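(* Let $d\ge2$ and let $D\subset\mathbb{R}^d$ be a bounded $\operatorname{CAT}(0)$ domain that satisfies a uniform exterior sphere condition based on a radius $r>0$ and a uniform interior cone condition based on a radius $\delta>0$ and angle $\alpha\in(0,\pi/2]$. Let $\varepsilon>0$. Then there is a positive constant $t_c$, depending only on the intrinsic diameter of $D$ and on $\varepsilon$, such that for every measurable unit-vector-valued function $H$ of time and all starting positions $x(0),y(0)$ in $D$, under the greedy pursuit strategy $$dx=\chi(x,y)\,dt-\nu_x\,dL^x,\qquad dy=H\,dt-\nu_y\,dL^y,$$ the Lion $x$ comes within intrinsic distance $\varepsilon/2$ of the Man $y$ before time $t_c$.
   Context: A domain is a connected open subset of $\mathbb{R}^d$. $\mathcal{B}(y,s)$ is the open Euclidean ball of radius $s$ centred at $y$. Uniform exterior sphere condition (based on radius $r>0$): for $x\in\partial D$ let $\mathcal{N}_{x,r}=\{\nu\in\mathbb{R}^d: |\nu|=1,\ \mathcal{B}(x+r\nu,r)\cap D=\varnothing\}$. The condition requires that for every $x\in\partial D$, $\mathcal{N}_{x,r}\neq\varnothing$ and $\mathcal{N}_{x,r}=\mathcal{N}_{x,s}$ for all $0<s\le r$. Uniform interior cone condition (based on radius $\delta>0$ and angle $\alpha\in(0,\pi/2]$): for every $x\in\partial D$ there is a unit vector $\mathbf m$ such that the cone $C(\mathbf m)=\{z:\langle z,\mathbf m\rangle>|z|\cos\alpha\}$ satisfies $(y+C(\mathbf m))\cap\mathcal{B}(x,\delta)\subseteq D$ for all $y\in D\cap\mathcal{B}(x,\delta)$.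 Intrinsic metric: $\operatorname{dist}_{\mathrm{intr}}(x,y)$ is the infimum of the lengths of smooth paths in $D$ connecting $x$ and $y$. Under the uniform interior cone condition, the completion of $D$ in this metric is identified with the Euclidean closure $\overline D$, to which $\operatorname{dist}_{\mathrm{intr}}$ extends by continuity. Intrinsic geodesics are paths in $\overline D$ attaining the infimum. The intrinsic diameter of $D$ is $\sup_{x,y\in D}\operatorname{dist}_{\mathrm{intr}}(x,y)$. $\operatorname{CAT}(0)$: $(D,\operatorname{dist}_{\mathrm{intr}})$ is $\operatorname{CAT}(0)$ if, whenever $\Gamma_{a,b},\Gamma_{a,c},\Gamma_{b,c}$ are unit-speed intrinsic geodesics connecting $a$ to $b$, $a$ to $c$, $b$ to $c$, one has $\operatorname{dist}_{\mathrm{intr}}(\Gamma_{a,b}(s),\Gamma_{a,c}(t))\le r(s,t)$, where $r(s,t)$ is the distance between the points at distance $s$, respectively $t$, from $\tilde a$ along the sides $\tilde a\tilde b$, respectively $\tilde a\tilde c$, of a Euclidean triangle $\tilde a\tilde b\tilde c$ with the same side lengths. The closure $\overline D$ inherits this property. For distinct $x,y\in\overline D$, $\chi(x,y)$ is the unit vector that is the initial velocity at $x$ of the unique unit-speed intrinsic geodesic from $x$ to $y$. Lion and Man system: $x,y$ are $\overline D$-valued trajectories, Lipschitz with constant $1$, satisfying the displayed equations in integrated form as long as $x\ne y$. The terms $\nu_x\,dL^x$ and $\nu_y\,dL^y$ are the Skorokhod reflection terms: $L^x$ (respectively $L^y$) is nondecreasing and increases only when $x\in\partial D$ (respectively $y\in\partial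 D$), with $\nu_x\in\mathcal N_{x,r}$, $\nu_y\in\mathcal N_{y,r}$ ($\nu_x\,dL^x$ in fact vanishes identically). *)

theory Defs
  imports "HOL-Analysis.Analysis"
begin

section \<open>All the spaces $\mathbb{R}^d$ inside one type\<close>

text \<open>
  The capture time below must not depend on the dimension, so it has to be chosen before \<open>d\<close>.
  An index type for \<open>real ^ 'n\<close> is fixed throughout a formula. Hence
  $\mathbb{R}^d$ is realised as the set of square-summable real sequences that vanish from
  index \<open>d\<close> on, with the norm, the inner product and the topology of \<open>\<ell>\<^sup>2\<close>. These
  restrict to the Euclidean ones (lemmas \<open>inner_Rd\<close> and \<open>norm_Rd\<close>).
\<close>

typedef ell2 = "{f :: nat \<Rightarrow> real. summable (\<lambda>i. (f i)\<^sup>2)}"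
  morphisms coord Abs_ell2
  by (rule exI[of _ "\<lambda>_. 0"]) simp

setup_lifting type_definition_ell2

lemma ell2_eqI: "(\<And>i. coord x i = coord y i) \<Longrightarrow> x = y"
  by (metis coord_inject ext)

lemma summable_coord: "summable (\<lambda>i. (coord x i)\<^sup>2)"
  using coord[of x] by simp

lemma summable_sq_add:
  assumes "summable (\<lambda>i. (f i)\<^sup>2)" "summable (\<lambda>i. (g i)\<^sup>2)"
  shows "summable (\<lambda>i. (f i + g i :: real)\<^sup>2)"
proof (rule summable_comparison_test')
  show "summable (\<lambda>i. 2 * (f i)\<^sup>2 + 2 * (g i)\<^sup>2)"
    using assms by (intro summable_add summable_mult)
next
  fix i :: nat
  have "(f i + g i)\<^sup>2 \<le> 2 * (f i)\<^sup>2 + 2 * (g i)\<^sup>2"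
    using zero_le_power2[of "f i - g i"] by (simp add: power2_eq_square algebra_simps)
  then show "norm ((f i + g i)\<^sup>2) \<le> 2 * (f i)\<^sup>2 + 2 * (g i)\<^sup>2" by simp
qed

lemma summable_mult_coord: "summable (\<lambda>i. coord x i * coord y i)"
proof (rule summable_comparison_test')
  show "summable (\<lambda>i. (coord x i)\<^sup>2 + (coord y i)\<^sup>2)"
    by (intro summable_add summable_coord)
next
  fix i :: nat
  have "2 * (\<bar>coord x i\<bar> * \<bar>coord y i\<bar>) \<le> (coord x i)\<^sup>2 + (coord y i)\<^sup>2"
    using zero_le_power2[of "\<bar>coord x i\<bar> - \<bar>coord y i\<bar>"]
    by (simp add: power2_eq_square algebra_simps)
  moreover have "0 \<le> \<bar>coord x i\<bar> * \<bar>coord y i\<bar>" by simp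
  ultimately show "norm (coord x i * coord y i) \<le> (coord x i)\<^sup>2 + (coord y i)\<^sup>2"
    unfolding real_norm_def abs_mult by linarith
qed

instantiation ell2 :: real_vector
begin

lift_definition zero_ell2 :: ell2 is "\<lambda>_. 0" by simp
lift_definition plus_ell2 :: "ell2 \<Rightarrow> ell2 \<Rightarrow> ell2" is "\<lambda>f g i. f i + g i"
  by (simp add: summable_sq_add)
lift_definition uminus_ell2 :: "ell2 \<Rightarrow> ell2" is "\<lambda>f i. - f i" by simp
lift_definition minus_ell2 :: "ell2 \<Rightarrow> ell2 \<Rightarrow> ell2" is "\<lambda>f g i. f i - g i"
  using summable_sq_add[of _ "\<lambda>i. - g i" for g] by fastforce
lift_definition scaleR_ell2 :: "real \<Rightarrow> ell2 \<Rightarrow> ell2" is "\<lambda>r f i. r * f i"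
  by (simp add: power_mult_distrib summable_mult)

instance
  by standard (transfer; simp add: fun_eq_iff algebra_simps)+

end

lemma coord_simps [simp]:
  "coord 0 i = 0" "coord (x + y) i = coord x i + coord y i" "coord (- x) i = - coord x i"
  "coord (x - y) i = coord x i - coord y i" "coord (r *\<^sub>R x) i = r * coord x i"
  by (transfer; simp)+

instantiation ell2 :: real_inner
begin

definition inner_ell2 :: "ell2 \<Rightarrow> ell2 \<Rightarrow> real" where
  "inner_ell2 x y = (\<Sum>i. coord x i * coord y i)"
definition norm_ell2 :: "ell2 \<Rightarrow> real" where "norm_ell2 x = sqrt (inner x x)"
definition dist_ell2 :: "ell2 \<Rightarrow> ell2 \<Rightarrow> real" where "dist_ell2 x y = norm (x - y)"
definition sgn_ell2 :: "ell2 \<Rightarrow> ell2" where "sgn_ell2 x = x /\<^sub>R norm x"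
definition uniformity_ell2 :: "(ell2 \<times> ell2) filter" where
  "uniformity_ell2 = (INF e\<in>{0<..}. principal {(x, y). dist x y < e})"
definition open_ell2 :: "ell2 set \<Rightarrow> bool" where
  "open_ell2 U \<longleftrightarrow> (\<forall>x\<in>U. eventually (\<lambda>(x', y). x' = x \<longrightarrow> y \<in> U) uniformity)"

instance
proof
  fix x y z :: ell2 and r :: real and U :: "ell2 set"
  show "dist x y = norm (x - y)" by (rule dist_ell2_def)
  show "sgn x = inverse (norm x) *\<^sub>R x" by (rule sgn_ell2_def)
  show "uniformity = (INF e\<in>{0<..}. principal {(x, y::ell2). dist x y < e})"
    by (rule uniformity_ell2_def)
  show "open U \<longleftrightarrow> (\<forall>x\<in>U. eventually (\<lambda>(x', y). x' = x \<longrightarrow> y \<in> U) uniformity)"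
    by (rule open_ell2_def)
  show "inner x y = inner y x" by (simp add: inner_ell2_def mult.commute)
  show "inner (x + y) z = inner x z + inner y z"
    by (simp add: inner_ell2_def distrib_right suminf_add[symmetric] summable_mult_coord)
  show "inner (r *\<^sub>R x) y = r * inner x y"
    by (simp add: inner_ell2_def mult.assoc suminf_mult summable_mult_coord)
  show "0 \<le> inner x x"
    by (simp add: inner_ell2_def suminf_nonneg summable_mult_coord)
  show "inner x x = 0 \<longleftrightarrow> x = 0"
  proof -
    have "inner x x = 0 \<longleftrightarrow> (\<forall>i. coord x i * coord x i = 0)"
      unfolding inner_ell2_def by (rule suminf_eq_zero_iff) (simp_all add: summable_mult_coord)
    also have "\<dots> \<longleftrightarrow> x = 0" by (auto intro: ell2_eqI)
    finally show ?thesis .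
  qed
  show "norm x = sqrt (inner x x)" by (rule norm_ell2_def)
qed

end

lemma norm_ell2_sq: "(norm (x :: ell2))\<^sup>2 = (\<Sum>i. (coord x i)\<^sup>2)"
  unfolding power2_norm_eq_inner inner_ell2_def by (simp add: power2_eq_square)

lemma abs_coord_le_norm: "\<bar>coord x i\<bar> \<le> norm x"
proof -
  have "(coord x i)\<^sup>2 = (\<Sum>j\<in>{i}. (coord x j)\<^sup>2)" by simp
  also have "\<dots> \<le> (\<Sum>j. (coord x j)\<^sup>2)"
    by (rule sum_le_suminf) (simp_all add: summable_coord)
  finally have "\<bar>coord x i\<bar>\<^sup>2 \<le> (norm x)\<^sup>2" by (simp add: norm_ell2_sq)
  then show ?thesis by (rule power2_le_imp_le) simp
qed

instance ell2 :: complete_space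
proof
  fix X :: "nat \<Rightarrow> ell2"
  assume X: "Cauchy X"
  define f where "f = (\<lambda>i. lim (\<lambda>m. coord (X m) i))"
  have "Cauchy (\<lambda>m. coord (X m) i)" for i
  proof (rule CauchyI)
    fix e :: real assume "0 < e"
    then obtain M where M: "\<And>m n. M \<le> m \<Longrightarrow> M \<le> n \<Longrightarrow> norm (X m - X n) < e"
      using CauchyD[OF X] by blast
    have "norm (coord (X m) i - coord (X n) i) < e" if "M \<le> m" "M \<le> n" for m n
      using abs_coord_le_norm[of "X m - X n" i] M[OF that] by simp
    then show "\<exists>M. \<forall>m\<ge>M. \<forall>n\<ge>M. norm (coord (X m) i - coord (X n) i) < e" by blast
  qed
  then have f: "(\<lambda>m. coord (X m) i) \<longlonglongrightarrow> f i" for i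
    by (simp add: f_def Cauchy_convergent_iff convergent_LIMSEQ_iff)
  have bound: "\<exists>M. \<forall>m\<ge>M. \<forall>N. (\<Sum>i<N. (coord (X m) i - f i)\<^sup>2) \<le> e\<^sup>2" if "0 < e" for e
  proof -
    obtain M where M: "\<And>m n. M \<le> m \<Longrightarrow> M \<le> n \<Longrightarrow> norm (X m - X n) < e"
      using CauchyD[OF X \<open>0 < e\<close>] by blast
    have "(\<Sum>i<N. (coord (X m) i - f i)\<^sup>2) \<le> e\<^sup>2" if m: "M \<le> m" for m N
    proof (rule tendsto_upperbound)
      show "(\<lambda>n. \<Sum>i<N. (coord (X m) i - coord (X n) i)\<^sup>2) \<longlonglongrightarrow> (\<Sum>i<N. (coord (X m) i - f i)\<^sup>2)"
        by (intro tendsto_intros f)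
      show "\<forall>\<^sub>F n in sequentially. (\<Sum>i<N. (coord (X m) i - coord (X n) i)\<^sup>2) \<le> e\<^sup>2"
      proof (rule eventually_sequentiallyI)
        fix n assume n: "M \<le> n"
        have "(\<Sum>i<N. (coord (X m - X n) i)\<^sup>2) \<le> (norm (X m - X n))\<^sup>2"
          unfolding norm_ell2_sq by (rule sum_le_suminf) (simp_all only: summable_coord finite_lessThan zero_le_power2)
        also have "\<dots> \<le> e\<^sup>2"
          using M[OF m n] by (intro power_mono) auto
        finally show "(\<Sum>i<N. (coord (X m) i - coord (X n) i)\<^sup>2) \<le> e\<^sup>2" by simp
      qed
    qed simp
    then show ?thesis by blast
  qed
  obtain M where "\<And>N. (\<Sum>i<N. (coord (X M) i - f i)\<^sup>2) \<le> 1"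
    using bound[of 1] by auto
  then have "summable (\<lambda>i. (coord (X M) i - f i)\<^sup>2)"
    by (intro bounded_imp_summable[where B = 1]) (auto simp: lessThan_Suc_atMost[symmetric] simp del: sum.lessThan_Suc)
  then have "summable (\<lambda>i. (f i - coord (X M) i)\<^sup>2)"
    by (simp add: power2_commute)
  from summable_sq_add[OF this summable_coord[of "X M"]]
  have f_sq: "summable (\<lambda>i. (f i)\<^sup>2)" by simp
  define x where "x = Abs_ell2 f"
  have x: "coord x i = f i" for i
    using f_sq by (simp add: x_def Abs_ell2_inverse)
  have "X \<longlonglongrightarrow> x"
  proof (rule LIMSEQ_I)
    fix e :: real assume e: "0 < e"
    obtain M where M: "\<And>m N. M \<le> m \<Longrightarrow> (\<Sum>i<N. (coord (X m) i - f i)\<^sup>2) \<le> (e / 2)\<^sup>2"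
      using bound[of "e / 2"] e by auto
    have "norm (X m - x) < e" if "M \<le> m" for m
    proof -
      have "(\<Sum>i. (coord (X m - x) i)\<^sup>2) \<le> (e / 2)\<^sup>2"
        by (rule suminf_le_const[OF summable_coord]) (simp add: x M[OF that])
      then have "(norm (X m - x))\<^sup>2 \<le> (e / 2)\<^sup>2" by (simp only: norm_ell2_sq)
      moreover have "0 \<le> e / 2" using e by simp
      ultimately have "norm (X m - x) \<le> e / 2" by (rule power2_le_imp_le)
      then show ?thesis using e by simp
    qed
    then show "\<exists>M. \<forall>m\<ge>M. norm (X m - x) < e" by blast
  qed
  then show "convergent X" by (rule convergentI)
qed

instance ell2 :: banach ..

text \<open>The set \<open>Rd d\<close> is $\mathbb{R}^d$.\<close>

definition Rd :: "nat \<Rightarrow> ell2 set" where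
  "Rd d = {x. \<forall>i\<ge>d. coord x i = 0}"

lemma inner_Rd:
  assumes "x \<in> Rd d"
  shows "inner x y = (\<Sum>i<d. coord x i * coord y i)"
  using assms unfolding inner_ell2_def Rd_def by (intro suminf_finite) auto

lemma norm_Rd: "x \<in> Rd d \<Longrightarrow> norm x = sqrt (\<Sum>i<d. (coord x i)\<^sup>2)"
  unfolding norm_eq_sqrt_inner by (simp add: inner_Rd power2_eq_square)

lemma Rd_coords: "\<exists>!x. x \<in> Rd d \<and> (\<forall>i<d. coord x i = f i)"
proof -
  have "summable (\<lambda>i. (if i < d then f i else 0 :: real)\<^sup>2)"
    by (rule summable_finite[of "{..<d}"]) auto
  then have "coord (Abs_ell2 (\<lambda>i. if i < d then f i else 0)) i = (if i < d then f i else 0)" for i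
    by (simp add: Abs_ell2_inverse)
  then have "\<exists>x. x \<in> Rd d \<and> (\<forall>i<d. coord x i = f i)"
    by (intro exI[of _ "Abs_ell2 (\<lambda>i. if i < d then f i else 0)"]) (auto simp: Rd_def)
  moreover have "x = y" if "x \<in> Rd d \<and> (\<forall>i<d. coord x i = f i)"
    "y \<in> Rd d \<and> (\<forall>i<d. coord y i = f i)" for x y
  proof (rule ell2_eqI)
    fix i show "coord x i = coord y i"
      using that by (cases "i < d") (auto simp: Rd_def)
  qed
  ultimately show ?thesis by blast
qed

lemma subspace_Rd: "subspace (Rd d)"
  by (auto simp: subspace_def Rd_def)

lemma closed_Rd: "closed (Rd d)"
proof -
  have "bounded_linear (\<lambda>x. coord x i)" for i
    by (rule bounded_linear_intro[of _ 1]) (auto simp: abs_coord_le_norm)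
  then have "continuous_on UNIV (\<lambda>x. coord x i)" for i
    by (rule linear_continuous_on)
  then have "closed {x. coord x i = 0}" for i
    by (intro closed_Collect_eq) auto
  moreover have "Rd d = (\<Inter>i\<in>{d..}. {x. coord x i = 0})" by (auto simp: Rd_def)
  ultimately show ?thesis by auto
qed

instance ell2 :: second_countable_topology
proof
  define Q where "Q = {x :: ell2. (\<forall>i. coord x i \<in> \<rat>) \<and> (\<exists>n. x \<in> Rd n)}"
  have "countable {x \<in> Rd n. \<forall>i<n. coord x i \<in> \<rat>}" for n
  proof (rule countableI')
    show "inj_on (\<lambda>x. to_nat (map (\<lambda>i. SOME q :: rat. coord x i = of_rat q) [0..<n]))
        {x \<in> Rd n. \<forall>i<n. coord x i \<in> \<rat>}"
    proof (rule inj_onI, clarsimp)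
      fix x y :: ell2
      assume x: "x \<in> Rd n" "\<forall>i<n. coord x i \<in> \<rat>" and y: "y \<in> Rd n" "\<forall>i<n. coord y i \<in> \<rat>"
        and eq: "\<forall>i\<in>{0..<n}. (SOME q :: rat. coord x i = of_rat q) = (SOME q. coord y i = of_rat q)"
      have "coord x i = coord y i" if "i < n" for i
      proof -
        have "coord x i = of_rat (SOME q. coord x i = of_rat q)"
          using x(2) that by (intro someI_ex[of "\<lambda>q. coord x i = of_rat q"]) (auto elim: Rats_cases)
        moreover have "coord y i = of_rat (SOME q. coord y i = of_rat q)"
          using y(2) that by (intro someI_ex[of "\<lambda>q. coord y i = of_rat q"]) (auto elim: Rats_cases)
        ultimately show ?thesis using eq that by simp
      qed
      then show "x = y" using x(1) y(1) Rd_coords[of n "coord x"] by auto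
    qed
  qed
  then have "countable (\<Union>n. {x \<in> Rd n. \<forall>i<n. coord x i \<in> \<rat>})" by auto
  then have countable_Q: "countable Q" by (rule countable_subset[rotated]) (auto simp: Q_def)
  have dense_Q: "\<exists>q\<in>Q. dist q x < e" if e: "0 < e" for x e
  proof -
    have "(\<lambda>n. \<Sum>i<n. (coord x i)\<^sup>2) \<longlonglongrightarrow> (\<Sum>i. (coord x i)\<^sup>2)"
      using summable_LIMSEQ[OF summable_coord] .
    from LIMSEQ_D[OF this, of "(e / 2)\<^sup>2"] e obtain n
      where "norm ((\<Sum>i<n. (coord x i)\<^sup>2) - (\<Sum>i. (coord x i)\<^sup>2)) < (e / 2)\<^sup>2" by auto
    then have n: "(\<Sum>i. (coord x i)\<^sup>2) - (\<Sum>i<n. (coord x i)\<^sup>2) < (e / 2)\<^sup>2"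
      by (auto simp: abs_less_iff)
    define c where "c = e / (2 * (real n + 1))"
    have c: "0 < c" using e by (simp add: c_def)
    have "\<exists>q. q \<in> \<rat> \<and> \<bar>q - coord x i\<bar> < c" for i
    proof -
      obtain q where "q \<in> \<rat>" "coord x i - c < q" "q < coord x i + c"
        using Rats_dense_in_real[of "coord x i - c" "coord x i + c"] c by auto
      then show ?thesis by (intro exI[of _ q]) auto
    qed
    then have "\<exists>f. \<forall>i. f i \<in> \<rat> \<and> \<bar>f i - coord x i\<bar> < c" by (intro choice allI)
    then obtain f where f: "\<And>i. f i \<in> \<rat>" "\<And>i. \<bar>f i - coord x i\<bar> < c" by auto
    obtain q where q: "q \<in> Rd n" "\<And>i. i < n \<Longrightarrow> coord q i = f i" using Rd_coords by blast
    have qi: "coord q i = (if i < n then f i else 0)" for i using q by (auto simp: Rd_def)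
    obtain p where p: "p \<in> Rd n" "\<And>i. i < n \<Longrightarrow> coord p i = coord x i" using Rd_coords by blast
    have pi: "coord p i = (if i < n then coord x i else 0)" for i using p by (auto simp: Rd_def)
    have "norm (q - p) \<le> e / 2"
    proof -
      have "q - p \<in> Rd n" using q(1) p(1) subspace_Rd by (simp add: subspace_diff)
      then have "norm (q - p) = sqrt (\<Sum>i<n. (coord (q - p) i)\<^sup>2)" by (rule norm_Rd)
      also have "\<dots> = L2_set (coord (q - p)) {..<n}" by (simp add: L2_set_def)
      also have "\<dots> \<le> (\<Sum>i<n. \<bar>coord (q - p) i\<bar>)" by (rule L2_set_le_sum_abs)
      also have "\<dots> \<le> (\<Sum>i<n. c)"
        by (rule sum_mono) (use f(2) in \<open>auto simp: qi pi intro: less_imp_le\<close>)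
      also have "\<dots> \<le> e / 2" using e by (simp add: c_def field_simps)
      finally show ?thesis .
    qed
    moreover have "norm (p - x) < e / 2"
    proof -
      have "(norm (p - x))\<^sup>2 = (\<Sum>i. (coord x i)\<^sup>2 - (if i < n then (coord x i)\<^sup>2 else 0))"
        unfolding norm_ell2_sq by (rule suminf_cong) (simp add: pi)
      also have "\<dots> = (\<Sum>i. (coord x i)\<^sup>2) - (\<Sum>i. if i < n then (coord x i)\<^sup>2 else 0)"
        by (rule suminf_diff[symmetric]) (auto intro: summable_coord summable_finite[of "{..<n}"])
      also have "(\<Sum>i. if i < n then (coord x i)\<^sup>2 else 0) = (\<Sum>i<n. (coord x i)\<^sup>2)"
        by (subst suminf_finite[of "{..<n}"]) auto
      also note n
      finally show ?thesis using e by (intro power_less_imp_less_base[of _ 2 "e / 2"]) auto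
    qed
    ultimately have "norm (q - x) < e"
      using norm_triangle_ineq[of "q - p" "p - x"] by simp
    moreover have "q \<in> Q" using q(1) f(1) by (auto simp: Q_def qi)
    ultimately show ?thesis by (auto simp: dist_norm)
  qed
  define B where "B = (\<lambda>(q, n). ball q (1 / real (Suc n))) ` (Q \<times> (UNIV :: nat set))"
  have "countable B" using countable_Q by (auto simp: B_def)
  moreover have "topological_basis B"
  proof (rule topological_basisI)
    show "open B'" if "B' \<in> B" for B' using that by (auto simp: B_def)
    fix U :: "ell2 set" and x assume "open U" "x \<in> U"
    then obtain e where e: "0 < e" "ball x e \<subseteq> U" using openE by blast
    then obtain n where n: "1 / real (Suc n) < e / 2"
      using nat_approx_posE[of "e / 2"] by auto
    obtain q where q: "q \<in> Q" "dist q x < 1 / real (Suc n)" using dense_Q[of "1 / real (Suc n)"] by auto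
    have "ball q (1 / real (Suc n)) \<subseteq> ball x e"
    proof
      fix z assume "z \<in> ball q (1 / real (Suc n))"
      then show "z \<in> ball x e"
        using q(2) n dist_triangle[of x z q] by (simp add: dist_commute)
    qed
    moreover have "ball q (1 / real (Suc n)) \<in> B" using q(1) by (auto simp: B_def)
    ultimately show "\<exists>B'\<in>B. x \<in> B' \<and> B' \<subseteq> U" using q(2) e(2) by (intro bexI[of _ "ball q (1 / real (Suc n))"]) auto
  qed
  ultimately show "\<exists>B :: ell2 set set. countable B \<and> open = generate_topology B"
    by (blast intro: topological_basis_imp_subbasis)
qed


section \<open>Domains\<close>

text \<open>
  \<open>E\<close> is the ambient Euclidean space, used at \<open>E = Rd d\<close>. Openness and boundaries are
  relative to \<open>E\<close>; since \<open>E\<close> is closed, the closure of a subset of \<open>E\<close> is the same in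
  \<open>E\<close> and in the whole type. Likewise \<open>ball x s\<close> meets subsets of \<open>E\<close> exactly as the
  ball of \<open>E\<close> does when \<open>x \<in> E\<close>.
\<close>

definition domain_in :: "'a::real_inner set \<Rightarrow> 'a set \<Rightarrow> bool" where
  "domain_in E D \<longleftrightarrow> openin (top_of_set E) D \<and> connected D"

definition boundary_in :: "'a::real_inner set \<Rightarrow> 'a set \<Rightarrow> 'a set" where
  "boundary_in E D = top_of_set E frontier_of D"

definition exterior_normals :: "'a::real_inner set \<Rightarrow> 'a set \<Rightarrow> real \<Rightarrow> 'a \<Rightarrow> 'a set" where
  "exterior_normals E D r x = {\<nu> \<in> E. norm \<nu> = 1 \<and> ball (x + r *\<^sub>R \<nu>) r \<inter> D = {}}"

definition uniform_exterior_sphere :: "'a::real_inner set \<Rightarrow> 'a set \<Rightarrow> real \<Rightarrow> bool" where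
  "uniform_exterior_sphere E D r \<longleftrightarrow>
     0 < r \<and>
     (\<forall>x \<in> boundary_in E D. exterior_normals E D r x \<noteq> {} \<and>
        (\<forall>s. 0 < s \<and> s \<le> r \<longrightarrow> exterior_normals E D r x = exterior_normals E D s x))"

definition open_cone :: "'a::real_inner set \<Rightarrow> real \<Rightarrow> 'a \<Rightarrow> 'a set" where
  "open_cone E \<alpha> m = {z \<in> E. inner z m > norm z * cos \<alpha>}"

definition uniform_interior_cone ::
    "'a::real_inner set \<Rightarrow> 'a set \<Rightarrow> real \<Rightarrow> real \<Rightarrow> bool" where
  "uniform_interior_cone E D \<delta> \<alpha> \<longleftrightarrow>
     0 < \<delta> \<and> 0 < \<alpha> \<and> \<alpha> \<le> pi / 2 \<and>
     (\<forall>x \<in> boundary_in E D. \<exists>m \<in> E. norm m = 1 \<and>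
        (\<forall>y \<in> D \<inter> ball x \<delta>. ((+) y ` open_cone E \<alpha> m) \<inter> ball x \<delta> \<subseteq> D))"


section \<open>The intrinsic metric and its geodesics\<close>

text \<open>\<open>C\<^sup>\<infinity>\<close> on \<open>[0, 1]\<close>, with one-sided derivatives at the end points: \<open>G k\<close> is the
  \<open>k\<close>-th derivative of \<open>g\<close>.\<close>

definition smooth_path :: "(real \<Rightarrow> 'a::real_normed_vector) \<Rightarrow> bool" where
  "smooth_path g \<longleftrightarrow>
     (\<exists>G. G 0 = g \<and>
        (\<forall>k. \<forall>t\<in>{0..1}. (G k has_vector_derivative G (Suc k) t) (at t within {0..1})))"

definition smooth_path_length :: "(real \<Rightarrow> 'a::real_normed_vector) \<Rightarrow> real" where
  "smooth_path_length g =
     integral {0..1} (\<lambda>t. norm (vector_derivative g (at t within {0..1})))"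

definition smooth_path_dist :: "'a::real_normed_vector set \<Rightarrow> 'a \<Rightarrow> 'a \<Rightarrow> real" where
  "smooth_path_dist D x y =
     Inf {smooth_path_length g | g.
       smooth_path g \<and> path_image g \<subseteq> D \<and> pathstart g = x \<and> pathfinish g = y}"

text \<open>On pairs of points of the closure of \<open>D\<close> that do not both lie in \<open>D\<close>, the metric is
  the continuous extension from \<open>D \<times> D\<close>.\<close>

definition intrinsic_dist :: "'a::real_normed_vector set \<Rightarrow> 'a \<Rightarrow> 'a \<Rightarrow> real" where
  "intrinsic_dist D x y =
     (if x \<in> D \<and> y \<in> D then smooth_path_dist D x y
      else Lim (at (x, y) within D \<times> D) (\<lambda>(u, v). smooth_path_dist D u v))"

definition intrinsic_diameter :: "'a::real_normed_vector set \<Rightarrow> real" where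
  "intrinsic_diameter D = (SUP (x, y) \<in> D \<times> D. intrinsic_dist D x y)"

text \<open>The Euclidean length of a path on \<open>[a, b]\<close>, as the supremum of the lengths of inscribed
  polygons. Geodesics run in the closure of \<open>D\<close> and need not be smooth.\<close>

definition curve_length :: "(real \<Rightarrow> 'a::metric_space) \<Rightarrow> real \<Rightarrow> real \<Rightarrow> ennreal" where
  "curve_length \<gamma> a b =
     (SUP (n, p) \<in> {(n, p). mono_on {..n} p \<and> p ` {..n} \<subseteq> {a..b}}.
        ennreal (\<Sum>i<n. dist (\<gamma> (p i)) (\<gamma> (p (Suc i)))))"

text \<open>With \<open>s = 0\<close> and \<open>t = intrinsic_dist D x y\<close>, the last condition says that the length of
  \<open>\<gamma>\<close> attains the infimum defining \<open>intrinsic_dist D x y\<close>; the other cases are unit speed.\<close>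

definition unit_speed_geodesic ::
    "'a::real_normed_vector set \<Rightarrow> 'a \<Rightarrow> 'a \<Rightarrow> (real \<Rightarrow> 'a) \<Rightarrow> bool" where
  "unit_speed_geodesic D x y \<gamma> \<longleftrightarrow>
     continuous_on {0..intrinsic_dist D x y} \<gamma> \<and>
     \<gamma> ` {0..intrinsic_dist D x y} \<subseteq> closure D \<and>
     \<gamma> 0 = x \<and> \<gamma> (intrinsic_dist D x y) = y \<and>
     (\<forall>s t. 0 \<le> s \<and> s \<le> t \<and> t \<le> intrinsic_dist D x y \<longrightarrow>
        curve_length \<gamma> s t = ennreal (t - s))"

text \<open>\<open>a' + s *\<^sub>R sgn (b' - a')\<close> is the point at distance \<open>s\<close> from \<open>a'\<close> along the side
  \<open>a' b'\<close> of the comparison triangle.\<close>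

definition CAT0_domain :: "'a::real_normed_vector set \<Rightarrow> bool" where
  "CAT0_domain D \<longleftrightarrow>
     (\<forall>a\<in>D. \<forall>b\<in>D. \<forall>c\<in>D. \<forall>\<gamma>ab \<gamma>ac \<gamma>bc.
        unit_speed_geodesic D a b \<gamma>ab \<and> unit_speed_geodesic D a c \<gamma>ac \<and>
        unit_speed_geodesic D b c \<gamma>bc \<longrightarrow>
        (\<forall>a' b' c' :: real ^ 2.
           dist a' b' = intrinsic_dist D a b \<and> dist a' c' = intrinsic_dist D a c \<and>
           dist b' c' = intrinsic_dist D b c \<longrightarrow>
           (\<forall>s \<in> {0..intrinsic_dist D a b}. \<forall>t \<in> {0..intrinsic_dist D a c}.
              intrinsic_dist D (\<gamma>ab s) (\<gamma>ac t)
                \<le> dist (a' + s *\<^sub>R sgn (b' - a')) (a' + t *\<^sub>R sgn (c' - a')))))"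

definition geodesic_direction :: "'a::real_normed_vector set \<Rightarrow> 'a \<Rightarrow> 'a \<Rightarrow> 'a" where
  "geodesic_direction D x y =
     (THE \<nu>. norm \<nu> = 1 \<and>
        (\<exists>\<gamma>. unit_speed_geodesic D x y \<gamma> \<and>
           (\<gamma> has_vector_derivative \<nu>) (at 0 within {0..intrinsic_dist D x y})))"


section \<open>The pursuit\<close>

text \<open>\<open>dL\<close> is the Lebesgue--Stieltjes measure of \<open>L\<close> on \<open>(0, \<infinity>)\<close>, so the values of \<open>L\<close> at
  negative times do not matter. That \<open>L\<close> increases only when \<open>z\<close> is on the boundary means
  that \<open>dL\<close> is carried by those times; the direction \<open>\<nu>\<close> matters only up to \<open>dL\<close>-null
  sets.\<close>

definition reflection_term ::
    "'a::real_inner set \<Rightarrow> 'a set \<Rightarrow> real \<Rightarrow> (real \<Rightarrow> 'a) \<Rightarrow> (real \<Rightarrow> real) \<Rightarrow> (real \<Rightarrow> 'a) \<Rightarrow> bool" where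
  "reflection_term E D r z L \<nu> \<longleftrightarrow>
     mono L \<and> (\<forall>t. continuous (at_right t) L) \<and> \<nu> \<in> borel_measurable borel \<and>
     (AE t in interval_measure L. 0 < t \<longrightarrow>
        z t \<in> boundary_in E D \<and> \<nu> t \<in> exterior_normals E D r (z t))"

text \<open>The man's motion equation and the lion's greedy pursuit, in integrated form, up to the
  first meeting time. \<open>\<nu> \<in> exterior_normals\<close> points out of \<open>D\<close>, hence the minus signs.\<close>

definition greedy_pursuit ::
    "'a::{real_inner, banach, second_countable_topology} set \<Rightarrow> 'a set \<Rightarrow> real \<Rightarrow> (real \<Rightarrow> 'a) \<Rightarrow>
     (real \<Rightarrow> 'a) \<Rightarrow> (real \<Rightarrow> 'a) \<Rightarrow> bool" where
  "greedy_pursuit E D r H x y \<longleftrightarrow>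
     x ` {0..} \<subseteq> closure D \<and> y ` {0..} \<subseteq> closure D \<and>
     1-lipschitz_on {0..} x \<and> 1-lipschitz_on {0..} y \<and>
     (\<exists>Lx \<nu>x Ly \<nu>y.
        reflection_term E D r x Lx \<nu>x \<and> reflection_term E D r y Ly \<nu>y \<and>
        (\<forall>t\<ge>0. (\<forall>s\<in>{0..t}. x s \<noteq> y s) \<longrightarrow>
           set_integrable lebesgue {0..t} (\<lambda>s. geodesic_direction D (x s) (y s)) \<and>
           x t = x 0 + (LINT s:{0..t}|lebesgue. geodesic_direction D (x s) (y s))
                     - (LINT s:{0<..t}|interval_measure Lx. \<nu>x s) \<and>
           y t = y 0 + (LINT s:{0..t}|lebesgue. H s)
                     - (LINT s:{0<..t}|interval_measure Ly. \<nu>y s)))"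

end

theory Submission
  imports Defs
begin

text \<open>
  The capture time comes from a Lyapunov function. Write \<open>d\<close> for the intrinsic metric on the
  closure of \<open>D\<close>, \<open>M\<close> for the intrinsic diameter, and fix a point \<open>p\<close> of the closure. With
  \<open>K = 8 * M\<^sup>2 / \<epsilon>\<close> consider along the pursuit
  \<open>\<Phi> = (d p y)\<^sup>2 - (d p x)\<^sup>2 - K * d x y\<close>.
  In a Euclidean space, with the Lion at unit speed \<open>u = (y - x) / \<bar>y - x\<bar>\<close> and the Man at velocity \<open>v\<close>, the
  first two terms grow at rate \<open>2 * \<bar>y - x\<bar> + 2 * \<langle>y - p, v - u\<rangle>\<close>, while the separation shrinks at rate
  \<open>\<lambda> = 1 - \<langle>u, v\<rangle>\<close>, and \<open>\<bar>v - u\<bar>\<^sup>2 \<le> 2 * \<lambda>\<close> because \<open>\<bar>v\<bar> \<le> 1\<close>. So either the Man runs almost straight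
  away from the Lion, and then the difference of squares grows, or the separation drops, and
  the term with \<open>K\<close> pays for the defect. In both cases \<open>\<Phi>\<close> grows at rate at least \<open>\<epsilon> / 2\<close> as
  long as \<open>d x y > \<epsilon> / 2\<close>. Since \<open>\<bar>\<Phi>\<bar>\<close> is bounded in terms of \<open>M\<close> and \<open>\<epsilon>\<close>, this
  cannot go on for long. In a CAT(0) space the same computation works with difference
  quotients: the comparison inequality replaces the parallelogram law, and no angles or first
  variation formulas are needed (lemmas \<open>pursuit_step\<close> and \<open>pursuit_time_bound\<close>). The Man enters
  only through \<open>d (y t) (y (t + h)) \<le> h\<close>, and the Lion only through the fact that \<open>x (t + h)\<close> is within
  \<open>o(h)\<close> of the point at distance \<open>h\<close> on the geodesic from \<open>x t\<close> to \<open>y t\<close>.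

  The rest of the work is to supply the geometry behind these two facts.

  Distances in \<open>D\<close> are infima over smooth paths. Smooth paths are joined by slowing them down to
  infinite order at the junction (\<open>connects_join\<close>); this gives the triangle inequality.

  The exterior spheres make the nearest point projection Lipschitz with a constant close to 1 near
  the closure of \<open>D\<close>, so the projection of a short segment is a chain of almost the same length; the
  interior cones push this chain into \<open>D\<close>. Hence \<open>d x y \<le> \<bar>x - y\<bar> + \<bar>x - y\<bar>\<^sup>2 / r\<close> for close points
  (\<open>path_dist_le_of_near\<close>, \<open>d_le_quadratic\<close>). This one estimate has four consequences: \<open>d\<close> extends
  continuously to the compact closure; \<open>d\<close> is the length metric of curves in the closure; geodesics
  are characterised by \<open>d (\<gamma> s) (\<gamma> t) = \<bar>s - t\<bar>\<close>; and a geodesic is so close to straight on short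
  intervals that it has an initial velocity, with a uniform rate (\<open>geod_initial_velocity\<close>).

  The CAT(0) inequality passes to the closure and makes geodesics unique and dependent
  continuously on their ends. With the uniform rate this makes the initial direction of geodesics continuous.
  As it never points out of the domain, a reflection could only add to the unit speed of the
  Lion, who is 1-Lipschitz; so the reflection term vanishes and the velocity of the Lion is the
  direction of pursuit at all times (\<open>lion_follows_direction\<close>).
\<close>

section \<open>Smooth functions and a flat step\<close>

definition smooth_on :: "real set \<Rightarrow> (real \<Rightarrow> 'a::real_normed_vector) \<Rightarrow> bool" where
  "smooth_on S f \<longleftrightarrow>
     (\<exists>G. G 0 = f \<and> (\<forall>k. \<forall>t\<in>S. (G k has_vector_derivative G (Suc k) t) (at t within S)))"

lemma smooth_path_iff_smooth_on: "smooth_path g \<longleftrightarrow> smooth_on {0..1} g"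
  by (simp add: smooth_path_def smooth_on_def)

text \<open>
  Smoothness by coinduction: a class of differentiable functions that contains a derivative of each
  member consists of smooth functions. No formula for higher derivatives is ever needed.
\<close>

lemma smooth_onI_derivative_closed:
  assumes "f \<in> F"
    and "\<And>g. g \<in> F \<Longrightarrow> \<exists>g'\<in>F. \<forall>t\<in>S. (g has_vector_derivative g' t) (at t within S)"
  shows "smooth_on S f"
proof -
  obtain D where D: "\<And>g. g \<in> F \<Longrightarrow> D g \<in> F"
    "\<And>g t. g \<in> F \<Longrightarrow> t \<in> S \<Longrightarrow> (g has_vector_derivative D g t) (at t within S)"
    using assms(2) by metis
  have "(D ^^ k) f \<in> F" for k
    by (induction k) (use assms(1) D(1) in auto)
  then show ?thesis
    unfolding smooth_on_def by (intro exI[of _ "\<lambda>k. (D ^^ k) f"]) (auto intro: D(2))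
qed

lemma smooth_on_const: "smooth_on S (\<lambda>_. c)"
  by (rule smooth_onI_derivative_closed[where F = "range (\<lambda>c _. c)"])
     (auto intro!: derivative_eq_intros)

lemma smooth_on_add:
  assumes "smooth_on S f" "smooth_on S g"
  shows "smooth_on S (\<lambda>t. f t + g t)"
proof -
  obtain F G where "F 0 = f" "\<And>k t. t \<in> S \<Longrightarrow> (F k has_vector_derivative F (Suc k) t) (at t within S)"
    and "G 0 = g" "\<And>k t. t \<in> S \<Longrightarrow> (G k has_vector_derivative G (Suc k) t) (at t within S)"
    using assms unfolding smooth_on_def by auto
  then show ?thesis
    unfolding smooth_on_def
    by (intro exI[of _ "\<lambda>k t. F k t + G k t"]) (auto intro!: derivative_eq_intros)
qed

lemma has_vector_derivative_affine:
  assumes "(f has_vector_derivative f') (at (a * t + b) within T)" "(\<lambda>t. a * t + b) ` S \<subseteq> T"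
  shows "((\<lambda>t. f (a * t + b)) has_vector_derivative a *\<^sub>R f') (at t within S)"
proof -
  have "((\<lambda>t. a * t + b) has_vector_derivative a) (at t within S)"
    by (auto intro!: derivative_eq_intros)
  moreover have "(f has_vector_derivative f') (at (a * t + b) within (\<lambda>t. a * t + b) ` S)"
    using assms by (auto intro: has_vector_derivative_within_subset)
  ultimately show ?thesis
    using vector_diff_chain_within[of "\<lambda>t. a * t + b" a t S f f'] by (simp add: o_def)
qed

lemma smooth_on_affine:
  assumes "smooth_on T f" "(\<lambda>t. a * t + b) ` S \<subseteq> T"
  shows "smooth_on S (\<lambda>t. f (a * t + b))"
proof -
  obtain G where G: "G 0 = f" "\<And>k t. t \<in> T \<Longrightarrow> (G k has_vector_derivative G (Suc k) t) (at t within T)"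
    using assms(1) unfolding smooth_on_def by auto
  have "((\<lambda>t. a ^ k *\<^sub>R G k (a * t + b)) has_vector_derivative a ^ Suc k *\<^sub>R G (Suc k) (a * t + b))
      (at t within S)" if "t \<in> S" for k t
  proof -
    have "((\<lambda>t. G k (a * t + b)) has_vector_derivative a *\<^sub>R G (Suc k) (a * t + b)) (at t within S)"
      by (rule has_vector_derivative_affine[OF G(2)]) (use assms(2) that in auto)
    from has_vector_derivative_scaleR[OF DERIV_const[of "a ^ k" "at t within S"] this]
    show ?thesis by (simp add: mult.commute)
  qed
  then show ?thesis
    unfolding smooth_on_def using G(1)
    by (intro exI[of _ "\<lambda>k t. a ^ k *\<^sub>R G k (a * t + b)"]) auto
qed

text \<open>
  The bump \<open>exp (- 1 / (t (1 - t)))\<close> on the unit interval, times powers of \<open>1 / (t (1 - t))\<close>: these powers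
  are what differentiation produces.
\<close>

definition flat_exp :: "nat \<Rightarrow> real \<Rightarrow> real" where
  "flat_exp k t =
     (if 0 < t \<and> t < 1 then (1 / (t * (1 - t))) ^ k * exp (- (1 / (t * (1 - t)))) else 0)"

lemma flat_exp_nonneg: "0 \<le> flat_exp k t"
  by (simp add: flat_exp_def)

lemma power_mult_exp_minus_le_fact:
  assumes "0 \<le> (y::real)" shows "y ^ n * exp (- y) \<le> fact n"
proof -
  have "y ^ n / fact n \<le> exp y"
  proof -
    have "(\<Sum>i<Suc n. y ^ i /\<^sub>R fact i) \<le> exp y"
      unfolding exp_def using assms
      by (intro sum_le_suminf summable_exp_generic) auto
    moreover have "y ^ n / fact n \<le> (\<Sum>i<Suc n. y ^ i /\<^sub>R fact i)"
      using assms by (simp add: sum_nonneg field_simps)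
    ultimately show ?thesis by simp
  qed
  then have "y ^ n \<le> fact n * exp y" by (simp add: field_simps)
  then show ?thesis by (simp add: exp_minus field_simps)
qed

text \<open>
  The exponential beats every power of \<open>1 / (t (1 - t))\<close>, leaving two spare factors
  \<open>t (1 - t) \<le> \<bar>t - s\<bar>\<close>. This gives derivative zero at and outside the ends of the interval.
\<close>

lemma flat_exp_quadratic_bound:
  assumes "s \<le> 0 \<or> 1 \<le> s"
  shows "\<bar>flat_exp k t\<bar> \<le> fact (k + 2) * (t - s)\<^sup>2"
proof (cases "0 < t \<and> t < 1")
  case True
  define w where "w = t * (1 - t)"
  have "w \<le> t" "w \<le> 1 - t"
    using True mult_left_le[of "1 - t" t] mult_left_le[of t "1 - t"]
    by (auto simp: w_def mult.commute)
  moreover have "0 < w" using True by (simp add: w_def)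
  ultimately have w: "0 < w" "w \<le> \<bar>t - s\<bar>"
    using True assms by auto
  have "flat_exp k t = w\<^sup>2 * ((1 / w) ^ (k + 2) * exp (- (1 / w)))"
    using True w(1) by (simp add: flat_exp_def w_def[symmetric] power_add power2_eq_square)
  also have "\<dots> \<le> w\<^sup>2 * fact (k + 2)"
    using w(1) by (intro mult_left_mono power_mult_exp_minus_le_fact) auto
  also have "\<dots> \<le> \<bar>t - s\<bar>\<^sup>2 * fact (k + 2)"
    using w by (intro mult_right_mono power_mono) auto
  finally have "flat_exp k t \<le> fact (k + 2) * (t - s)\<^sup>2" by (simp add: mult.commute)
  moreover have "0 \<le> flat_exp k t" using True by (simp add: flat_exp_def)
  ultimately show ?thesis by simp
qed (auto simp: flat_exp_def)

lemma DERIV_zero_if_quadratic_bound: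
  fixes f :: "real \<Rightarrow> real"
  assumes "\<And>t. \<bar>f t - f s\<bar> \<le> C * (t - s)\<^sup>2"
  shows "(f has_real_derivative 0) (at s)"
  unfolding DERIV_def
proof (rule Lim_null_comparison)
  show "\<forall>\<^sub>F h in at 0. norm ((f (s + h) - f s) / h) \<le> C * \<bar>h\<bar>"
  proof (rule eventually_at_filter[THEN iffD2], rule always_eventually, intro allI impI)
    fix h :: real assume "h \<noteq> 0"
    have "\<bar>f (s + h) - f s\<bar> \<le> C * \<bar>h\<bar> * \<bar>h\<bar>"
      using assms[of "s + h"] by (simp add: power2_eq_square mult.assoc)
    then show "norm ((f (s + h) - f s) / h) \<le> C * \<bar>h\<bar>"
      using \<open>h \<noteq> 0\<close> by (simp add: field_simps)
  qed
  show "((\<lambda>h. C * \<bar>h\<bar>) \<longlongrightarrow> 0) (at (0::real))"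
    by (auto intro!: tendsto_eq_intros)
qed

lemma DERIV_flat_exp:
  "(flat_exp k has_real_derivative
     (1 - 2 * t) * flat_exp (k + 2) t - real k * (1 - 2 * t) * flat_exp (k + 1) t) (at t)"
proof (cases "0 < t \<and> t < 1")
  case True
  have chain: "((\<lambda>t. y t ^ k * exp (- y t)) has_real_derivative
      real k * y t ^ (k - 1) * D * exp (- y t) + y t ^ k * (exp (- y t) * (- D))) (at t)"
    if "(y has_real_derivative D) (at t)" for y D
    using that by (auto intro!: derivative_eq_intros)
  have simplify: "real k * v ^ (k - 1) * (- a * v\<^sup>2) * e + v ^ k * (e * (- (- a * v\<^sup>2)))
      = a * (v ^ (k + 2) * e) - real k * a * (v ^ (k + 1) * e)" for v a e :: real
    by (cases k) (simp_all add: power2_eq_square algebra_simps)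
  define w where "w = t * (1 - t)"
  have w: "0 < w" using True by (simp add: w_def)
  have dy: "((\<lambda>t. 1 / (t * (1 - t))) has_real_derivative - (1 - 2 * t) * (1 / w)\<^sup>2) (at t)"
    unfolding w_def using True
    by (auto intro!: derivative_eq_intros simp: power2_eq_square field_simps)
  have "((\<lambda>t. (1 / (t * (1 - t))) ^ k * exp (- (1 / (t * (1 - t))))) has_real_derivative
     real k * (1 / w) ^ (k - 1) * (- (1 - 2 * t) * (1 / w)\<^sup>2) * exp (- (1 / w))
      + (1 / w) ^ k * (exp (- (1 / w)) * (- (- (1 - 2 * t) * (1 / w)\<^sup>2)))) (at t)"
    using chain[OF dy] by (simp only: w_def[symmetric])
  also have "real k * (1 / w) ^ (k - 1) * (- (1 - 2 * t) * (1 / w)\<^sup>2) * exp (- (1 / w))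
      + (1 / w) ^ k * (exp (- (1 / w)) * (- (- (1 - 2 * t) * (1 / w)\<^sup>2)))
      = (1 - 2 * t) * ((1 / w) ^ (k + 2) * exp (- (1 / w)))
      - real k * (1 - 2 * t) * ((1 / w) ^ (k + 1) * exp (- (1 / w)))"
    by (rule simplify)
  also have "\<dots> = (1 - 2 * t) * flat_exp (k + 2) t - real k * (1 - 2 * t) * flat_exp (k + 1) t"
    using True by (simp only: flat_exp_def w_def[symmetric] if_True simp_thms)
  finally show ?thesis
    by (rule has_field_derivative_transform_within_open[of _ _ _ "{0<..<1}"])
       (use True in \<open>auto simp: flat_exp_def\<close>)
next
  case False
  then have "\<bar>flat_exp k u - flat_exp k t\<bar> \<le> fact (k + 2) * (u - t)\<^sup>2" for u
    using flat_exp_quadratic_bound[of t k u] by (auto simp: flat_exp_def[of _ t])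
  from DERIV_zero_if_quadratic_bound[OF this] False show ?thesis
    by (auto simp: flat_exp_def[of _ t])
qed

text \<open>
  An algebra of functions closed under differentiation that contains the derivative of the flat step
  below.
\<close>

inductive_set flat_algebra :: "(real \<Rightarrow> real) set" where
  const: "(\<lambda>_. c) \<in> flat_algebra"
| ident: "(\<lambda>t. t) \<in> flat_algebra"
| flat: "flat_exp k \<in> flat_algebra"
| add: "f \<in> flat_algebra \<Longrightarrow> g \<in> flat_algebra \<Longrightarrow> (\<lambda>t. f t + g t) \<in> flat_algebra"
| mult: "f \<in> flat_algebra \<Longrightarrow> g \<in> flat_algebra \<Longrightarrow> (\<lambda>t. f t * g t) \<in> flat_algebra"

lemma flat_algebra_derivative:
  assumes "f \<in> flat_algebra"
  shows "\<exists>f'\<in>flat_algebra. \<forall>t. (f has_real_derivative f' t) (at t)"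
  using assms
proof induction
  case (const c)
  show ?case by (intro bexI[of _ "\<lambda>_. 0"] flat_algebra.const) auto
next
  case ident
  show ?case by (intro bexI[of _ "\<lambda>_. 1"] flat_algebra.const) auto
next
  case (flat k)
  have "(\<lambda>t. (1 + (- 2) * t) * flat_exp (k + 2) t
      + ((- real k) * (1 + (- 2) * t)) * flat_exp (k + 1) t) \<in> flat_algebra"
    by (intro flat_algebra.intros)
  moreover have "(flat_exp k has_real_derivative (1 + (- 2) * t) * flat_exp (k + 2) t
      + ((- real k) * (1 + (- 2) * t)) * flat_exp (k + 1) t) (at t)" for t
    using DERIV_flat_exp[of k t] by simp
  ultimately show ?case by (intro bexI allI)
next
  case (add f g)
  then obtain f' g' where "f' \<in> flat_algebra" "g' \<in> flat_algebra"
    "\<And>t. (f has_real_derivative f' t) (at t)" "\<And>t. (g has_real_derivative g' t) (at t)" by blast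
  then show ?case
    by (intro bexI[of _ "\<lambda>t. f' t + g' t"] flat_algebra.add) (auto intro: DERIV_add)
next
  case (mult f g)
  then obtain f' g' where "f' \<in> flat_algebra" "g' \<in> flat_algebra"
    "\<And>t. (f has_real_derivative f' t) (at t)" "\<And>t. (g has_real_derivative g' t) (at t)" by blast
  with mult.hyps show ?case
    by (intro bexI[of _ "\<lambda>t. f' t * g t + g' t * f t"] flat_algebra.intros) (auto intro: DERIV_mult)
qed

text \<open>
  The normalised primitive of the bump rises from 0 to 1 on the unit interval. It is wanted on
  \<open>{-1..2}\<close> because the two halves of a joined path use the arguments \<open>2 * t\<close> and \<open>2 * t - 1\<close> for \<open>t\<close> in
  \<open>{0..1}\<close>.
\<close>

lemma flat_step_exists:
  obtains \<phi> c where "0 \<le> (c::real)" "\<And>t. t \<in> {-1..2} \<Longrightarrow> 0 \<le> \<phi> t \<and> \<phi> t \<le> (1::real)"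
    "\<And>t. t \<in> {-1..0} \<Longrightarrow> \<phi> t = 0" "\<And>t. t \<in> {1..2} \<Longrightarrow> \<phi> t = 1"
    "\<And>t. t \<in> {-1..2} \<Longrightarrow> (\<phi> has_vector_derivative c * flat_exp 0 t) (at t within {-1..2})"
proof -
  have cont: "continuous_on {-1..2} (flat_exp 0)"
    using DERIV_flat_exp by (meson DERIV_isCont continuous_at_imp_continuous_on)
  obtain g where g: "\<And>t. t \<in> {-1..2} \<Longrightarrow> (g has_vector_derivative flat_exp 0 t) (at t within {-1..2})"
    using antiderivative_continuous[OF cont] by blast
  have incr: "g b - g a = integral {a..b} (flat_exp 0)" if "-1 \<le> a" "a \<le> b" "b \<le> 2" for a b
    using that
    by (intro integral_unique[symmetric] fundamental_theorem_of_calculus)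
       (auto intro: has_vector_derivative_within_subset[OF g])
  have integ: "flat_exp 0 integrable_on {a..b}" if "-1 \<le> a" "b \<le> 2" for a b
    using that by (intro integrable_continuous_real continuous_on_subset[OF cont]) auto
  have mono: "g a \<le> g b" if "-1 \<le> a" "a \<le> b" "b \<le> 2" for a b
  proof -
    have "0 \<le> integral {a..b} (flat_exp 0)"
      using that by (intro integral_nonneg integ) (auto simp: flat_exp_def)
    then show ?thesis using incr[OF that] by simp
  qed
  have left: "g t = g 0" if "t \<in> {-1..0}" for t
  proof -
    have "integral {t..0} (flat_exp 0) = integral {t..0} (\<lambda>_. 0)"
      by (rule integral_cong) (auto simp: flat_exp_def)
    then show ?thesis using incr[of t 0] that by simp
  qed
  have right: "g t = g 1" if "t \<in> {1..2}" for t
  proof -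
    have "integral {1..t} (flat_exp 0) = integral {1..t} (\<lambda>_. 0)"
      by (rule integral_cong) (auto simp: flat_exp_def)
    then show ?thesis using incr[of 1 t] that by simp
  qed
  have "g 0 \<noteq> g 1"
  proof
    assume eq: "g 0 = g 1"
    then have "integral {0..1} (flat_exp 0) = 0" using incr[of 0 1] by simp
    then have "(flat_exp 0 has_integral 0) (cbox 0 1)"
      using integ[of 0 1] by (metis has_integral_integral cbox_interval zero_le_one neg_le_0_iff_le one_le_numeral)
    then have "flat_exp 0 (1 / 2) = 0"
      by (rule has_integral_0_cbox_imp_0[rotated 2])
         (use continuous_on_subset[OF cont, of "{0..1}"] in \<open>auto simp: flat_exp_nonneg\<close>)
    then show False by (simp add: flat_exp_def)
  qed
  then have pos: "g 0 < g 1" using mono[of 0 1] by simp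
  define c where "c = 1 / (g 1 - g 0)"
  show ?thesis
  proof (rule that[of c "\<lambda>t. c * (g t - g 0)"])
    show "0 \<le> c" using pos by (simp add: c_def)
    show "0 \<le> c * (g t - g 0) \<and> c * (g t - g 0) \<le> 1" if "t \<in> {-1..2}" for t
    proof -
      have "g 0 \<le> g t"
        using mono[of 0 t] left[of t] that by (cases "0 \<le> t") auto
      moreover have "g t \<le> g 1"
        using mono[of t 1] right[of t] that by (cases "t \<le> 1") auto
      ultimately show ?thesis using pos by (simp add: c_def field_simps)
    qed
    show "c * (g t - g 0) = 0" if "t \<in> {-1..0}" for t using left[OF that] by simp
    show "c * (g t - g 0) = 1" if "t \<in> {1..2}" for t using right[OF that] pos by (simp add: c_def)
    show "((\<lambda>t. c * (g t - g 0)) has_vector_derivative c * flat_exp 0 t) (at t within {-1..2})"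
      if "t \<in> {-1..2}" for t
      using g[OF that] unfolding has_real_derivative_iff_has_vector_derivative[symmetric]
      by (auto intro!: derivative_eq_intros)
  qed
qed

text \<open>
  All derivatives of \<open>G 0 \<circ> \<phi>\<close> are of this form: by the chain rule, differentiation turns
  \<open>f t *\<^sub>R G j (\<phi> t)\<close> into two terms of the same kind.
\<close>

inductive_set flat_combinations :: "(nat \<Rightarrow> real \<Rightarrow> 'a::real_normed_vector) \<Rightarrow> (real \<Rightarrow> real) \<Rightarrow> (real \<Rightarrow> 'a) set"
  for G \<phi> where
  base: "f \<in> flat_algebra \<Longrightarrow> (\<lambda>t. f t *\<^sub>R G j (\<phi> t)) \<in> flat_combinations G \<phi>"
| add: "f \<in> flat_combinations G \<phi> \<Longrightarrow> g \<in> flat_combinations G \<phi> \<Longrightarrow> (\<lambda>t. f t + g t) \<in> flat_combinations G \<phi>"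

lemma smooth_on_flat_reparametrization:
  fixes g :: "real \<Rightarrow> 'a::real_normed_vector"
  assumes "smooth_on T g" "\<phi> ` S \<subseteq> T"
    "\<forall>t\<in>S. (\<phi> has_vector_derivative c * flat_exp 0 t) (at t within S)"
  shows "smooth_on S (\<lambda>t. g (\<phi> t))"
proof -
  obtain G where G: "G 0 = g" "\<And>k t. t \<in> T \<Longrightarrow> (G k has_vector_derivative G (Suc k) t) (at t within T)"
    using assms(1) unfolding smooth_on_def by auto
  have comp: "((\<lambda>t. G j (\<phi> t)) has_vector_derivative (c * flat_exp 0 t) *\<^sub>R G (Suc j) (\<phi> t)) (at t within S)"
    if "t \<in> S" for j t
  proof -
    have "(G j has_vector_derivative G (Suc j) (\<phi> t)) (at (\<phi> t) within \<phi> ` S)"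
      using assms(2) that by (intro has_vector_derivative_within_subset[OF G(2)]) auto
    from vector_diff_chain_within[OF assms(3)[rule_format, OF that] this] show ?thesis by (simp add: o_def)
  qed
  have step: "\<exists>f'\<in>flat_combinations G \<phi>. \<forall>t\<in>S. (f has_vector_derivative f' t) (at t within S)"
    if "f \<in> flat_combinations G \<phi>" for f
    using that
  proof induction
    case (base f j)
    then obtain f' where f': "f' \<in> flat_algebra" "\<And>t. (f has_real_derivative f' t) (at t)"
      using flat_algebra_derivative by blast
    let ?h = "\<lambda>t. (f t * (c * flat_exp 0 t)) *\<^sub>R G (Suc j) (\<phi> t) + f' t *\<^sub>R G j (\<phi> t)"
    have "?h \<in> flat_combinations G \<phi>"
      using base f'(1) by (intro flat_combinations.intros flat_algebra.intros)
    moreover have "((\<lambda>t. f t *\<^sub>R G j (\<phi> t)) has_vector_derivative ?h t) (at t within S)" if "t \<in> S" for t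
      using has_vector_derivative_scaleR[OF has_field_derivative_at_within[OF f'(2)] comp[OF that]] by simp
    ultimately show ?case by (intro bexI[of _ ?h] ballI)
  next
    case (add f g)
    then obtain f' g' where "f' \<in> flat_combinations G \<phi>" "g' \<in> flat_combinations G \<phi>"
      "\<And>t. t \<in> S \<Longrightarrow> (f has_vector_derivative f' t) (at t within S)"
      "\<And>t. t \<in> S \<Longrightarrow> (g has_vector_derivative g' t) (at t within S)" by blast
    then show ?case
      by (intro bexI[of _ "\<lambda>t. f' t + g' t"] flat_combinations.add)
         (auto intro: has_vector_derivative_add)
  qed
  have "(\<lambda>t. 1 *\<^sub>R G 0 (\<phi> t)) \<in> flat_combinations G \<phi>"
    by (intro flat_combinations.base flat_algebra.const)
  then show ?thesis
    using smooth_onI_derivative_closed[of "\<lambda>t. g (\<phi> t)" "flat_combinations G \<phi>" S] step G(1) by simp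
qed

section \<open>Smooth paths and their lengths\<close>

lemma has_vector_derivative_flat_reparametrization:
  assumes "(f has_vector_derivative f') (at (\<phi> (a * t + b)) within T)"
    "\<forall>t\<in>U. (\<phi> has_vector_derivative \<phi>' t) (at t within U)" "\<phi> ` U \<subseteq> T"
    "(\<lambda>t. a * t + b) ` S \<subseteq> U" "t \<in> S"
  shows "((\<lambda>t. f (\<phi> (a * t + b))) has_vector_derivative (a * \<phi>' (a * t + b)) *\<^sub>R f') (at t within S)"
proof -
  have 1: "((\<lambda>t. \<phi> (a * t + b)) has_vector_derivative a *\<^sub>R \<phi>' (a * t + b)) (at t within S)"
    by (rule has_vector_derivative_affine[OF _ assms(4)]) (use assms in auto)
  have 2: "(f has_vector_derivative f') (at (\<phi> (a * t + b)) within (\<lambda>t. \<phi> (a * t + b)) ` S)"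
    using assms(3,4) by (intro has_vector_derivative_within_subset[OF assms(1)]) auto
  show ?thesis using vector_diff_chain_within[OF 1 2] by (simp add: o_def)
qed

lemma smooth_path_derivative:
  assumes "smooth_path g"
  obtains g' where "\<And>t. t \<in> {0..1} \<Longrightarrow> (g has_vector_derivative g' t) (at t within {0..1})"
    "continuous_on {0..1} g'"
proof -
  obtain G where G: "G 0 = g"
    "\<And>k t. t \<in> {0..1} \<Longrightarrow> (G k has_vector_derivative G (Suc k) t) (at t within {0..1})"
    using assms unfolding smooth_path_def by auto
  show ?thesis
  proof (rule that[of "G 1"])
    show "(g has_vector_derivative G 1 t) (at t within {0..1})" if "t \<in> {0..1}" for t
      using G(2)[OF that, of 0] G(1) by simp
    show "continuous_on {0..1} (G 1)"
      using G(2)[of _ 1] has_vector_derivative_continuous continuous_on_eq_continuous_within by blast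
  qed
qed

lemma smooth_path_continuous_on: "smooth_path g \<Longrightarrow> continuous_on {0..1} g"
  by (meson smooth_path_derivative has_vector_derivative_continuous continuous_on_eq_continuous_within)

lemma smooth_path_length_eq_integral:
  assumes "\<And>t. t \<in> {0..1} \<Longrightarrow> (g has_vector_derivative g' t) (at t within {0..1})"
  shows "smooth_path_length g = integral {0..1} (\<lambda>t. norm (g' t))"
  unfolding smooth_path_length_def
proof (rule integral_cong)
  fix t :: real assume t: "t \<in> {0..1}"
  have "vector_derivative g (at t within {0..1}) = g' t"
    using vector_derivative_within_cbox[of 0 1 t g "g' t"] assms[OF t] t by (simp add: cbox_interval)
  then show "norm (vector_derivative g (at t within {0..1})) = norm (g' t)" by simp
qed

text \<open>
  Every length below is computed by exhibiting a primitive of the speed; this avoids splitting and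
  substituting in integrals.
\<close>

lemma smooth_path_length_antiderivative:
  assumes "\<And>t. t \<in> {0..1} \<Longrightarrow> (g has_vector_derivative g' t) (at t within {0..1})"
    "\<And>t. t \<in> {0..1} \<Longrightarrow> (F has_vector_derivative norm (g' t)) (at t within {0..1})"
  shows "smooth_path_length g = F 1 - F 0"
  using integral_unique[OF fundamental_theorem_of_calculus[of 0 1 F "\<lambda>t. norm (g' t)"]] assms(2)
    smooth_path_length_eq_integral[OF assms(1)] by simp

lemma smooth_path_arc_length:
  assumes "smooth_path g"
  obtains g' \<Lambda> where "\<And>t. t \<in> {0..1} \<Longrightarrow> (g has_vector_derivative g' t) (at t within {0..1})"
    "\<And>t. t \<in> {0..1} \<Longrightarrow> (\<Lambda> has_vector_derivative norm (g' t)) (at t within {0..1})"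
    "\<Lambda> 0 = 0" "\<Lambda> 1 = smooth_path_length g" "mono_on {0..1} \<Lambda>" "continuous_on {0..1} \<Lambda>"
proof -
  obtain g' where g': "\<And>t. t \<in> {0..1} \<Longrightarrow> (g has_vector_derivative g' t) (at t within {0..1})"
    and c: "continuous_on {0..1} g'"
    by (rule smooth_path_derivative[OF assms], rule that) blast+
  define \<Lambda> where "\<Lambda> t = integral {0..t} (\<lambda>t. norm (g' t))" for t
  have \<Lambda>: "(\<Lambda> has_vector_derivative norm (g' t)) (at t within {0..1})" if "t \<in> {0..1}" for t
    unfolding \<Lambda>_def using that by (intro integral_has_vector_derivative continuous_on_norm c) auto
  have int: "(\<lambda>t. norm (g' t)) integrable_on {0..t}" if "t \<le> 1" for t
    using that by (intro integrable_continuous_real continuous_on_norm continuous_on_subset[OF c]) auto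
  have "mono_on {0..1} \<Lambda>"
    unfolding \<Lambda>_def by (intro mono_onI integral_subset_le int) auto
  moreover have "continuous_on {0..1} \<Lambda>"
    using \<Lambda> has_vector_derivative_continuous continuous_on_eq_continuous_within by blast
  ultimately show ?thesis
    using g' \<Lambda> smooth_path_length_eq_integral[of g g']
    by (intro that[of g' \<Lambda>]) (simp_all add: \<Lambda>_def)
qed

lemma smooth_path_length_nonneg: "smooth_path g \<Longrightarrow> 0 \<le> smooth_path_length g"
proof -
  assume "smooth_path g"
  then obtain \<Lambda> :: "real \<Rightarrow> real" where \<Lambda>: "\<Lambda> 0 = 0" "\<Lambda> 1 = smooth_path_length g" "mono_on {0..1} \<Lambda>"
    by (rule smooth_path_arc_length) (rule that)
  show ?thesis using mono_onD[OF \<Lambda>(3), of 0 1] \<Lambda>(1,2) by simp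
qed

definition connects :: "'a::real_normed_vector set \<Rightarrow> 'a \<Rightarrow> 'a \<Rightarrow> (real \<Rightarrow> 'a) \<Rightarrow> bool" where
  "connects D x y g \<longleftrightarrow> smooth_path g \<and> path_image g \<subseteq> D \<and> pathstart g = x \<and> pathfinish g = y"

lemma smooth_path_dist_connects: "smooth_path_dist D x y = Inf {smooth_path_length g | g. connects D x y g}"
  by (simp add: smooth_path_dist_def connects_def)

lemma connects_linepath:
  assumes "closed_segment x y \<subseteq> D"
  shows "connects D x y (linepath x y)" "smooth_path_length (linepath x y) = dist x y"
proof -
  have "smooth_on {0..1} (\<lambda>t. x + t *\<^sub>R (y - x))"
  proof (rule smooth_onI_derivative_closed)
    show "(\<lambda>t. x + t *\<^sub>R (y - x)) \<in> range (\<lambda>(c, v) t. c + t *\<^sub>R v)"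
      by (rule range_eqI[of _ _ "(x, y - x)"]) simp
  next
    fix g assume "g \<in> range (\<lambda>(c, v) t. c + t *\<^sub>R v :: 'a)"
    then obtain c v where g: "g = (\<lambda>t. c + t *\<^sub>R v)" by auto
    have "(\<lambda>t. v + t *\<^sub>R 0) \<in> range (\<lambda>(c, v) t. c + t *\<^sub>R v :: 'a)"
      by (rule range_eqI[of _ _ "(v, 0)"]) simp
    moreover have "(g has_vector_derivative v + t *\<^sub>R 0) (at t within {0..1})" for t
      unfolding g by (auto intro!: derivative_eq_intros)
    ultimately show "\<exists>g'\<in>range (\<lambda>(c, v) t. c + t *\<^sub>R v).
        \<forall>t\<in>{0..1}. (g has_vector_derivative g' t) (at t within {0..1})"
      by (intro bexI[of _ "\<lambda>t. v + t *\<^sub>R 0"]) auto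
  qed
  moreover have "linepath x y = (\<lambda>t. x + t *\<^sub>R (y - x))"
    by (auto simp: linepath_def algebra_simps)
  ultimately show "connects D x y (linepath x y)"
    using assms path_image_linepath[of x y] pathstart_linepath[of x y] pathfinish_linepath[of x y]
    by (simp add: connects_def smooth_path_iff_smooth_on)
  have "(linepath x y has_vector_derivative y - x) (at t within {0..1})" for t
    by (rule has_vector_derivative_linepath_within)
  then show "smooth_path_length (linepath x y) = dist x y"
    by (subst smooth_path_length_eq_integral[of _ "\<lambda>_. y - x"]) (auto simp: dist_norm norm_minus_commute)
qed

lemma smooth_path_affine:
  assumes "smooth_path g" "(\<lambda>t. a * t + b) ` {0..1} \<subseteq> {0..1}"
    "\<And>t. t \<in> {0..1} \<Longrightarrow> (g has_vector_derivative g' t) (at t within {0..1})"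
    "\<And>t. t \<in> {0..1} \<Longrightarrow> (\<Lambda> has_vector_derivative norm (g' t)) (at t within {0..1})"
  shows "smooth_path (\<lambda>t. g (a * t + b))"
    "smooth_path_length (\<lambda>t. g (a * t + b)) = sgn a * (\<Lambda> (a + b) - \<Lambda> b)"
proof -
  show "smooth_path (\<lambda>t. g (a * t + b))"
    using smooth_on_affine[OF assms(1)[unfolded smooth_path_iff_smooth_on] assms(2)]
    by (simp only: smooth_path_iff_smooth_on)
  have "((\<lambda>t. g (a * t + b)) has_vector_derivative a *\<^sub>R g' (a * t + b)) (at t within {0..1})"
    if "t \<in> {0..1}" for t
    using assms(2) that by (intro has_vector_derivative_affine[OF assms(3) assms(2)]) blast
  moreover have "((\<lambda>t. sgn a * \<Lambda> (a * t + b)) has_vector_derivative norm (a *\<^sub>R g' (a * t + b))) (at t within {0..1})"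
    if "t \<in> {0..1}" for t
  proof -
    have "((\<lambda>t. \<Lambda> (a * t + b)) has_vector_derivative a *\<^sub>R norm (g' (a * t + b))) (at t within {0..1})"
      using assms(2) that by (intro has_vector_derivative_affine[OF assms(4) assms(2)]) blast
    from has_vector_derivative_mult_right[OF this, of "sgn a"]
    show ?thesis by (simp add: mult.assoc[symmetric] abs_sgn mult.commute)
  qed
  ultimately have "smooth_path_length (\<lambda>t. g (a * t + b)) = sgn a * \<Lambda> (a * 1 + b) - sgn a * \<Lambda> (a * 0 + b)"
    by (rule smooth_path_length_antiderivative)
  then show "smooth_path_length (\<lambda>t. g (a * t + b)) = sgn a * (\<Lambda> (a + b) - \<Lambda> b)"
    by (simp add: algebra_simps)
qed

lemma connects_reverse:
  assumes "connects D x y g"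
  obtains h where "connects D y x h" "smooth_path_length h = smooth_path_length g"
proof -
  have g: "smooth_path g" using assms by (simp add: connects_def)
  obtain g' \<Lambda> where \<Lambda>: "\<And>t. t \<in> {0..1} \<Longrightarrow> (g has_vector_derivative g' t) (at t within {0..1})"
    "\<And>t. t \<in> {0..1} \<Longrightarrow> (\<Lambda> has_vector_derivative norm (g' t)) (at t within {0..1})"
    "\<Lambda> 0 = 0" "\<Lambda> 1 = smooth_path_length g" and "mono_on {0..1} \<Lambda>" "continuous_on {0..1} \<Lambda>"
    by (rule smooth_path_arc_length[OF g], rule that) blast+
  have r: "(\<lambda>t. - 1 * t + 1) ` {0..1} \<subseteq> {0..1::real}" by auto
  have "connects D y x (\<lambda>t. g (- 1 * t + 1))"
    using assms smooth_path_affine(1)[OF g r \<Lambda>(1,2)]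
    by (auto simp: connects_def path_image_def pathstart_def pathfinish_def)
  with smooth_path_affine(2)[OF g r \<Lambda>(1,2)] \<Lambda>(3,4) show ?thesis
    by (intro that[of "\<lambda>t. g (- 1 * t + 1)"]) auto
qed

text \<open>
  The intermediate value theorem for the arc length. It provides almost-midpoints, and hence
  geodesics in the completion.
\<close>

lemma connects_split:
  assumes "connects D x y g" "0 \<le> l" "l \<le> smooth_path_length g"
  obtains z h k where "connects D x z h" "smooth_path_length h = l"
    "connects D z y k" "smooth_path_length k = smooth_path_length g - l"
proof -
  have g: "smooth_path g" using assms by (simp add: connects_def)
  obtain g' \<Lambda> where \<Lambda>: "\<And>t. t \<in> {0..1} \<Longrightarrow> (g has_vector_derivative g' t) (at t within {0..1})"
    "\<And>t. t \<in> {0..1} \<Longrightarrow> (\<Lambda> has_vector_derivative norm (g' t)) (at t within {0..1})"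
    "\<Lambda> 0 = 0" "\<Lambda> 1 = smooth_path_length g" and "mono_on {0..1} \<Lambda>" and cont: "continuous_on {0..1} \<Lambda>"
    by (rule smooth_path_arc_length[OF g], rule that) blast+
  obtain s where s: "0 \<le> s" "s \<le> 1" "\<Lambda> s = l"
    using IVT'[of \<Lambda> 0 l 1] assms(2,3) \<Lambda>(3,4) cont by auto
  have r1: "(\<lambda>t. s * t + 0) ` {0..1} \<subseteq> {0..1}"
    using s mult_le_one[of s] by auto
  have r2: "(\<lambda>t. (1 - s) * t + s) ` {0..1} \<subseteq> {0..1}"
  proof -
    have "(1 - s) * t \<le> 1 - s" if "t \<le> 1" for t using s that mult_left_le[of t "1 - s"] by simp
    then show ?thesis using s by (fastforce simp: image_subset_iff)
  qed
  note a1 = smooth_path_affine[OF g r1 \<Lambda>(1,2)] and a2 = smooth_path_affine[OF g r2 \<Lambda>(1,2)]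
  have l1: "smooth_path_length (\<lambda>t. g (s * t + 0)) = l"
    using a1(2) s \<Lambda>(3) by (cases "s = 0") auto
  have l2: "smooth_path_length (\<lambda>t. g ((1 - s) * t + s)) = smooth_path_length g - l"
    using a2(2) s \<Lambda>(4) by (cases "s = 1") auto
  have i1: "connects D x (g s) (\<lambda>t. g (s * t + 0))"
    using assms(1) a1(1) r1 by (auto simp: connects_def path_image_def pathstart_def pathfinish_def)
  have i2: "connects D (g s) y (\<lambda>t. g ((1 - s) * t + s))"
    using assms(1) a2(1) r2 by (auto simp: connects_def path_image_def pathstart_def pathfinish_def)
  show ?thesis using that[OF i1 l1 i2 l2] .
qed

text \<open>
  The joined path is \<open>g (\<phi> (2 t)) + h (\<phi> (2 t - 1)) - y\<close> with the flat step \<open>\<phi>\<close>: on each half of the interval one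
  of the first two terms is constantly equal to \<open>y\<close>. At most one of the two speeds is nonzero at any
  time, so the lengths add up.
\<close>

lemma connects_join:
  assumes "connects D x y g" "connects D y z h"
  obtains k where "connects D x z k" "smooth_path_length k = smooth_path_length g + smooth_path_length h"
proof -
  have g: "smooth_path g" "g 0 = x" "g 1 = y" "g ` {0..1} \<subseteq> D"
    and h: "smooth_path h" "h 0 = y" "h 1 = z" "h ` {0..1} \<subseteq> D"
    using assms by (auto simp: connects_def path_image_def pathstart_def pathfinish_def)
  obtain g' \<Lambda> where \<Lambda>: "\<And>t. t \<in> {0..1} \<Longrightarrow> (g has_vector_derivative g' t) (at t within {0..1})"
    "\<And>t. t \<in> {0..1} \<Longrightarrow> (\<Lambda> has_vector_derivative norm (g' t)) (at t within {0..1})"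
    "\<Lambda> 0 = 0" "\<Lambda> 1 = smooth_path_length g" and "mono_on {0..1} \<Lambda>" "continuous_on {0..1} \<Lambda>"
    by (rule smooth_path_arc_length[OF g(1)], rule that) blast+
  obtain h' M where M: "\<And>t. t \<in> {0..1} \<Longrightarrow> (h has_vector_derivative h' t) (at t within {0..1})"
    "\<And>t. t \<in> {0..1} \<Longrightarrow> (M has_vector_derivative norm (h' t)) (at t within {0..1})"
    "M 0 = 0" "M 1 = smooth_path_length h" and "mono_on {0..1} M" "continuous_on {0..1} M"
    by (rule smooth_path_arc_length[OF h(1)], rule that) blast+
  obtain \<phi> c where \<phi>: "0 \<le> c" "\<And>t. t \<in> {-1..2} \<Longrightarrow> 0 \<le> \<phi> t \<and> \<phi> t \<le> 1"
    "\<And>t. t \<in> {-1..0} \<Longrightarrow> \<phi> t = 0" "\<And>t. t \<in> {1..2} \<Longrightarrow> \<phi> t = 1"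
    "\<And>t. t \<in> {-1..2} \<Longrightarrow> (\<phi> has_vector_derivative c * flat_exp 0 t) (at t within {-1..2})"
    by (rule flat_step_exists) blast
  have r1: "(\<lambda>t. 2 * t + 0) ` {0..1} \<subseteq> {-1..2::real}" and r2: "(\<lambda>t. 2 * t + (-1)) ` {0..1} \<subseteq> {-1..2::real}"
    by auto
  have \<phi>_range: "\<phi> ` {-1..2} \<subseteq> {0..1}" using \<phi>(2) by auto
  have \<phi>_deriv: "\<forall>t\<in>{-1..2}. (\<phi> has_vector_derivative c * flat_exp 0 t) (at t within {-1..2})"
    using \<phi>(5) by blast
  define k where "k t = g (\<phi> (2 * t + 0)) + (h (\<phi> (2 * t + (-1))) + - y)" for t
  note reparam = smooth_on_flat_reparametrization[OF _ \<phi>_range \<phi>_deriv]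
  have smooth: "smooth_path k"
    unfolding smooth_path_iff_smooth_on k_def
    by (rule smooth_on_add[OF smooth_on_affine[OF reparam[OF g(1)[unfolded smooth_path_iff_smooth_on]] r1]
        smooth_on_add[OF smooth_on_affine[OF reparam[OF h(1)[unfolded smooth_path_iff_smooth_on]] r2]
          smooth_on_const]])
  have k1: "k t = g (\<phi> (2 * t + 0))" if "t \<in> {0..1/2}" for t
    using that \<phi>(3)[of "2 * t + (-1)"] h(2) by (simp add: k_def)
  have k2: "k t = h (\<phi> (2 * t + (-1)))" if "t \<in> {1/2..1}" for t
    using that \<phi>(4)[of "2 * t + 0"] g(3) by (simp add: k_def)
  have "k t \<in> D" if "t \<in> {0..1}" for t
  proof (cases "t \<le> 1 / 2")
    case True
    then show ?thesis using k1[of t] \<phi>(2)[of "2 * t + 0"] g(4) that by auto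
  next
    case False
    then show ?thesis using k2[of t] \<phi>(2)[of "2 * t + (-1)"] h(4) that by auto
  qed
  moreover have "k 0 = x" using k1[of 0] \<phi>(3)[of 0] g(2) by simp
  moreover have "k 1 = z" using k2[of 1] \<phi>(4)[of 1] h(3) by simp
  ultimately have "connects D x z k"
    using smooth by (auto simp: connects_def path_image_def pathstart_def pathfinish_def)
  moreover have "smooth_path_length k = smooth_path_length g + smooth_path_length h"
  proof -
    define a b where "a t = 2 * (c * flat_exp 0 (2 * t + 0))" and "b t = 2 * (c * flat_exp 0 (2 * t + (-1)))" for t
    have ab: "0 \<le> a t" "0 \<le> b t" "a t = 0 \<or> b t = 0" for t
      using \<phi>(1) by (auto simp: a_def b_def flat_exp_nonneg) (auto simp: flat_exp_def split: if_splits)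
    have "smooth_path_length k = (\<Lambda> (\<phi> (2 * 1 + 0)) + M (\<phi> (2 * 1 + (-1)))) - (\<Lambda> (\<phi> (2 * 0 + 0)) + M (\<phi> (2 * 0 + (-1))))"
    proof (rule smooth_path_length_antiderivative)
      fix t :: real assume t: "t \<in> {0..1}"
      note chain = has_vector_derivative_flat_reparametrization[where U = "{-1..2}" and T = "{0..1}", OF _ \<phi>_deriv \<phi>_range _ t]
      have p1: "\<phi> (2 * t + 0) \<in> {0..1}" and p2: "\<phi> (2 * t + (-1)) \<in> {0..1}"
        using \<phi>(2)[of "2 * t + 0"] \<phi>(2)[of "2 * t + (-1)"] t by auto
      have "((\<lambda>t. g (\<phi> (2 * t + 0))) has_vector_derivative a t *\<^sub>R g' (\<phi> (2 * t + 0))) (at t within {0..1})"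
        "((\<lambda>t. h (\<phi> (2 * t + (-1)))) has_vector_derivative b t *\<^sub>R h' (\<phi> (2 * t + (-1)))) (at t within {0..1})"
        unfolding a_def b_def
        by (rule chain[OF \<Lambda>(1)[OF p1] r1] chain[OF M(1)[OF p2] r2])+
      then have "((\<lambda>t. g (\<phi> (2 * t + 0)) + (h (\<phi> (2 * t + (-1))) + - y)) has_vector_derivative
          a t *\<^sub>R g' (\<phi> (2 * t + 0)) + (b t *\<^sub>R h' (\<phi> (2 * t + (-1))) + 0)) (at t within {0..1})"
        by (intro has_vector_derivative_add has_vector_derivative_const)
      then show "(k has_vector_derivative
          a t *\<^sub>R g' (\<phi> (2 * t + 0)) + (b t *\<^sub>R h' (\<phi> (2 * t + (-1))) + 0)) (at t within {0..1})"
        by (simp only: k_def[abs_def])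
      have "((\<lambda>t. \<Lambda> (\<phi> (2 * t + 0))) has_vector_derivative a t *\<^sub>R norm (g' (\<phi> (2 * t + 0)))) (at t within {0..1})"
        "((\<lambda>t. M (\<phi> (2 * t + (-1)))) has_vector_derivative b t *\<^sub>R norm (h' (\<phi> (2 * t + (-1))))) (at t within {0..1})"
        unfolding a_def b_def
        by (rule chain[OF \<Lambda>(2)[OF p1] r1] chain[OF M(2)[OF p2] r2])+
      from has_vector_derivative_add[OF this]
      show "((\<lambda>t. \<Lambda> (\<phi> (2 * t + 0)) + M (\<phi> (2 * t + (-1)))) has_vector_derivative
          norm (a t *\<^sub>R g' (\<phi> (2 * t + 0)) + (b t *\<^sub>R h' (\<phi> (2 * t + (-1))) + 0))) (at t within {0..1})"
        using ab[of t] by auto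
    qed
    then show ?thesis
      using \<phi>(3)[of 0] \<phi>(3)[of "-1"] \<phi>(4)[of 1] \<phi>(4)[of 2] \<Lambda>(3,4) M(3,4) by simp
  qed
  ultimately show ?thesis by (rule that)
qed

lemma smooth_path_length_ge_dist:
  assumes "connects D x y g"
  shows "dist x y \<le> smooth_path_length g"
proof -
  have g: "smooth_path g" using assms by (simp add: connects_def)
  obtain g' where g': "\<And>t. t \<in> {0..1} \<Longrightarrow> (g has_vector_derivative g' t) (at t within {0..1})"
    "continuous_on {0..1} g'"
    by (rule smooth_path_derivative[OF g], rule that) blast+
  obtain \<Lambda> where \<Lambda>:
    "\<And>t. t \<in> {0..1} \<Longrightarrow> (\<Lambda> has_vector_derivative norm (g' t)) (at t within {0..1})"
    using antiderivative_continuous[of 0 1 "\<lambda>t. norm (g' t)"] g'(2) by (auto intro: continuous_on_norm)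
  have "norm (g 1 - g 0) \<le> \<Lambda> 1 - \<Lambda> 0"
  proof (rule differentiable_bound_general)
    show "continuous_on {0..1} g" by (rule smooth_path_continuous_on[OF g])
    show "continuous_on {0..1} \<Lambda>"
      using \<Lambda> has_vector_derivative_continuous continuous_on_eq_continuous_within by blast
    fix t :: real assume t: "0 < t" "t < 1"
    then have at: "at t within {0..1} = at t" by (intro at_within_interior) auto
    show "(g has_vector_derivative g' t) (at t)" "(\<Lambda> has_vector_derivative norm (g' t)) (at t)"
      using g'(1)[of t] \<Lambda>[of t] t at by auto
  qed auto
  then show ?thesis
    using assms smooth_path_length_antiderivative[OF g'(1) \<Lambda>]
    by (simp add: connects_def pathstart_def pathfinish_def dist_norm norm_minus_commute)
qed

section \<open>Compactness in finite dimension\<close>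

text \<open>
  The whole space is infinite-dimensional, so compactness has to come from the dimension \<open>d\<close>: a ball of
  \<open>Rd (Suc d)\<close> is contained in the continuous image of an interval times a ball of \<open>Rd d\<close>.
\<close>

lemma compact_Rd_cball: "compact (Rd d \<inter> cball 0 R)"
proof (induction d arbitrary: R)
  case 0
  have "Rd 0 = {0}" by (auto simp: Rd_def intro: ell2_eqI)
  then show ?case by (intro finite_imp_compact) (auto intro: finite_subset[of _ "{0}"])
next
  case (Suc d)
  obtain e where e: "e \<in> Rd (Suc d)" "\<And>i. i < Suc d \<Longrightarrow> coord e i = (if i = d then 1 else 0)"
    using Rd_coords[of "Suc d" "\<lambda>i. if i = d then 1 else 0"] by blast
  have coord_e: "coord e i = (if i = d then 1 else 0)" for i
    using e by (cases "i < Suc d") (auto simp: Rd_def)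
  have norm_e: "norm e = 1"
    using norm_Rd[OF e(1)] by (simp add: coord_e)
  define K where "K = (\<lambda>(t, x). t *\<^sub>R e + x) ` ({-R..R} \<times> (Rd d \<inter> cball 0 (2 * R)))"
  have "compact K"
    unfolding K_def
    unfolding case_prod_beta
    by (rule compact_continuous_image)
       (rule continuous_intros compact_Times compact_Icc Suc)+
  moreover have "Rd (Suc d) \<inter> cball 0 R \<subseteq> K"
  proof
    fix x assume x: "x \<in> Rd (Suc d) \<inter> cball 0 R"
    define y where "y = x - coord x d *\<^sub>R e"
    have c: "\<bar>coord x d\<bar> \<le> R" using x abs_coord_le_norm[of x d] by auto
    have "y \<in> Rd d"
      using x by (auto simp: Rd_def y_def coord_e)
    moreover have "norm y \<le> 2 * R"
      using norm_triangle_ineq4[of x "coord x d *\<^sub>R e"] c x by (simp add: y_def norm_e)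
    ultimately show "x \<in> K"
      unfolding K_def using c
      by (intro image_eqI[of _ _ "(coord x d, y)"]) (auto simp: y_def abs_le_iff)
  qed
  ultimately show ?case
    using compact_Int_closed[of K "Rd (Suc d) \<inter> cball 0 R"] closed_Rd
    by (metis closed_Int closed_cball inf.absorb_iff2)
qed

lemma compact_closure_in_Rd:
  assumes "bounded D" "D \<subseteq> Rd d" shows "compact (closure D)"
proof -
  obtain R where "\<forall>x\<in>D. norm x \<le> R" using assms(1) by (auto simp: bounded_iff)
  with assms(2) have "D \<subseteq> Rd d \<inter> cball 0 R" by auto
  then have "closure D \<subseteq> Rd d \<inter> cball 0 R"
    by (intro closure_minimal compact_imp_closed compact_Rd_cball)
  then show ?thesis
    using compact_Int_closed[OF compact_Rd_cball[of d R] closed_closure[of D]]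
    by (simp add: inf.absorb2)
qed

text \<open>
  The ambient space \<open>E\<close> is a closed subspace of a possibly infinite-dimensional space; finite
  dimension enters through the compactness of the closure of \<open>D\<close>.
\<close>

locale sphere_cone_domain =
  fixes E D :: "'a::{real_inner, banach, second_countable_topology} set" and r \<delta> \<alpha> :: real
  assumes subspace_E: "subspace E" and closed_E: "closed E" and domain: "domain_in E D"
    and compact_closure: "compact (closure D)"
    and exterior_sphere: "uniform_exterior_sphere E D r"
    and interior_cone: "uniform_interior_cone E D \<delta> \<alpha>"
begin

lemma r_pos: "0 < r" using exterior_sphere by (simp add: uniform_exterior_sphere_def)
lemma \<delta>_pos: "0 < \<delta>" using interior_cone by (simp add: uniform_interior_cone_def)

lemma D_subset_E: "D \<subseteq> E"
  using domain openin_imp_subset by (auto simp: domain_in_def)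

lemma closure_subset_E: "closure D \<subseteq> E"
  using D_subset_E closed_E by (rule closure_minimal)

lemma D_in_closure: "x \<in> D \<Longrightarrow> x \<in> closure D"
  using closure_subset by auto

lemma boundary_eq: "boundary_in E D = closure D - D"
proof -
  have "top_of_set E interior_of D = D"
    using domain by (simp add: domain_in_def interior_of_openin)
  moreover have "top_of_set E closure_of D = closure D"
    using D_subset_E closure_subset_E by (simp add: closure_of_subtopology inf.absorb2)
  ultimately show ?thesis by (simp add: boundary_in_def frontier_of_def)
qed

lemma D_contains_ball:
  assumes "x \<in> D" obtains e where "0 < e" "ball x e \<inter> E \<subseteq> D"
  using domain assms openin_contains_ball[of E D] by (auto simp: domain_in_def)

text \<open>
  Connectedness by smooth paths is an equivalence relation with open classes.
\<close>

lemma ex_connects: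
  assumes "x \<in> D" "y \<in> D" shows "\<exists>g. connects D x y g"
proof (rule connected_equivalence_relation[where S = D and R = "\<lambda>x y. \<exists>g. connects D x y g"])
  show "connected D" using domain by (simp add: domain_in_def)
  show "\<exists>g. connects D y x g" if "\<exists>g. connects D x y g" for x y
    using that connects_reverse by metis
  show "\<exists>g. connects D x z g" if "\<exists>g. connects D x y g" "\<exists>g. connects D y z g" for x y z
    using that connects_join by metis
  show "\<exists>T. openin (top_of_set D) T \<and> a \<in> T \<and> (\<forall>x\<in>T. \<exists>g. connects D a x g)" if a: "a \<in> D" for a
  proof -
    obtain e where e: "0 < e" "ball a e \<inter> E \<subseteq> D" using D_contains_ball[OF a] .
    have "\<exists>g. connects D a x g" if "x \<in> D \<inter> ball a e" for x
    proof -
      have "convex (ball a e \<inter> E)" by (simp add: convex_Int subspace_E subspace_imp_convex)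
      then have "closed_segment a x \<subseteq> ball a e \<inter> E"
        using that a e(1) D_subset_E by (intro closed_segment_subset) auto
      then show ?thesis using connects_linepath(1)[of a x D] e(2) by auto
    qed
    then show ?thesis
      using a e(1) by (intro exI[of _ "D \<inter> ball a e"]) auto
  qed
qed (use assms in auto)

abbreviation path_dist :: "'a \<Rightarrow> 'a \<Rightarrow> real" where "path_dist \<equiv> smooth_path_dist D"

lemma path_dist_le_length: "connects D x y g \<Longrightarrow> path_dist x y \<le> smooth_path_length g"
  unfolding smooth_path_dist_connects
  by (intro cInf_lower bdd_belowI[of _ 0])
     (auto intro: smooth_path_length_nonneg simp: connects_def)

lemma path_dist_approx:
  assumes "x \<in> D" "y \<in> D" "0 < e"
  obtains g where "connects D x y g" "smooth_path_length g < path_dist x y + e"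
proof -
  have "Inf {smooth_path_length g | g. connects D x y g} < path_dist x y + e"
    using assms(3) by (simp add: smooth_path_dist_connects)
  then have "\<exists>l\<in>{smooth_path_length g | g. connects D x y g}. l < path_dist x y + e"
    using ex_connects[OF assms(1,2)] by (intro cInf_lessD) auto
  then show ?thesis using that by auto
qed

lemma path_dist_ge_dist: "x \<in> D \<Longrightarrow> y \<in> D \<Longrightarrow> dist x y \<le> path_dist x y"
  unfolding smooth_path_dist_connects
  using ex_connects by (intro cInf_greatest) (auto intro: smooth_path_length_ge_dist)

lemma path_dist_segment: "closed_segment x y \<subseteq> D \<Longrightarrow> path_dist x y \<le> dist x y"
  using path_dist_le_length connects_linepath by metis

lemma path_dist_commute_le:
  assumes "x \<in> D" "y \<in> D" shows "path_dist x y \<le> path_dist y x"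
proof (rule field_le_epsilon)
  fix e :: real assume "0 < e"
  then obtain g where "connects D y x g" "smooth_path_length g < path_dist y x + e"
    using path_dist_approx assms by blast
  then show "path_dist x y \<le> path_dist y x + e"
    by (metis connects_reverse path_dist_le_length less_eq_real_def order_trans)
qed

lemma path_dist_commute: "x \<in> D \<Longrightarrow> y \<in> D \<Longrightarrow> path_dist x y = path_dist y x"
  using path_dist_commute_le by (simp add: antisym)

lemma path_dist_triangle:
  assumes "x \<in> D" "y \<in> D" "z \<in> D" shows "path_dist x z \<le> path_dist x y + path_dist y z"
proof (rule field_le_epsilon)
  fix e :: real assume e: "0 < e"
  obtain g where g: "connects D x y g" "smooth_path_length g < path_dist x y + e / 2"
    using path_dist_approx[of x y "e / 2"] assms e by auto
  obtain h where h: "connects D y z h" "smooth_path_length h < path_dist y z + e / 2"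
    using path_dist_approx[of y z "e / 2"] assms e by auto
  obtain k where "connects D x z k" "smooth_path_length k = smooth_path_length g + smooth_path_length h"
    using connects_join[OF g(1) h(1)] .
  then show "path_dist x z \<le> path_dist x y + path_dist y z + e" using path_dist_le_length[of x z k] g(2) h(2) by simp
qed

lemma path_dist_split:
  assumes "x \<in> D" "y \<in> D" "0 \<le> t" "t \<le> path_dist x y" "0 < e"
  obtains z where "z \<in> D" "path_dist x z \<le> t" "path_dist z y \<le> path_dist x y - t + e"
proof -
  obtain g where g: "connects D x y g" "smooth_path_length g < path_dist x y + e"
    using path_dist_approx assms by blast
  have "t \<le> smooth_path_length g" using path_dist_le_length[OF g(1)] assms(4) by simp
  then obtain z h k where hk: "connects D x z h" "smooth_path_length h = t"
    "connects D z y k" "smooth_path_length k = smooth_path_length g - t"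
    using connects_split[OF g(1) assms(3)] by metis
  then have "z \<in> D" using pathfinish_in_path_image[of h] by (auto simp: connects_def)
  then show ?thesis using that[of z] path_dist_le_length[OF hk(1)] path_dist_le_length[OF hk(3)] hk g(2) by simp
qed

section \<open>Exterior spheres and nearest points\<close>

text \<open>
  The exterior ball at \<open>x\<close> in algebraic form; this is how normals are used below.
\<close>

lemma exterior_normal_inner_le:
  assumes "\<nu> \<in> exterior_normals E D r x" "q \<in> closure D"
  shows "2 * r * inner \<nu> (q - x) \<le> (norm (q - x))\<^sup>2"
proof -
  have "D \<subseteq> - ball (x + r *\<^sub>R \<nu>) r" using assms(1) by (auto simp: exterior_normals_def)
  then have "closure D \<subseteq> - ball (x + r *\<^sub>R \<nu>) r" by (intro closure_minimal) auto
  then have "r \<le> norm (q - x - r *\<^sub>R \<nu>)"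
    using assms(2) by (auto simp: dist_norm norm_minus_commute algebra_simps subset_iff)
  then have "r\<^sup>2 \<le> (norm (q - x - r *\<^sub>R \<nu>))\<^sup>2"
    using r_pos by (intro power_mono) auto
  also have "\<dots> = (norm (q - x))\<^sup>2 - 2 * r * inner \<nu> (q - x) + (r * norm \<nu>)\<^sup>2"
    using dot_norm_neg[of "q - x" "r *\<^sub>R \<nu>"]
    by (simp add: inner_commute power_mult_distrib algebra_simps)
  also have "norm \<nu> = 1" using assms(1) by (simp add: exterior_normals_def)
  finally show ?thesis by simp
qed

lemma nearest_point_exists:
  assumes "D \<noteq> {}"
  obtains p where "p \<in> closure D" "\<And>q. q \<in> closure D \<Longrightarrow> dist m p \<le> dist m q"
proof -
  have "continuous_on (closure D) (dist m)" by (intro continuous_intros)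
  then obtain p where "p \<in> closure D" "\<forall>q\<in>closure D. dist m p \<le> dist m q"
    using continuous_attains_inf[OF compact_closure, of "dist m"] assms by auto
  then show ?thesis using that by blast
qed

text \<open>
  If \<open>p\<close> is nearest to \<open>m\<close>, the open ball around \<open>m\<close> through \<open>p\<close> misses the domain, so \<open>m - p\<close> is an
  exterior normal for the small radius \<open>dist m p\<close>. The exterior sphere condition turns it into one for the
  radius \<open>r\<close>.
\<close>

lemma nearest_point_inner_le:
  assumes m: "m \<in> E" and p: "p \<in> closure D" "\<And>q. q \<in> closure D \<Longrightarrow> dist m p \<le> dist m q"
    and near: "dist m p \<le> r" and q: "q \<in> closure D"
  shows "2 * r * inner (m - p) (q - p) \<le> dist m p * (norm (q - p))\<^sup>2"
proof (cases "m = p")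
  case False
  define l where "l = dist m p"
  have l: "0 < l" "l \<le> r" using False near by (auto simp: l_def)
  define \<nu> where "\<nu> = (1 / l) *\<^sub>R (m - p)"
  have \<nu>: "m - p = l *\<^sub>R \<nu>" using l by (simp add: \<nu>_def)
  have p_E: "p \<in> E" using p(1) closure_subset_E by auto
  have "p \<notin> D"
  proof
    assume "p \<in> D"
    then obtain e where e: "0 < e" "ball p e \<inter> E \<subseteq> D" using D_contains_ball by blast
    define t where "t = min (1 / 2) (e / (2 * l))"
    have t: "0 < t" "t < 1" "t * l < e" using e(1) l by (auto simp: t_def min_def field_simps)
    define z where "z = p + t *\<^sub>R (m - p)"
    have "dist p z = t * l" using t by (simp add: z_def l_def dist_norm)
    moreover have "z \<in> E" unfolding z_def using subspace_E m p_E
      by (intro subspace_add subspace_scale subspace_diff)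
    ultimately have "z \<in> closure D" using e(2) t(3) closure_subset[of D] by (auto simp: subset_iff)
    moreover have "dist m z = (1 - t) * l"
    proof -
      have "m - z = (1 - t) *\<^sub>R (m - p)" by (simp add: z_def algebra_simps)
      then show ?thesis using t by (simp add: dist_norm l_def)
    qed
    ultimately show False using p(2)[of z] t l by (simp add: l_def[symmetric])
  qed
  then have bd: "p \<in> boundary_in E D" using p(1) by (simp add: boundary_eq)
  have "\<nu> \<in> exterior_normals E D l p"
  proof -
    have "ball m l \<inter> D = {}"
      using p(2)[OF D_in_closure] by (fastforce simp: l_def)
    then have "ball (p + l *\<^sub>R \<nu>) l \<inter> D = {}" by (simp add: \<nu>[symmetric])
    moreover have "norm \<nu> = 1" using l by (simp add: \<nu>_def l_def dist_norm)
    moreover have "\<nu> \<in> E" unfolding \<nu>_def using subspace_E m p_E by (intro subspace_scale subspace_diff)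
    ultimately show ?thesis by (simp add: exterior_normals_def)
  qed
  also have "exterior_normals E D l p = exterior_normals E D r p"
    using exterior_sphere bd l by (auto simp: uniform_exterior_sphere_def)
  finally have "2 * r * inner \<nu> (q - p) \<le> (norm (q - p))\<^sup>2"
    using q by (rule exterior_normal_inner_le)
  then have "l * (2 * r * inner \<nu> (q - p)) \<le> l * (norm (q - p))\<^sup>2"
    using l by (intro mult_left_mono) auto
  then show ?thesis by (simp add: \<nu> l_def[symmetric] mult_ac)
qed auto

text \<open>
  Add the two inequalities of the previous lemma, for \<open>m\<close> tested with \<open>q\<close> and for \<open>n\<close> tested with \<open>p\<close>.
  The constant tends to 1 with the distance \<open>\<eta>\<close> from the domain.
\<close>

lemma nearest_point_lipschitz:
  assumes "m \<in> E" "p \<in> closure D" "\<And>z. z \<in> closure D \<Longrightarrow> dist m p \<le> dist m z" "dist m p \<le> \<eta>"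
    and "n \<in> E" "q \<in> closure D" "\<And>z. z \<in> closure D \<Longrightarrow> dist n q \<le> dist n z" "dist n q \<le> \<eta>"
    and "\<eta> \<le> r"
  shows "(1 - \<eta> / r) * dist p q \<le> dist m n"
proof (cases "p = q")
  case False
  let ?P = "(norm (q - p))\<^sup>2"
  have "2 * r * inner (m - p) (q - p) \<le> dist m p * ?P"
    using assms by (intro nearest_point_inner_le) auto
  also have "\<dots> \<le> \<eta> * ?P" using assms by (intro mult_right_mono) auto
  finally have 1: "2 * r * inner (m - p) (q - p) \<le> \<eta> * ?P" .
  have "2 * r * inner (n - q) (p - q) \<le> dist n q * (norm (p - q))\<^sup>2"
    using assms by (intro nearest_point_inner_le) auto
  also have "\<dots> \<le> \<eta> * ?P" using assms by (auto intro!: mult_right_mono simp: norm_minus_commute)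
  finally have 2: "2 * r * inner (n - q) (p - q) \<le> \<eta> * ?P" .
  have eq: "inner (m - p) (q - p) + inner (n - q) (p - q) = inner (m - n) (q - p) + ?P"
    by (simp add: power2_norm_eq_inner inner_diff_left inner_diff_right)
  have "2 * r * (inner (m - p) (q - p) + inner (n - q) (p - q)) \<le> 2 * (\<eta> * ?P)"
    using 1 2 by (simp add: distrib_left)
  then have "r * (inner (m - n) (q - p) + ?P) \<le> \<eta> * ?P" by (simp add: eq)
  then have "(r - \<eta>) * ?P \<le> r * inner (n - m) (q - p)"
    by (simp add: algebra_simps inner_diff_left inner_diff_right)
  also have "\<dots> \<le> r * (dist m n * norm (q - p))"
    using norm_cauchy_schwarz[of "n - m" "q - p"] r_pos
    by (intro mult_left_mono) (auto simp: dist_norm norm_minus_commute)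
  finally have "norm (q - p) * ((r - \<eta>) * norm (q - p)) \<le> norm (q - p) * (r * dist m n)"
    by (simp add: power2_eq_square mult_ac)
  then have "(r - \<eta>) * norm (q - p) \<le> r * dist m n" using False by simp
  then show ?thesis using r_pos by (simp add: dist_norm norm_minus_commute field_simps)
qed auto

section \<open>Short paths near the boundary\<close>

text \<open>
  A point \<open>q\<close> that is close to the closure of \<open>D\<close> relative to \<open>\<tau>\<close> is moved into \<open>D\<close> by \<open>\<tau> *\<^sub>R m\<close>: the
  displacement from a nearby point of \<open>D\<close> is \<open>\<tau> *\<^sub>R m\<close> up to a small relative error, so it lies in the
  open cone around \<open>m\<close>. The same \<open>m\<close> serves a whole neighbourhood of the boundary point, so
  polygons can be translated as a whole.
\<close>

lemma push_into_domain:
  assumes x: "x \<in> boundary_in E D"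
  obtains m \<kappa> where "m \<in> E" "norm m = 1" "0 < \<kappa>"
    "\<And>a q \<tau>. a \<in> closure D \<Longrightarrow> q \<in> E \<Longrightarrow> 0 < \<tau> \<Longrightarrow> dist q a \<le> \<kappa> * \<tau> \<Longrightarrow> dist q x + 2 * \<tau> < \<delta> \<Longrightarrow>
       q + \<tau> *\<^sub>R m \<in> D"
proof -
  obtain m where m: "m \<in> E" "norm m = 1"
    "\<And>y. y \<in> D \<inter> ball x \<delta> \<Longrightarrow> ((+) y ` open_cone E \<alpha> m) \<inter> ball x \<delta> \<subseteq> D"
    using interior_cone x unfolding uniform_interior_cone_def by meson
  have \<alpha>: "0 < \<alpha>" "\<alpha> \<le> pi / 2" using interior_cone by (auto simp: uniform_interior_cone_def)
  define c where "c = cos \<alpha>"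
  have c: "0 \<le> c" "c < 1"
    using \<alpha> cos_monotone_0_pi[of 0 \<alpha>] cos_ge_zero[of \<alpha>] pi_gt_zero by (auto simp: c_def)
  (* Two errors of size \<kappa> \<tau> have to fit into the cone: (1 + 2 \<kappa>) c < 1 - 2 \<kappa>. *)
  define \<kappa> where "\<kappa> = (1 - c) / 8"
  have \<kappa>: "0 < \<kappa>" "\<kappa> \<le> 1 / 8" using c by (auto simp: \<kappa>_def)
  show ?thesis
  proof (rule that[OF m(1,2) \<kappa>(1)])
    fix a q \<tau> assume a: "a \<in> closure D" and q: "q \<in> E" and \<tau>: "0 < \<tau>"
      and qa: "dist q a \<le> \<kappa> * \<tau>" and qx: "dist q x + 2 * \<tau> < \<delta>"
    obtain y where y: "y \<in> D" "dist y a < \<kappa> * \<tau>"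
      using a \<kappa> \<tau> closure_approachable[of a D] by (metis mult_pos_pos)
    have qy: "norm (q - y) \<le> 2 * \<kappa> * \<tau>"
      using qa y(2) dist_triangle2[of q y a] by (simp add: dist_norm)
    have \<kappa>\<tau>: "2 * \<kappa> * \<tau> \<le> \<tau>" using \<kappa> \<tau> by simp
    have "dist y x < \<delta>"
      using qy \<kappa>\<tau> qx \<tau> dist_triangle[of y x q] unfolding dist_norm norm_minus_commute[of y q]
      by linarith
    then have y_ball: "y \<in> D \<inter> ball x \<delta>" using y by (simp add: dist_commute)
    define z where "z = q + \<tau> *\<^sub>R m - y"
    have "z \<in> open_cone E \<alpha> m"
    proof -
      have "inner z m = \<tau> + inner (q - y) m"
        using m(2) by (simp add: z_def inner_diff_left inner_add_left power2_norm_eq_inner[symmetric])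
      moreover have "\<bar>inner (q - y) m\<bar> \<le> 2 * \<kappa> * \<tau>"
        using Cauchy_Schwarz_ineq2[of "q - y" m] m(2) qy by simp
      ultimately have low: "\<tau> - 2 * \<kappa> * \<tau> \<le> inner z m" by linarith
      have "norm z \<le> \<tau> + 2 * \<kappa> * \<tau>"
        using norm_triangle_ineq[of "\<tau> *\<^sub>R m" "q - y"] m(2) \<tau> qy by (simp add: z_def algebra_simps)
      then have up: "norm z * c \<le> (\<tau> + 2 * \<kappa> * \<tau>) * c" using c by (intro mult_right_mono)
      have "(1 + 2 * \<kappa>) * c < 1 - 2 * \<kappa>"
      proof -
        have "c = 1 - 8 * \<kappa>" by (simp add: \<kappa>_def field_simps)
        then have "(1 + 2 * \<kappa>) * c = 1 - 6 * \<kappa> - 16 * \<kappa> * \<kappa>"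
          by (simp only:) (simp add: algebra_simps)
        then show ?thesis using \<kappa> by (smt (verit) mult_pos_pos)
      qed
      then have "\<tau> * ((1 + 2 * \<kappa>) * c) < \<tau> * (1 - 2 * \<kappa>)" using \<tau> by simp
      then have "norm z * c < inner z m" using low up by (simp add: algebra_simps)
      moreover have "z \<in> E" unfolding z_def using subspace_E q m(1) y(1) D_subset_E
        by (auto intro!: subspace_add subspace_diff subspace_scale)
      ultimately show ?thesis by (simp add: open_cone_def c_def)
    qed
    then have "q + \<tau> *\<^sub>R m \<in> (+) y ` open_cone E \<alpha> m" by (auto simp: z_def intro: image_eqI[of _ _ z])
    moreover have "dist x (q + \<tau> *\<^sub>R m) \<le> dist q x + \<tau>"
      using norm_triangle_ineq4[of "x - q" "\<tau> *\<^sub>R m"] m(2) \<tau>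
      by (simp add: dist_norm norm_minus_commute algebra_simps)
    then have "q + \<tau> *\<^sub>R m \<in> ball x \<delta>" using qx \<tau> by simp
    ultimately show "q + \<tau> *\<^sub>R m \<in> D" using m(3)[OF y_ball] by blast
  qed
qed

end

lemma dist_le_of_in_segment:
  fixes a b :: "'a::real_normed_vector"
  assumes "x \<in> closed_segment a b" "y \<in> closed_segment a b" shows "dist x y \<le> dist a b"
proof -
  obtain t u where t: "0 \<le> t" "t \<le> 1" "x = (1 - t) *\<^sub>R a + t *\<^sub>R b"
    and u: "0 \<le> u" "u \<le> 1" "y = (1 - u) *\<^sub>R a + u *\<^sub>R b"
    using assms by (auto simp: in_segment)
  have "x - y = (u - t) *\<^sub>R (a - b)" by (simp add: t u algebra_simps)
  then have "dist x y = \<bar>u - t\<bar> * dist a b" by (simp add: dist_norm)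
  also have "\<dots> \<le> 1 * dist a b" using t u by (intro mult_right_mono) auto
  finally show ?thesis by simp
qed

context sphere_cone_domain begin

lemma path_dist_chain:
  assumes "\<And>i. i \<le> n \<Longrightarrow> p i \<in> D"
  shows "path_dist (p 0) (p n) \<le> (\<Sum>i<n. path_dist (p i) (p (Suc i)))"
  using assms
proof (induction n)
  case 0
  then show ?case using path_dist_segment[of "p 0" "p 0"] by simp
next
  case (Suc n)
  then have "path_dist (p 0) (p n) \<le> (\<Sum>i<n. path_dist (p i) (p (Suc i)))" by simp
  then show ?case using path_dist_triangle[of "p 0" "p n" "p (Suc n)"] Suc.prems by auto
qed

lemma segment_subset_E: "x \<in> E \<Longrightarrow> y \<in> E \<Longrightarrow> closed_segment x y \<subseteq> E"
  using subspace_E by (intro closed_segment_subset) (auto simp: subspace_imp_convex)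

text \<open>
  Otherwise \<open>D\<close> would cut out a relatively clopen part of the segment.
\<close>

lemma segment_meets_boundary:
  assumes "u \<in> D" "v \<in> E" "\<not> closed_segment u v \<subseteq> D"
  obtains x where "x \<in> closed_segment u v" "x \<in> boundary_in E D"
proof (rule ccontr)
  let ?S = "closed_segment u v"
  assume "\<not> thesis"
  then have eq: "?S \<inter> D = ?S \<inter> closure D"
    using that closure_subset[of D] by (auto simp: boundary_eq)
  obtain U where U: "open U" "D = E \<inter> U"
    using domain by (auto simp: domain_in_def openin_open)
  have S: "?S \<subseteq> E" using assms D_subset_E by (intro segment_subset_E) auto
  have "?S \<inter> D = ?S \<inter> U" using U(2) S by auto
  then have "openin (top_of_set ?S) (?S \<inter> D)" using U(1) by (simp add: openin_open_Int)
  moreover have "closedin (top_of_set ?S) (?S \<inter> D)" unfolding eq by (simp add: closedin_closed_Int)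
  moreover have "u \<in> ?S \<inter> D" using assms(1) by simp
  ultimately have "?S \<inter> D = ?S"
    using connected_clopen[of ?S] connected_segment(1)[of u v] by blast
  then show False using assms(3) by auto
qed

text \<open>
  The key estimate. If the segment from \<open>u\<close> to \<open>v\<close> leaves \<open>D\<close>, divide it into many parts and replace the
  division points by their nearest points in the closure. All distances to the closure are at most half of
  \<open>dist u v\<close>, so the edges grow at most by the Lipschitz constant of the projection. The edges of this
  chain may leave the closure, but only by less than their tiny length, so a translation by a small
  \<open>\<tau> *\<^sub>R m\<close> moves the chain into \<open>D\<close>. It costs only \<open>\<tau>\<close> at each end.
\<close>

lemma path_dist_le_of_near:
  assumes u: "u \<in> D" and v: "v \<in> D" and l: "dist u v \<le> r" "4 * dist u v < \<delta>"
  shows "path_dist u v \<le> dist u v / (1 - dist u v / (2 * r))"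
proof (cases "closed_segment u v \<subseteq> D")
  case True
  have "0 < 1 - dist u v / (2 * r)" "1 - dist u v / (2 * r) \<le> 1" using l r_pos by (auto simp: field_simps)
  then have "dist u v \<le> dist u v / (1 - dist u v / (2 * r))"
    using mult_left_mono[of "1 - dist u v / (2 * r)" 1 "dist u v"] by (simp add: pos_le_divide_eq)
  then show ?thesis using path_dist_segment[OF True] by simp
next
  case False
  define l where "l = dist u v"
  define K where "K = l / (1 - l / (2 * r))"
  have l_pos: "0 < l" using False u by (auto simp: l_def)
  have den: "1 / 2 \<le> 1 - l / (2 * r)" using l r_pos by (simp add: l_def field_simps)
  have K: "0 < K" using l_pos den by (simp add: K_def)
  obtain x where x: "x \<in> closed_segment u v" "x \<in> boundary_in E D"
    using segment_meets_boundary[OF u _ False] v D_subset_E by auto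
  have near_x: "dist z x \<le> l" if "z \<in> closed_segment u v" for z
    using dist_le_of_in_segment[OF that x(1)] by (simp add: l_def)
  obtain m \<kappa> where m: "m \<in> E" "norm m = 1" and \<kappa>: "0 < \<kappa>" and push:
    "\<And>a q \<tau>. a \<in> closure D \<Longrightarrow> q \<in> E \<Longrightarrow> 0 < \<tau> \<Longrightarrow> dist q a \<le> \<kappa> * \<tau> \<Longrightarrow> dist q x + 2 * \<tau> < \<delta> \<Longrightarrow>
       q + \<tau> *\<^sub>R m \<in> D"
    using push_into_domain[OF x(2)] by metis
  have "\<exists>p. p \<in> closure D \<and> (\<forall>q\<in>closure D. dist m p \<le> dist m q)" for m
    using nearest_point_exists[of m] u by (metis empty_iff)
  then obtain P where P: "\<And>m. P m \<in> closure D" "\<And>m q. q \<in> closure D \<Longrightarrow> dist m (P m) \<le> dist m q"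
    by metis
  have "path_dist u v \<le> K + e" if e: "0 < e" for e
  proof -
    define \<tau> where "\<tau> = min (e / 2) (\<delta> / 8)"
    have \<tau>: "0 < \<tau>" "\<tau> \<le> e / 2" "\<tau> \<le> \<delta> / 8" using e \<delta>_pos by (auto simp: \<tau>_def)
    have "0 < min (\<kappa> * \<tau>) (l / 2)" using \<kappa> \<tau> l_pos by simp
    then obtain N where N: "K / min (\<kappa> * \<tau>) (l / 2) < real (Suc N)"
      using reals_Archimedean2 by (metis less_Suc_eq of_nat_less_iff order.strict_trans lessI)
    define n where "n = Suc N"
    have n: "0 < n" "K / real n \<le> \<kappa> * \<tau>" "K / real n \<le> l / 2"
    proof -
      have "K / real n < min (\<kappa> * \<tau>) (l / 2)"
        using N \<open>0 < min (\<kappa> * \<tau>) (l / 2)\<close>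
        by (simp add: n_def pos_divide_less_eq mult.commute del: of_nat_Suc min_less_iff_conj)
      then show "0 < n" "K / real n \<le> \<kappa> * \<tau>" "K / real n \<le> l / 2" by (auto simp: n_def)
    qed
    define w where "w i = u + (real i / real n) *\<^sub>R (v - u)" for i
    define p where "p i = P (w i)" for i
    have w_seg: "w i \<in> closed_segment u v" if "i \<le> n" for i
      using that n(1) by (auto simp: w_def in_segment intro!: exI[of _ "real i / real n"]) (simp add: algebra_simps)
    have w_E: "w i \<in> E" if "i \<le> n" for i
      using w_seg[OF that] segment_subset_E u v D_subset_E by blast
    have p_cl: "p i \<in> closure D" for i by (simp add: p_def P)
    have wp: "dist (w i) (p i) \<le> l / 2" if "i \<le> n" for i
    proof (cases "real i / real n \<le> 1 / 2")
      case True
      have "dist (w i) (p i) \<le> dist (w i) u" using P(2) D_in_closure[OF u] by (simp add: p_def)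
      also have "\<dots> = (real i / real n) * l"
        by (simp add: w_def l_def dist_norm norm_minus_commute)
      also have "\<dots> \<le> 1 / 2 * l" using True l_pos by (intro mult_right_mono) auto
      finally show ?thesis by simp
    next
      case False
      have "dist (w i) (p i) \<le> dist (w i) v" using P(2) D_in_closure[OF v] by (simp add: p_def)
      also have "w i - v = (1 - real i / real n) *\<^sub>R (u - v)" by (simp add: w_def algebra_simps)
      then have "dist (w i) v = (1 - real i / real n) * l"
        using that n(1) by (simp add: l_def dist_norm)
      also have "\<dots> \<le> 1 / 2 * l" using False l_pos by (intro mult_right_mono) auto
      finally show ?thesis by simp
    qed
    have edge: "dist (p i) (p (Suc i)) \<le> K / real n" if "i < n" for i
    proof -
      have "(1 - (l / 2) / r) * dist (p i) (p (Suc i)) \<le> dist (w i) (w (Suc i))"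
        using that l_pos l unfolding p_def
        by (intro nearest_point_lipschitz P w_E wp[unfolded p_def]) (use r_pos in \<open>auto simp: l_def\<close>)
      also have "w (Suc i) - w i = (1 / real n) *\<^sub>R (v - u)"
        by (simp add: w_def add_divide_distrib algebra_simps)
      then have "dist (w i) (w (Suc i)) = l / real n"
        by (simp add: dist_norm l_def norm_minus_commute[of "w i"] norm_minus_commute[of u])
      finally have "dist (p i) (p (Suc i)) \<le> l / real n / (1 - l / (2 * r))"
        by (subst pos_le_divide_eq) (use den in linarith, simp add: mult.commute)
      then show ?thesis by (simp add: K_def divide_divide_eq_left mult.commute)
    qed
    have p_x: "dist (p i) x \<le> 3 / 2 * l" if "i \<le> n" for i
      using near_x[OF w_seg[OF that]] wp[OF that] dist_triangle[of "p i" x "w i"]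
      by (simp add: dist_commute)
    define q where "q i = p i + \<tau> *\<^sub>R m" for i
    have q_D: "q i \<in> D" if "i \<le> n" for i
      unfolding q_def using p_x[OF that] p_cl closure_subset_E \<tau> l \<kappa> \<delta>_pos
      by (intro push[of "p i"]) (auto simp: l_def)
    have q_edge: "path_dist (q i) (q (Suc i)) \<le> K / real n" if i: "i < n" for i
    proof -
      have "closed_segment (q i) (q (Suc i)) \<subseteq> D"
      proof
        fix z assume "z \<in> closed_segment (q i) (q (Suc i))"
        then have "z \<in> (+) (\<tau> *\<^sub>R m) ` closed_segment (p i) (p (Suc i))"
          by (simp only: q_def add.commute[of _ "\<tau> *\<^sub>R m"] closed_segment_translation)
        then obtain y where y: "y \<in> closed_segment (p i) (p (Suc i))" "z = y + \<tau> *\<^sub>R m"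
          by auto
        have "dist y (p i) \<le> dist (p (Suc i)) (p i)"
          using dist_le_of_in_segment[OF y(1), of "p i"] by (simp add: dist_commute)
        then have d: "dist y (p i) \<le> K / real n" using edge[OF i] by (simp add: dist_commute)
        have "dist y x \<le> 2 * l"
          using d n(3) p_x[OF less_imp_le[OF i]] dist_triangle[of y x "p i"] by linarith
        moreover have "y \<in> E" using y(1) segment_subset_E p_cl closure_subset_E by blast
        ultimately show "z \<in> D"
          unfolding y(2) using d n(2) \<tau> l \<delta>_pos
          by (intro push[of "p i"] p_cl) (auto simp: l_def)
      qed
      then have "path_dist (q i) (q (Suc i)) \<le> dist (q i) (q (Suc i))" by (rule path_dist_segment)
      then show ?thesis using edge[OF i] by (simp add: q_def)
    qed
    have lift: "path_dist a (a + \<tau> *\<^sub>R m) \<le> \<tau>" "a + \<tau> *\<^sub>R m \<in> D" if a: "a \<in> D" "dist a x \<le> l" for a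
    proof -
      have "a + \<sigma> *\<^sub>R m \<in> D" if "0 \<le> \<sigma>" "\<sigma> \<le> \<tau>" for \<sigma>
      proof (cases "\<sigma> = 0")
        case False
        then show ?thesis
          using that a l \<tau> D_subset_E \<kappa> \<delta>_pos by (intro push[of a]) (auto simp: D_in_closure l_def)
      qed (use a in simp)
      moreover have "closed_segment a (a + \<tau> *\<^sub>R m) \<subseteq> (\<lambda>\<sigma>. a + \<sigma> *\<^sub>R m) ` {0..\<tau>}"
      proof
        fix z assume "z \<in> closed_segment a (a + \<tau> *\<^sub>R m)"
        then obtain t where t: "0 \<le> t" "t \<le> 1" "z = (1 - t) *\<^sub>R a + t *\<^sub>R (a + \<tau> *\<^sub>R m)"
          by (auto simp: in_segment)
        then show "z \<in> (\<lambda>\<sigma>. a + \<sigma> *\<^sub>R m) ` {0..\<tau>}"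
          using \<tau>(1) mult_left_le_one_le[of \<tau> t]
          by (intro image_eqI[of _ _ "t * \<tau>"]) (auto simp: algebra_simps)
      qed
      ultimately have "closed_segment a (a + \<tau> *\<^sub>R m) \<subseteq> D" by auto
      from path_dist_segment[OF this] this m(2) \<tau>(1) show "path_dist a (a + \<tau> *\<^sub>R m) \<le> \<tau>" "a + \<tau> *\<^sub>R m \<in> D"
        by (auto simp: dist_norm)
    qed
    have "p 0 = u" using P(2)[OF D_in_closure[OF u], of "w 0"] by (simp add: p_def w_def)
    moreover have "w n = v" using n(1) by (simp add: w_def)
    then have "p n = v" using P(2)[OF D_in_closure[OF v], of v] by (simp add: p_def)
    ultimately have q0: "q 0 = u + \<tau> *\<^sub>R m" and qn: "q n = v + \<tau> *\<^sub>R m" by (simp_all add: q_def)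
    have "path_dist (q 0) (q n) \<le> (\<Sum>i<n. path_dist (q i) (q (Suc i)))" using q_D by (rule path_dist_chain)
    also have "\<dots> \<le> (\<Sum>i<n. K / real n)" by (intro sum_mono q_edge) auto
    also have "\<dots> = K" using n(1) by simp
    finally have "path_dist (q 0) (q n) \<le> K" .
    moreover have "path_dist u (q 0) \<le> \<tau>" "path_dist (q n) v \<le> \<tau>" "q 0 \<in> D" "q n \<in> D"
      using lift[OF u near_x] lift[OF v near_x] path_dist_commute[OF v] q0 qn by auto
    ultimately show "path_dist u v \<le> K + e"
      using path_dist_triangle[of u "q 0" v] path_dist_triangle[of "q 0" "q n" v] u v \<tau>(2) by simp
  qed
  then have "path_dist u v \<le> K" by (rule field_le_epsilon)
  then show ?thesis by (simp add: K_def l_def)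
qed

section \<open>The intrinsic metric on the closure\<close>

text \<open>
  The scale at which the intrinsic metric is comparable to the Euclidean one.
\<close>

definition \<rho> :: real where "\<rho> = min r (\<delta> / 5)"

lemma \<rho>_pos: "0 < \<rho>" and \<rho>_le_r: "\<rho> \<le> r"
  using r_pos \<delta>_pos by (auto simp: \<rho>_def)

lemma path_dist_le_quadratic:
  assumes "u \<in> D" "v \<in> D" "dist u v \<le> \<rho>"
  shows "path_dist u v \<le> dist u v + (dist u v)\<^sup>2 / r"
proof -
  let ?l = "dist u v"
  have l: "?l \<le> r" "4 * ?l < \<delta>" using assms(3) \<delta>_pos zero_le_dist[of u v] by (auto simp: \<rho>_def)
  have den: "0 < 1 - ?l / (2 * r)" using l(1) r_pos by (simp add: field_simps)
  have "?l \<le> (?l + ?l\<^sup>2 / r) * (1 - ?l / (2 * r))"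
  proof -
    have "?l * ?l * ?l \<le> ?l * ?l * r" using l(1) by (intro mult_left_mono) auto
    then show ?thesis using r_pos by (simp add: field_simps power2_eq_square)
  qed
  then have "?l / (1 - ?l / (2 * r)) \<le> ?l + ?l\<^sup>2 / r" using den by (simp add: pos_divide_le_eq)
  then show ?thesis using path_dist_le_of_near[OF assms(1,2) l] by simp
qed

lemma path_dist_le_two_dist:
  assumes "u \<in> D" "v \<in> D" "dist u v \<le> \<rho>" shows "path_dist u v \<le> 2 * dist u v"
proof -
  have "dist u v * dist u v \<le> r * dist u v"
    using assms(3) \<rho>_le_r by (intro mult_right_mono) auto
  then have "dist u v * dist u v / r \<le> dist u v" using r_pos by (simp add: pos_divide_le_eq mult.commute)
  then show ?thesis
    using path_dist_le_quadratic[OF assms] r_pos by (simp add: power2_eq_square)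
qed

abbreviation d :: "'a \<Rightarrow> 'a \<Rightarrow> real" where "d \<equiv> intrinsic_dist D"

lemma uniformly_continuous_path_dist: "uniformly_continuous_on (D \<times> D) (\<lambda>(u, v). path_dist u v)"
  unfolding uniformly_continuous_on_def
proof (intro allI impI)
  fix e :: real assume e: "0 < e"
  have "dist (case z' of (u, v) \<Rightarrow> path_dist u v) (case z of (u, v) \<Rightarrow> path_dist u v) < e"
    if z: "z \<in> D \<times> D" "z' \<in> D \<times> D" "dist z' z < min \<rho> (e / 4)" for z z'
  proof -
    obtain u v u' v' where eq: "z = (u, v)" "z' = (u', v')" by fastforce
    have D: "u \<in> D" "v \<in> D" "u' \<in> D" "v' \<in> D" using z eq by auto
    have "dist u u' \<le> dist z' z" "dist v v' \<le> dist z' z"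
      using dist_fst_le[of z z'] dist_snd_le[of z z'] by (auto simp: eq dist_commute)
    then have "path_dist u u' < e / 2" "path_dist v v' < e / 2"
      using z(3) path_dist_le_two_dist[of u u'] path_dist_le_two_dist[of v v'] D by auto
    then have "path_dist u' v' < path_dist u v + e" "path_dist u v < path_dist u' v' + e"
      using path_dist_triangle[of u u' v] path_dist_triangle[of u' v' v] path_dist_triangle[of u' u v'] path_dist_triangle[of u v v']
        path_dist_commute[of u u'] path_dist_commute[of v v'] D by auto
    then show ?thesis by (simp add: eq dist_real_def abs_less_iff)
  qed
  then show "\<exists>\<eta>>0. \<forall>z\<in>D \<times> D. \<forall>z'\<in>D \<times> D. dist z' z < \<eta> \<longrightarrow>
      dist (case z' of (u, v) \<Rightarrow> path_dist u v) (case z of (u, v) \<Rightarrow> path_dist u v) < e"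
    using e \<rho>_pos by (intro exI[of _ "min \<rho> (e / 4)"]) auto
qed

lemma d_eq_path_dist: "x \<in> D \<Longrightarrow> y \<in> D \<Longrightarrow> d x y = path_dist x y"
  by (simp add: intrinsic_dist_def)

text \<open>
  The \<open>Lim\<close> in the intrinsic metric exists because the smooth path distance is uniformly
  continuous on \<open>D \<times> D\<close>; its value is that of the continuous extension.
\<close>

lemma continuous_on_d: "continuous_on (closure D \<times> closure D) (\<lambda>(x, y). d x y)"
proof -
  obtain g where g: "uniformly_continuous_on (closure (D \<times> D)) g"
    "\<And>z. z \<in> D \<times> D \<Longrightarrow> (case z of (u, v) \<Rightarrow> path_dist u v) = g z"
    using uniformly_continuous_on_extension_on_closure[OF uniformly_continuous_path_dist] by metis
  have cont: "continuous_on (closure D \<times> closure D) g"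
    using uniformly_continuous_imp_continuous[OF g(1)] by (simp add: closure_Times)
  have "d x y = g (x, y)" if xy: "(x, y) \<in> closure D \<times> closure D" for x y
  proof (cases "(x, y) \<in> D \<times> D")
    case True
    then show ?thesis using g(2)[OF True] by (simp add: intrinsic_dist_def)
  next
    case False
    have "(g \<longlongrightarrow> g (x, y)) (at (x, y) within closure D \<times> closure D)"
      using cont xy by (simp add: continuous_on_def)
    then have "(g \<longlongrightarrow> g (x, y)) (at (x, y) within D \<times> D)"
      by (rule tendsto_within_subset) (use closure_subset in auto)
    then have "((\<lambda>(u, v). path_dist u v) \<longlongrightarrow> g (x, y)) (at (x, y) within D \<times> D)"
      by (rule Lim_transform_within[where d = 1]) (use g(2) in auto)
    moreover have "at (x, y) within D \<times> D \<noteq> bot"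
    proof -
      have "(x, y) \<in> closure (D \<times> D)" using xy by (simp add: closure_Times)
      then show ?thesis using False unfolding trivial_limit_within closure_def by blast
    qed
    ultimately have "Lim (at (x, y) within D \<times> D) (\<lambda>(u, v). path_dist u v) = g (x, y)"
      by (intro tendsto_Lim)
    then show ?thesis using False by (auto simp: intrinsic_dist_def)
  qed
  then show ?thesis by (intro continuous_on_eq[OF cont]) auto
qed

lemma tendsto_d:
  assumes "(f \<longlongrightarrow> x) F" "(g \<longlongrightarrow> y) F" "\<forall>\<^sub>F t in F. f t \<in> closure D" "\<forall>\<^sub>F t in F. g t \<in> closure D"
    "x \<in> closure D" "y \<in> closure D"
  shows "((\<lambda>t. d (f t) (g t)) \<longlongrightarrow> d x y) F"
  using continuous_on_tendsto_compose[OF continuous_on_d tendsto_Pair[OF assms(1,2)]] assms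
  by (simp add: eventually_conj)

lemma LIMSEQ_d:
  assumes "X \<longlonglongrightarrow> x" "Y \<longlonglongrightarrow> y" "\<And>n. X n \<in> closure D" "\<And>n. Y n \<in> closure D"
  shows "(\<lambda>n. d (X n) (Y n)) \<longlonglongrightarrow> d x y"
  using assms closed_sequentially[OF closed_closure, of X D x] closed_sequentially[OF closed_closure, of Y D y]
  by (intro tendsto_d) auto

lemma sequence_in_domain:
  assumes "x \<in> closure D" obtains X where "\<And>n. X n \<in> D" "\<And>n. X n \<in> closure D" "X \<longlonglongrightarrow> x"
  using assms D_in_closure by (auto simp: closure_sequential)

lemma d_ge_dist: assumes "x \<in> closure D" "y \<in> closure D" shows "dist x y \<le> d x y"
proof -
  obtain X Y where X: "\<And>n. X n \<in> D" "\<And>n. X n \<in> closure D" "X \<longlonglongrightarrow> x"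
    and Y: "\<And>n. Y n \<in> D" "\<And>n. Y n \<in> closure D" "Y \<longlonglongrightarrow> y"
    using sequence_in_domain assms by metis
  have "dist (X n) (Y n) \<le> d (X n) (Y n)" for n
    using path_dist_ge_dist X(1) Y(1) by (simp add: d_eq_path_dist)
  then show ?thesis
    by (intro LIMSEQ_le[OF tendsto_dist[OF X(3) Y(3)] LIMSEQ_d[OF X(3) Y(3) X(2) Y(2)]]) auto
qed

lemma d_commute: assumes "x \<in> closure D" "y \<in> closure D" shows "d x y = d y x"
proof -
  obtain X Y where X: "\<And>n. X n \<in> D" "\<And>n. X n \<in> closure D" "X \<longlonglongrightarrow> x"
    and Y: "\<And>n. Y n \<in> D" "\<And>n. Y n \<in> closure D" "Y \<longlonglongrightarrow> y"
    using sequence_in_domain assms by metis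
  have "d (X n) (Y n) = d (Y n) (X n)" for n
    using path_dist_commute X(1) Y(1) by (simp add: d_eq_path_dist)
  then show ?thesis
    using LIMSEQ_d[OF X(3) Y(3) X(2) Y(2)] LIMSEQ_d[OF Y(3) X(3) Y(2) X(2)] LIMSEQ_unique by simp
qed

lemma d_triangle:
  assumes "x \<in> closure D" "y \<in> closure D" "z \<in> closure D" shows "d x z \<le> d x y + d y z"
proof -
  obtain X Y Z where X: "\<And>n. X n \<in> D" "\<And>n. X n \<in> closure D" "X \<longlonglongrightarrow> x"
    and Y: "\<And>n. Y n \<in> D" "\<And>n. Y n \<in> closure D" "Y \<longlonglongrightarrow> y"
    and Z: "\<And>n. Z n \<in> D" "\<And>n. Z n \<in> closure D" "Z \<longlonglongrightarrow> z"
    using sequence_in_domain assms by metis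
  have "d (X n) (Z n) \<le> d (X n) (Y n) + d (Y n) (Z n)" for n
    using path_dist_triangle X(1) Y(1) Z(1) by (simp add: d_eq_path_dist)
  then show ?thesis
    by (intro LIMSEQ_le[OF LIMSEQ_d[OF X(3) Z(3) X(2) Z(2)]
          tendsto_add[OF LIMSEQ_d[OF X(3) Y(3) X(2) Y(2)] LIMSEQ_d[OF Y(3) Z(3) Y(2) Z(2)]]]) auto
qed

lemma d_le_quadratic:
  assumes "x \<in> closure D" "y \<in> closure D" "dist x y < \<rho>"
  shows "d x y \<le> dist x y + (dist x y)\<^sup>2 / r"
proof -
  obtain X Y where X: "\<And>n. X n \<in> D" "\<And>n. X n \<in> closure D" "X \<longlonglongrightarrow> x"
    and Y: "\<And>n. Y n \<in> D" "\<And>n. Y n \<in> closure D" "Y \<longlonglongrightarrow> y"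
    using sequence_in_domain assms by metis
  have lim: "(\<lambda>n. dist (X n) (Y n)) \<longlonglongrightarrow> dist x y" by (rule tendsto_dist[OF X(3) Y(3)])
  have "\<forall>\<^sub>F n in sequentially. dist (X n) (Y n) < \<rho>" using order_tendstoD(2)[OF lim assms(3)] .
  then have "\<forall>\<^sub>F n in sequentially. d (X n) (Y n) \<le> dist (X n) (Y n) + (dist (X n) (Y n))\<^sup>2 / r"
    by eventually_elim (use path_dist_le_quadratic X(1) Y(1) in \<open>simp add: d_eq_path_dist\<close>)
  moreover have "(\<lambda>n. dist (X n) (Y n) + (dist (X n) (Y n))\<^sup>2 / r) \<longlonglongrightarrow> dist x y + (dist x y)\<^sup>2 / r"
    using r_pos by (intro tendsto_intros lim) auto
  ultimately show ?thesis
    by (intro tendsto_le[OF _ _ LIMSEQ_d[OF X(3) Y(3) X(2) Y(2)]]) auto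
qed

lemma d_self: "x \<in> closure D \<Longrightarrow> d x x = 0"
  using d_le_quadratic[of x x] d_ge_dist[of x x] \<rho>_pos by simp

lemma d_nonneg: "x \<in> closure D \<Longrightarrow> y \<in> closure D \<Longrightarrow> 0 \<le> d x y"
  using d_ge_dist[of x y] zero_le_dist[of x y] by linarith

lemma d_eq_0_iff: "x \<in> closure D \<Longrightarrow> y \<in> closure D \<Longrightarrow> d x y = 0 \<longleftrightarrow> x = y"
  using d_ge_dist[of x y] d_self by auto

lemma d_le_diameter:
  assumes "x \<in> closure D" "y \<in> closure D" shows "d x y \<le> intrinsic_diameter D"
proof -
  have "bounded ((\<lambda>(x, y). d x y) ` (closure D \<times> closure D))"
    by (intro compact_imp_bounded compact_continuous_image continuous_on_d compact_Times compact_closure)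
  then have "bdd_above ((\<lambda>(x, y). d x y) ` (closure D \<times> closure D))" by (rule bounded_imp_bdd_above)
  then have bdd: "bdd_above ((\<lambda>(x, y). d x y) ` (D \<times> D))"
    by (rule bdd_above_mono) (use closure_subset in auto)
  have le: "d x y \<le> intrinsic_diameter D" if "x \<in> D" "y \<in> D" for x y
    unfolding intrinsic_diameter_def using cSUP_upper[OF _ bdd, of "(x, y)"] that by auto
  obtain X Y where X: "\<And>n. X n \<in> D" "\<And>n. X n \<in> closure D" "X \<longlonglongrightarrow> x"
    and Y: "\<And>n. Y n \<in> D" "\<And>n. Y n \<in> closure D" "Y \<longlonglongrightarrow> y"
    using sequence_in_domain assms by metis
  show ?thesis
    by (rule LIMSEQ_le_const2[OF LIMSEQ_d[OF X(3) Y(3) X(2) Y(2)]]) (use le X(1) Y(1) in auto)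
qed

text \<open>
  Almost splitting points in \<open>D\<close> converge along a subsequence, by compactness of the closure.
\<close>

lemma d_split:
  assumes "x \<in> closure D" "y \<in> closure D" "0 \<le> t" "t \<le> d x y"
  obtains z where "z \<in> closure D" "d x z \<le> t" "d z y \<le> d x y - t"
proof -
  obtain X Y where X: "\<And>n. X n \<in> D" "\<And>n. X n \<in> closure D" "X \<longlonglongrightarrow> x"
    and Y: "\<And>n. Y n \<in> D" "\<And>n. Y n \<in> closure D" "Y \<longlonglongrightarrow> y"
    using sequence_in_domain assms by metis
  have "\<exists>z\<in>D. d (X n) z \<le> min t (d (X n) (Y n)) \<and>
      d z (Y n) \<le> d (X n) (Y n) - min t (d (X n) (Y n)) + 1 / real (Suc n)" for n
    using path_dist_split[of "X n" "Y n" "min t (d (X n) (Y n))" "1 / real (Suc n)"] X Y assms(3) d_nonneg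
    by (auto simp: d_eq_path_dist) (metis d_eq_path_dist)
  then obtain Z where Z: "\<And>n. Z n \<in> D" "\<And>n. d (X n) (Z n) \<le> min t (d (X n) (Y n))"
    "\<And>n. d (Z n) (Y n) \<le> d (X n) (Y n) - min t (d (X n) (Y n)) + 1 / real (Suc n)" by metis
  have Z_cl: "Z n \<in> closure D" for n using Z(1) D_in_closure by auto
  then obtain z f where z: "z \<in> closure D" "strict_mono f" "(Z \<circ> f) \<longlonglongrightarrow> z"
    using compact_closure unfolding compact_def by metis
  note Xf = LIMSEQ_subseq_LIMSEQ[OF X(3) z(2)] and Yf = LIMSEQ_subseq_LIMSEQ[OF Y(3) z(2)]
  have XY: "(\<lambda>n. d ((X \<circ> f) n) ((Y \<circ> f) n)) \<longlonglongrightarrow> d x y"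
    using X Y by (intro LIMSEQ_d Xf Yf) auto
  have XZ: "(\<lambda>n. d ((X \<circ> f) n) ((Z \<circ> f) n)) \<longlonglongrightarrow> d x z"
    using X Z_cl by (intro LIMSEQ_d Xf z) auto
  have ZY: "(\<lambda>n. d ((Z \<circ> f) n) ((Y \<circ> f) n)) \<longlonglongrightarrow> d z y"
    using Z_cl Y by (intro LIMSEQ_d Yf z) auto
  have "d x z \<le> t"
    by (rule LIMSEQ_le_const2[OF XZ]) (use Z(2) in \<open>auto simp: min_le_iff_disj intro: order_trans\<close>)
  moreover have "d z y \<le> d x y - min t (d x y) + 0"
  proof (rule LIMSEQ_le[OF ZY])
    have "(\<lambda>n. 1 / real (Suc (f n))) \<longlonglongrightarrow> 0"
      using LIMSEQ_subseq_LIMSEQ[OF LIMSEQ_inverse_real_of_nat z(2)] by (simp add: o_def inverse_eq_divide)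
    then show "(\<lambda>n. d ((X \<circ> f) n) ((Y \<circ> f) n) - min t (d ((X \<circ> f) n) ((Y \<circ> f) n)) + 1 / real (Suc (f n)))
        \<longlonglongrightarrow> d x y - min t (d x y) + 0"
      by (intro tendsto_intros XY)
  qed (use Z(3) in auto)
  ultimately show ?thesis using that[OF z(1)] assms(4) by simp
qed

end

section \<open>Curves and geodesics in the closure\<close>

lemma has_vector_derivativeI_power:
  assumes "0 < h0" "\<And>h. 0 \<le> h \<Longrightarrow> h \<le> h0 \<Longrightarrow> norm (f h - f 0 - h *\<^sub>R v) \<le> A * h * sqrt h"
    and "S \<subseteq> {0..}"
  shows "(f has_vector_derivative v) (at 0 within S)"
  unfolding has_vector_derivative_def has_derivative_within_alt
proof (intro conjI allI impI)
  show "bounded_linear (\<lambda>x. x *\<^sub>R v)" by (rule bounded_linear_scaleR_left)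
  fix e :: real assume e: "0 < e"
  have "((\<lambda>h. A * sqrt h) \<longlongrightarrow> A * sqrt 0) (at_right 0)" by (intro tendsto_intros)
  then have "\<forall>\<^sub>F h in at_right 0. A * sqrt h < e" using e by (intro order_tendstoD(2)) auto
  then obtain b where b: "0 < b" "\<And>h. 0 < h \<Longrightarrow> h < b \<Longrightarrow> A * sqrt h < e"
    by (auto simp: eventually_at_right_field)
  have "norm (f y - f 0 - (y - 0) *\<^sub>R v) \<le> e * norm (y - 0)" if "y \<in> S" "norm (y - 0) < min b h0" for y
  proof (cases "y = 0")
    case False
    then have y: "0 < y" "y < b" "y < h0" using that assms(3) by auto
    have "norm (f y - f 0 - y *\<^sub>R v) \<le> y * (A * sqrt y)" using assms(2)[of y] y by (simp add: mult_ac)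
    also have "\<dots> \<le> y * e" using y b(2)[of y] by (intro mult_left_mono) auto
    finally show ?thesis using y by (simp add: mult.commute)
  qed simp
  then show "\<exists>d>0. \<forall>y\<in>S. norm (y - 0) < d \<longrightarrow> norm (f y - f 0 - (y - 0) *\<^sub>R v) \<le> e * norm (y - 0)"
    using b(1) assms(1) by (intro exI[of _ "min b h0"]) auto
qed

text \<open>
  Used for the difference quotients of a geodesic. Controlling \<open>q\<close> over one octave is enough: the
  errors over consecutive octaves form a geometric series of ratio \<open>1 / sqrt 2 < 3 / 4\<close>, whence the factor
  4.
\<close>

lemma dyadic_cauchy_at_zero:
  fixes q :: "real \<Rightarrow> 'a::banach"
  assumes L: "0 < L" and B: "0 \<le> B"
    and step: "\<And>h k. 0 < k \<Longrightarrow> k \<le> h \<Longrightarrow> h \<le> 2 * k \<Longrightarrow> h \<le> L \<Longrightarrow> norm (q h - q k) \<le> B * sqrt h"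
  shows "\<exists>v. \<forall>h. 0 < h \<and> h \<le> L \<longrightarrow> norm (q h - v) \<le> 4 * B * sqrt h"
proof -
  have dyadic: "norm (q h - q k) \<le> 4 * B * sqrt h" if "0 < k" "k \<le> h" "h \<le> 2 ^ n * k" "h \<le> L" for n h k
    using that
  proof (induction n arbitrary: h)
    case (Suc n)
    show ?case
    proof (cases "h \<le> 2 * k")
      case True
      have "B * sqrt h \<le> 4 * B * sqrt h" using B Suc.prems by (intro mult_right_mono) auto
      then show ?thesis using step[OF Suc.prems(1,2) True Suc.prems(4)] by linarith
    next
      case False
      have "norm (q (h / 2) - q k) \<le> 4 * B * sqrt (h / 2)"
        using Suc.prems False by (intro Suc.IH) auto
      also have "\<dots> \<le> 4 * B * (3 / 4 * sqrt h)"
      proof (intro mult_left_mono)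
        have "sqrt (h / 2) \<le> sqrt ((3 / 4)\<^sup>2 * h)"
          using Suc.prems by (intro real_sqrt_le_mono) (auto simp: power2_eq_square)
        then show "sqrt (h / 2) \<le> 3 / 4 * sqrt h" by (simp only: real_sqrt_mult) simp
      qed (use B in auto)
      finally have "norm (q (h / 2) - q k) \<le> 3 * B * sqrt h" by simp
      moreover have "norm (q h - q (h / 2)) \<le> B * sqrt h" using Suc.prems by (intro step) auto
      ultimately show ?thesis using norm_triangle_ineq[of "q h - q (h / 2)" "q (h / 2) - q k"] by simp
    qed
  qed (use B in auto)
  have cauchy: "norm (q h - q k) \<le> 4 * B * sqrt h" if "0 < k" "k \<le> h" "h \<le> L" for h k
  proof -
    obtain n where "h / k < 2 ^ n" using real_arch_pow[of 2 "h / k"] by auto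
    then show ?thesis using that by (intro dyadic[where n = n]) (auto simp: field_simps)
  qed
  define u where "u n = L / real (Suc n)" for n
  have u: "0 < u n" "u n \<le> L" for n using L by (auto simp: u_def field_simps)
  have u_lim: "u \<longlonglongrightarrow> 0"
    using tendsto_mult_left[OF LIMSEQ_inverse_real_of_nat, of L] by (simp add: u_def[abs_def] divide_inverse)
  have u_mono: "u n \<le> u m" if "m \<le> n" for m n
    using that L by (auto simp: u_def intro!: divide_left_mono)
  have "(\<lambda>n. 4 * B * sqrt (u n)) \<longlonglongrightarrow> 4 * B * sqrt 0" by (intro tendsto_intros u_lim)
  then have lim0: "(\<lambda>n. 4 * B * sqrt (u n)) \<longlonglongrightarrow> 0" by simp
  have "Cauchy (\<lambda>n. q (u n))"
  proof (rule metric_CauchyI)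
    fix e :: real assume "0 < e"
    then have "\<forall>\<^sub>F n in sequentially. 4 * B * sqrt (u n) < e / 2"
      by (intro order_tendstoD(2)[OF lim0]) simp
    then obtain M where M: "4 * B * sqrt (u M) < e / 2" by (auto simp: eventually_sequentially)
    have near: "dist (q (u M)) (q (u n)) < e / 2" if "M \<le> n" for n
      using cauchy[OF u(1)[of n] u_mono[OF that] u(2)] M by (simp add: dist_norm)
    show "\<exists>M. \<forall>m\<ge>M. \<forall>n\<ge>M. dist (q (u m)) (q (u n)) < e"
      using near dist_triangle_half_r by blast
  qed
  then obtain v where v: "(\<lambda>n. q (u n)) \<longlonglongrightarrow> v" using Cauchy_convergent_iff convergent_def by blast
  show ?thesis
  proof (intro exI[of _ v] allI impI)
    fix h assume "0 < h \<and> h \<le> L"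
    then have h: "0 < h" "h \<le> L" by auto
    have "\<forall>\<^sub>F n in sequentially. u n < h" using order_tendstoD(2)[OF u_lim h(1)] .
    then have "\<forall>\<^sub>F n in sequentially. norm (q h - q (u n)) \<le> 4 * B * sqrt h"
      by eventually_elim (use cauchy u h in auto)
    then show "norm (q h - v) \<le> 4 * B * sqrt h"
      by (intro tendsto_upperbound[OF tendsto_norm[OF tendsto_diff[OF tendsto_const v]]]) auto
  qed
qed

lemma curve_length_le:
  assumes "a \<le> b" "\<And>s t. s \<in> {a..b} \<Longrightarrow> t \<in> {a..b} \<Longrightarrow> dist (\<gamma> s) (\<gamma> t) \<le> \<bar>s - t\<bar>"
  shows "curve_length \<gamma> a b \<le> ennreal (b - a)"
  unfolding curve_length_def
proof (rule SUP_least, clarify)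
  fix n :: nat and p :: "nat \<Rightarrow> real" assume p: "mono_on {..n} p" "p ` {..n} \<subseteq> {a..b}"
  have "(\<Sum>i<n. dist (\<gamma> (p i)) (\<gamma> (p (Suc i)))) \<le> (\<Sum>i<n. p (Suc i) - p i)"
  proof (rule sum_mono)
    fix i assume i: "i \<in> {..<n}"
    have "p i \<in> {a..b}" "p (Suc i) \<in> {a..b}" by (rule subsetD[OF p(2)], use i in simp)+
    moreover have "p i \<le> p (Suc i)" using mono_onD[OF p(1), of i "Suc i"] i by auto
    ultimately show "dist (\<gamma> (p i)) (\<gamma> (p (Suc i))) \<le> p (Suc i) - p i"
      using assms(2)[of "p i" "p (Suc i)"] by simp
  qed
  also have "\<dots> = p n - p 0" by (rule sum_lessThan_telescope)
  also have "\<dots> \<le> b - a"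
  proof -
    have "p n \<in> {a..b}" "p 0 \<in> {a..b}" using p(2) by auto
    then show ?thesis by simp
  qed
  finally show "ennreal (\<Sum>i<n. dist (\<gamma> (p i)) (\<gamma> (p (Suc i)))) \<le> ennreal (b - a)"
    by (rule ennreal_leI)
qed

lemma curve_length_ge:
  assumes "mono_on {..n} p" "p ` {..n} \<subseteq> {a..b}"
  shows "ennreal (\<Sum>i<n. dist (\<gamma> (p i)) (\<gamma> (p (Suc i)))) \<le> curve_length \<gamma> a b"
  unfolding curve_length_def using assms by (intro SUP_upper2[of "(n, p)"]) auto

lemma uniform_partition:
  assumes "0 < (n::nat)" "a \<le> (b::real)"
  defines "p \<equiv> \<lambda>i. a + real i * ((b - a) / real n)"
  shows "mono_on {..n} p" "p ` {..n} \<subseteq> {a..b}" "p 0 = a" "p n = b" "p (Suc i) - p i = (b - a) / real n"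
proof -
  have h: "0 \<le> (b - a) / real n" using assms by simp
  show "mono_on {..n} p" unfolding p_def using h by (intro mono_onI add_left_mono mult_right_mono) auto
  have "a + real (Suc i) * h - (a + real i * h) = h" for h by (simp add: algebra_simps)
  then show "p (Suc i) - p i = (b - a) / real n" by (simp only: p_def)
  show "p 0 = a" "p n = b" using assms(1) by (auto simp: p_def)
  show "p ` {..n} \<subseteq> {a..b}"
  proof
    fix t assume "t \<in> p ` {..n}"
    then obtain i where i: "i \<le> n" "t = p i" by auto
    have "real i * ((b - a) / real n) \<le> real n * ((b - a) / real n)"
      using i h by (intro mult_right_mono) auto
    moreover have "0 \<le> real i * ((b - a) / real n)" using h by (intro mult_nonneg_nonneg) auto
    ultimately show "t \<in> {a..b}" using i assms(1) by (simp add: p_def)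
  qed
qed

lemma sum_quadratic_steps:
  assumes "0 < (n::nat)"
  shows "(\<Sum>i<n. l / real n + c * (l / real n)\<^sup>2 / r) = l + c * (l\<^sup>2 / r / real n)"
  using assms by (simp add: field_simps power2_eq_square)

lemma fine_partition_exists:
  assumes "0 < \<rho>" "0 < e"
  obtains n :: nat where "0 < n" "L / real n < \<rho>" "M / real n \<le> e"
proof -
  obtain n :: nat where n: "max 0 (max (L / \<rho>) (M / e)) < real n" using reals_Archimedean2 by blast
  then have "0 < n" "L < \<rho> * real n" "M \<le> e * real n" using assms by (auto simp: field_simps)
  then show ?thesis using that[of n] by (simp add: field_simps)
qed

context sphere_cone_domain begin

lemma d_chain:
  assumes "\<And>i. i \<le> n \<Longrightarrow> p i \<in> closure D"
  shows "d (p 0) (p n) \<le> (\<Sum>i<n. d (p i) (p (Suc i)))"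
  using assms
proof (induction n)
  case (Suc n)
  then have "d (p 0) (p n) \<le> (\<Sum>i<n. d (p i) (p (Suc i)))" by simp
  then show ?case using d_triangle[of "p 0" "p n" "p (Suc n)"] Suc.prems by auto
qed (simp add: d_self)

text \<open>
  Subdivide finely: the quadratic errors of the local estimate add up to something that tends to zero. In
  particular \<open>d\<close> is at most the length of any curve in the closure, and the trajectories of the pursuit
  are 1-Lipschitz for \<open>d\<close>.
\<close>

lemma d_le_of_lipschitz:
  assumes "a \<le> b" "\<gamma> ` {a..b} \<subseteq> closure D"
    "\<And>s t. s \<in> {a..b} \<Longrightarrow> t \<in> {a..b} \<Longrightarrow> dist (\<gamma> s) (\<gamma> t) \<le> \<bar>s - t\<bar>"
  shows "d (\<gamma> a) (\<gamma> b) \<le> b - a"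
proof (rule field_le_epsilon)
  fix e :: real assume "0 < e"
  obtain n :: nat where n: "0 < n" "(b - a) / real n < \<rho>" "(b - a)\<^sup>2 / r / real n \<le> e"
    using fine_partition_exists[OF \<rho>_pos \<open>0 < e\<close>] .
  define p where "p i = a + real i * ((b - a) / real n)" for i :: nat
  note p = uniform_partition[OF n(1) assms(1), folded p_def]
  define h where "h = (b - a) / real n"
  have p_in: "p i \<in> {a..b}" if "i \<le> n" for i using p(2) that by auto
  have h: "0 \<le> h" "h < \<rho>" using n assms(1) by (auto simp: h_def)
  have step: "d (\<gamma> (p i)) (\<gamma> (p (Suc i))) \<le> h + h\<^sup>2 / r" if "i < n" for i
  proof -
    have dist: "dist (\<gamma> (p i)) (\<gamma> (p (Suc i))) \<le> h"
    proof -
      have "p (Suc i) - p i = h" using p(5)[of i] by (simp add: h_def)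
      then show ?thesis
        using assms(3)[of "p i" "p (Suc i)"] p_in[of i] p_in[of "Suc i"] that h(1) by simp
    qed
    have "d (\<gamma> (p i)) (\<gamma> (p (Suc i))) \<le> dist (\<gamma> (p i)) (\<gamma> (p (Suc i))) + (dist (\<gamma> (p i)) (\<gamma> (p (Suc i))))\<^sup>2 / r"
      using dist h assms(2) p_in that by (intro d_le_quadratic) auto
    also have "\<dots> \<le> h + h\<^sup>2 / r"
      using dist r_pos by (intro add_mono divide_right_mono power_mono) auto
    finally show ?thesis .
  qed
  have "d (\<gamma> (p 0)) (\<gamma> (p n)) \<le> (\<Sum>i<n. d (\<gamma> (p i)) (\<gamma> (p (Suc i))))"
    using p_in assms(2) by (intro d_chain) auto
  also have "\<dots> \<le> (\<Sum>i<n. h + h\<^sup>2 / r)" by (intro sum_mono step) auto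
  also have "\<dots> = (b - a) + (b - a)\<^sup>2 / r / real n"
    using sum_quadratic_steps[OF n(1), of "b - a" 1 r] by (simp only: h_def mult_1)
  finally show "d (\<gamma> a) (\<gamma> b) \<le> b - a + e" using n(3) p(3,4) by simp
qed

lemma dist_ge_of_d:
  assumes "x \<in> closure D" "y \<in> closure D" "d x y < \<rho>"
  shows "d x y - (d x y)\<^sup>2 / r \<le> dist x y"
proof -
  have le: "dist x y \<le> d x y" using d_ge_dist assms by blast
  then have "d x y \<le> dist x y + (dist x y)\<^sup>2 / r" using assms by (intro d_le_quadratic) auto
  also have "(dist x y)\<^sup>2 / r \<le> (d x y)\<^sup>2 / r" using le r_pos by (intro divide_right_mono power_mono) auto
  finally show ?thesis by simp
qed

text \<open>
  Equivalent to the definition by Euclidean curve length (\<open>unit_speed_geodesic_iff_geod\<close>), but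
  stable under limits and suited to the comparison inequality.
\<close>

definition geod :: "'a \<Rightarrow> 'a \<Rightarrow> (real \<Rightarrow> 'a) \<Rightarrow> bool" where
  "geod x y \<gamma> \<longleftrightarrow> \<gamma> 0 = x \<and> \<gamma> (d x y) = y \<and> \<gamma> ` {0..d x y} \<subseteq> closure D \<and>
     (\<forall>s\<in>{0..d x y}. \<forall>t\<in>{0..d x y}. d (\<gamma> s) (\<gamma> t) = \<bar>s - t\<bar>)"

lemma geodI:
  assumes "x \<in> closure D" "y \<in> closure D" "\<gamma> 0 = x" "\<gamma> (d x y) = y" "\<gamma> ` {0..d x y} \<subseteq> closure D"
    and le: "\<And>s t. 0 \<le> s \<Longrightarrow> s \<le> t \<Longrightarrow> t \<le> d x y \<Longrightarrow> d (\<gamma> s) (\<gamma> t) \<le> t - s"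
  shows "geod x y \<gamma>"
proof -
  have in_cl: "\<gamma> s \<in> closure D" if "0 \<le> s" "s \<le> d x y" for s using assms(5) that by auto
  have eq: "d (\<gamma> s) (\<gamma> t) = t - s" if "0 \<le> s" "s \<le> t" "t \<le> d x y" for s t
  proof (rule antisym[OF le[OF that]])
    have "d x y \<le> d x (\<gamma> s) + d (\<gamma> s) y" "d (\<gamma> s) y \<le> d (\<gamma> s) (\<gamma> t) + d (\<gamma> t) y"
      using in_cl assms(1,2) that by (intro d_triangle; simp)+
    then show "t - s \<le> d (\<gamma> s) (\<gamma> t)" using le[of 0 s] le[of t "d x y"] that assms(3,4) by simp
  qed
  have "d (\<gamma> s) (\<gamma> t) = \<bar>s - t\<bar>" if "s \<in> {0..d x y}" "t \<in> {0..d x y}" for s t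
    using eq[of s t] eq[of t s] that d_commute[of "\<gamma> s" "\<gamma> t"] in_cl by (cases "s \<le> t") auto
  then show ?thesis using assms(3-5) by (simp add: geod_def)
qed

lemma geodD:
  assumes "geod x y \<gamma>"
  shows "\<gamma> 0 = x" "\<gamma> (d x y) = y" "\<And>s. 0 \<le> s \<Longrightarrow> s \<le> d x y \<Longrightarrow> \<gamma> s \<in> closure D"
    "\<And>s t. 0 \<le> s \<Longrightarrow> s \<le> d x y \<Longrightarrow> 0 \<le> t \<Longrightarrow> t \<le> d x y \<Longrightarrow> d (\<gamma> s) (\<gamma> t) = \<bar>s - t\<bar>"
  using assms by (auto simp: geod_def)

lemma geod_dist_le:
  assumes "geod x y \<gamma>" "0 \<le> s" "s \<le> d x y" "0 \<le> t" "t \<le> d x y"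
  shows "dist (\<gamma> s) (\<gamma> t) \<le> \<bar>s - t\<bar>"
  using d_ge_dist[of "\<gamma> s" "\<gamma> t"] geodD(3,4)[OF assms(1)] assms(2-) by simp

text \<open>
  Euclidean length and intrinsic distance agree along a geodesic because chords and intrinsic
  distances differ to second order only.
\<close>

lemma unit_speed_geodesic_iff_geod:
  assumes x: "x \<in> closure D" and y: "y \<in> closure D"
  shows "unit_speed_geodesic D x y \<gamma> \<longleftrightarrow> geod x y \<gamma>"
proof
  assume g: "geod x y \<gamma>"
  note g' = geodD[OF g]
  have lip: "dist (\<gamma> s) (\<gamma> t) \<le> \<bar>s - t\<bar>" if "s \<in> {0..d x y}" "t \<in> {0..d x y}" for s t
    using geod_dist_le[OF g] that by auto
  have "continuous_on {0..d x y} \<gamma>"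
  proof (rule lipschitz_on_continuous_on)
    show "1-lipschitz_on {0..d x y} \<gamma>"
      using lip by (intro lipschitz_onI) (auto simp: dist_real_def)
  qed
  moreover have "curve_length \<gamma> s t = ennreal (t - s)" if st: "0 \<le> s" "s \<le> t" "t \<le> d x y" for s t
  proof (rule antisym)
    show le: "curve_length \<gamma> s t \<le> ennreal (t - s)"
      using st lip by (intro curve_length_le) auto
    obtain c where c: "curve_length \<gamma> s t = ennreal c" "0 \<le> c"
      using le by (cases "curve_length \<gamma> s t") (auto simp: top_unique)
    have "t - s \<le> c"
    proof (rule field_le_epsilon)
      fix e :: real assume "0 < e"
      obtain n :: nat where n: "0 < n" "(t - s) / real n < \<rho>" "(t - s)\<^sup>2 / r / real n \<le> e"
        using fine_partition_exists[OF \<rho>_pos \<open>0 < e\<close>] .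
      define p where "p i = s + real i * ((t - s) / real n)" for i :: nat
      note p = uniform_partition[OF n(1) st(2), folded p_def]
      define h where "h = (t - s) / real n"
      have h: "0 \<le> h" using st by (simp add: h_def)
      have step: "h - h\<^sup>2 / r \<le> dist (\<gamma> (p i)) (\<gamma> (p (Suc i)))" if "i < n" for i
      proof -
        have "p i \<in> {s..t}" "p (Suc i) \<in> {s..t}" by (rule subsetD[OF p(2)], use that in simp)+
        then have "d (\<gamma> (p i)) (\<gamma> (p (Suc i))) = h" "\<gamma> (p i) \<in> closure D" "\<gamma> (p (Suc i)) \<in> closure D"
          using g'(3,4) st p(5)[of i, folded h_def] h by auto
        then show ?thesis using dist_ge_of_d[of "\<gamma> (p i)" "\<gamma> (p (Suc i))"] n(2) by (simp add: h_def)
      qed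
      have "t - s - (t - s)\<^sup>2 / r / real n = (\<Sum>i<n. h - h\<^sup>2 / r)"
        using sum_quadratic_steps[OF n(1), of "t - s" "- 1" r]
        by (simp only: h_def mult_minus1 minus_divide_left[symmetric] diff_conv_add_uminus)
      also have "\<dots> \<le> (\<Sum>i<n. dist (\<gamma> (p i)) (\<gamma> (p (Suc i))))" by (intro sum_mono step) auto
      also have "\<dots> \<le> c"
        using curve_length_ge[OF p(1,2), of \<gamma>] c by (simp add: ennreal_le_iff)
      finally show "t - s \<le> c + e" using n(3) by simp
    qed
    then show "ennreal (t - s) \<le> curve_length \<gamma> s t" by (simp add: c ennreal_leI)
  qed
  ultimately show "unit_speed_geodesic D x y \<gamma>"
    using g by (auto simp: unit_speed_geodesic_def geod_def)
next
  assume u: "unit_speed_geodesic D x y \<gamma>"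
  then have len: "curve_length \<gamma> s t = ennreal (t - s)" if "0 \<le> s" "s \<le> t" "t \<le> d x y" for s t
    using that by (simp add: unit_speed_geodesic_def)
  have lip: "dist (\<gamma> s) (\<gamma> t) \<le> t - s" if st: "0 \<le> s" "s \<le> t" "t \<le> d x y" for s t
  proof -
    have "ennreal (\<Sum>i<Suc 0. dist (\<gamma> ((\<lambda>i. if i = 0 then s else t) i)) (\<gamma> ((\<lambda>i. if i = 0 then s else t) (Suc i)))) \<le> curve_length \<gamma> s t"
      using st by (intro curve_length_ge mono_onI) auto
    then show ?thesis using len[OF st] st by (simp add: ennreal_le_iff)
  qed
  then have lip: "dist (\<gamma> s) (\<gamma> t) \<le> \<bar>s - t\<bar>" if "s \<in> {0..d x y}" "t \<in> {0..d x y}" for s t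
    using lip[of s t] lip[of t s] that by (cases "s \<le> t") (auto simp: dist_commute)
  have im: "\<gamma> ` {0..d x y} \<subseteq> closure D" "\<gamma> 0 = x" "\<gamma> (d x y) = y" using u by (auto simp: unit_speed_geodesic_def)
  show "geod x y \<gamma>"
  proof (rule geodI[OF x y im(2,3,1)])
    fix s t assume st: "0 \<le> s" "s \<le> t" "t \<le> d x y"
    show "d (\<gamma> s) (\<gamma> t) \<le> t - s"
      using st im(1) lip by (intro d_le_of_lipschitz) auto
  qed
qed

text \<open>
  Splitting off the largest time \<open>b\<close> first reduces to the interval \<open>{0..b}\<close>. For times up to \<open>b\<close> the distance
  to \<open>y\<close> goes through the value at \<open>b\<close>.
\<close>

lemma finite_short_map:
  assumes "finite S" "S \<subseteq> {0..l}" "x \<in> closure D" "y \<in> closure D" "d x y \<le> l"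
  shows "\<exists>g. g 0 = x \<and> g l = y \<and> g ` (S \<union> {0, l}) \<subseteq> closure D \<and>
    (\<forall>s\<in>S \<union> {0, l}. \<forall>t\<in>S \<union> {0, l}. d (g s) (g t) \<le> \<bar>s - t\<bar>)"
  using assms
proof (induction S arbitrary: l y rule: finite_linorder_max_induct)
  case empty
  have "0 \<le> l" using empty d_nonneg[of x y] by simp
  moreover have "x = y" if "l = 0" using empty d_nonneg[of x y] d_eq_0_iff[of x y] that by auto
  ultimately show ?case
    using empty by (intro exI[of _ "\<lambda>s. if s = 0 then x else y"]) (auto simp: d_self d_commute)
next
  case (insert b A)
  have b: "0 \<le> b" "b \<le> l" using insert.prems by auto
  obtain z where z: "z \<in> closure D" "d x z \<le> b" "d z y \<le> l - b"
  proof (cases "b \<le> d x y")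
    case True
    obtain z where "z \<in> closure D" "d x z \<le> b" "d z y \<le> d x y - b"
      using d_split[OF insert.prems(2,3) b(1) True] .
    then show ?thesis using insert.prems(4) by (intro that[of z]) auto
  next
    case False
    then show ?thesis using that[of y] insert.prems b by (simp add: d_self)
  qed
  have "A \<subseteq> {0..b}"
  proof
    fix a assume "a \<in> A"
    then show "a \<in> {0..b}" using insert.hyps(2) insert.prems(1) by (auto simp: less_imp_le)
  qed
  from insert.IH[OF this insert.prems(2) z(1,2)] obtain g where g: "g 0 = x" "g b = z"
    "g ` (A \<union> {0, b}) \<subseteq> closure D" and "\<forall>s\<in>A \<union> {0, b}. \<forall>t\<in>A \<union> {0, b}. d (g s) (g t) \<le> \<bar>s - t\<bar>"
    by (elim exE conjE) (rule that)
  then have g4: "d (g s) (g t) \<le> \<bar>s - t\<bar>" if "s \<in> A \<union> {0, b}" "t \<in> A \<union> {0, b}" for s t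
    using that by (simp only: Ball_def)
  define f where "f = g(l := y)"
  have yl: "g l = y" if "l \<in> A \<union> {0, b}"
  proof -
    have "l = b" using that b insert.hyps insert.prems by force
    then have "z = y" using z d_nonneg[of z y] d_eq_0_iff[of z y] insert.prems by simp
    then show ?thesis using g(2) \<open>l = b\<close> by simp
  qed
  have f_old: "f s = g s" if "s \<in> A \<union> {0, b}" for s using yl that by (auto simp: f_def)
  have f_l: "f l = y" by (simp add: f_def)
  have le_l: "d (f s) (f l) \<le> l - s" if s: "s \<in> A \<union> {0, b}" for s
  proof -
    have "s \<le> b" using s insert.hyps b by auto
    moreover have "g s \<in> closure D" using g(3) s by auto
    ultimately show ?thesis
      using g4[OF s, of b] g(2) z d_triangle[of "g s" z y] insert.prems f_old[OF s] f_l by auto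
  qed
  have f_cl: "f s \<in> closure D" if "s \<in> insert b A \<union> {0, l}" for s
    using that g(3) f_old f_l insert.prems by (cases "s = l") auto
  have "d (f s) (f t) \<le> \<bar>s - t\<bar>" if st: "s \<in> insert b A \<union> {0, l}" "t \<in> insert b A \<union> {0, l}" for s t
  proof -
    have up: "u \<le> l" if "u \<in> insert b A \<union> {0, l}" for u using that insert.prems b by auto
    consider "s = l" "t = l" | "s = l" "t \<in> A \<union> {0, b}" | "t = l" "s \<in> A \<union> {0, b}"
      | "s \<in> A \<union> {0, b}" "t \<in> A \<union> {0, b}" using st by auto
    then show ?thesis
    proof cases
      case 1 then show ?thesis using f_l insert.prems by (simp add: d_self)
    next
      case 2 then show ?thesis using le_l[of t] d_commute[OF f_cl[OF st(1)] f_cl[OF st(2)]] up[OF st(2)] by simp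
    next
      case 3 then show ?thesis using le_l[of s] up[OF st(1)] by simp
    next
      case 4 then show ?thesis using g4 f_old by simp
    qed
  qed
  moreover have "f 0 = x" using f_old[of 0] g(1) by simp
  ultimately show ?case using f_l f_cl by (intro exI[of _ f]) (auto simp: image_subset_iff)
qed

text \<open>
  By Tychonoff's theorem the maps into the compact closure are compact for pointwise convergence. Being
  short is a family of closed conditions, one for each pair of times, and finitely many of them can be
  satisfied at once. A short map on the interval of length \<open>d x y\<close> is a geodesic.
\<close>

lemma geod_exists:
  assumes x: "x \<in> closure D" and y: "y \<in> closure D"
  obtains \<gamma> where "geod x y \<gamma>"
proof -
  define l where "l = d x y"
  have l: "0 \<le> l" using d_nonneg x y by (simp add: l_def)
  define P :: "(real \<Rightarrow> 'a) set" where "P = {g. \<forall>s. g s \<in> closure D}"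
  have P: "P = PiE UNIV (\<lambda>_. closure D)" by (auto simp: P_def)
  have "compactin (product_topology (\<lambda>_. euclidean) UNIV) P"
    unfolding P compactin_PiE using compact_closure by simp
  then have cP: "compact P" by (simp add: euclidean_product_topology)
  define K where "K c = {(a, b). a \<in> closure D \<and> b \<in> closure D \<and> d a b \<le> c}" for c
  have K: "closed (K c)" for c
  proof -
    have "closed ((closure D \<times> closure D) \<inter> (\<lambda>(a, b). d a b) -` {..c})"
      by (intro continuous_closed_preimage continuous_on_d closed_Times) auto
    also have "(closure D \<times> closure D) \<inter> (\<lambda>(a, b). d a b) -` {..c} = K c" by (auto simp: K_def)
    finally show ?thesis .
  qed
  define T where "T = (\<lambda>(s, t). {g. g 0 = x \<and> g l = y \<and> (g s, g t) \<in> K \<bar>s - t\<bar>})"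
  have ev: "continuous_on UNIV (\<lambda>g :: real \<Rightarrow> 'a. (g s, g t))" for s t
    by (intro continuous_on_Pair continuous_on_product_coordinates)
  have T_closed: "closed (T z)" for z
  proof -
    obtain s t where z: "z = (s, t)" by fastforce
    have "T z = (\<lambda>g. (g 0, g l)) -` {(x, y)} \<inter> (\<lambda>g. (g s, g t)) -` K \<bar>s - t\<bar>"
      by (auto simp: T_def z)
    moreover have "closed ((\<lambda>g :: real \<Rightarrow> 'a. (g 0, g l)) -` {(x, y)})" by (rule closed_vimage[OF _ ev]) simp
    moreover have "closed ((\<lambda>g :: real \<Rightarrow> 'a. (g s, g t)) -` K \<bar>s - t\<bar>)" by (rule closed_vimage[OF K ev])
    ultimately show ?thesis by (simp only: closed_Int)
  qed
  have T_finite: "P \<inter> \<Inter> (T ` Q) \<noteq> {}" if Q: "finite Q" "Q \<subseteq> {0..l} \<times> {0..l}" for Q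
  proof -
    define S where "S = fst ` Q \<union> snd ` Q"
    have S: "finite S" "S \<subseteq> {0..l}" using Q by (auto simp: S_def)
    have "d x y \<le> l" by (simp add: l_def)
    from finite_short_map[OF S x y this] obtain g where g: "g 0 = x" "g l = y" "g ` (S \<union> {0, l}) \<subseteq> closure D"
      "\<forall>s\<in>S \<union> {0, l}. \<forall>t\<in>S \<union> {0, l}. d (g s) (g t) \<le> \<bar>s - t\<bar>"
      by (elim exE conjE) (rule that)
    define f where "f s = (if s \<in> S \<union> {0, l} then g s else x)" for s
    have "f \<in> P" using g(3) x by (auto simp: P_def f_def)
    moreover have "f \<in> T z" if "z \<in> Q" for z
    proof -
      obtain s t where z: "z = (s, t)" by fastforce
      have "s \<in> S" "t \<in> S" using that by (force simp: S_def z)+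
      then have "f s = g s" "f t = g t" "g s \<in> closure D" "g t \<in> closure D" "d (g s) (g t) \<le> \<bar>s - t\<bar>"
        using g(3,4) by (simp_all add: f_def image_subset_iff)
      moreover have "f 0 = x" "f l = y" using g(1,2) by (simp_all add: f_def)
      ultimately show ?thesis by (simp add: T_def K_def z)
    qed
    ultimately show ?thesis by auto
  qed
  have "P \<inter> \<Inter> (T ` ({0..l} \<times> {0..l})) \<noteq> {}"
  proof (rule compact_imp_fip[OF cP])
    show "closed C" if "C \<in> T ` ({0..l} \<times> {0..l})" for C using that T_closed by auto
    fix F assume "finite F" "F \<subseteq> T ` ({0..l} \<times> {0..l})"
    then obtain Q where "Q \<subseteq> {0..l} \<times> {0..l}" "finite Q" "F = T ` Q" by (metis finite_subset_image)
    then show "P \<inter> \<Inter> F \<noteq> {}" using T_finite[of Q] by simp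
  qed
  then obtain \<gamma> where \<gamma>: "\<gamma> \<in> P" "\<And>z. z \<in> {0..l} \<times> {0..l} \<Longrightarrow> \<gamma> \<in> T z" by blast
  have "\<gamma> \<in> T (0, 0)" using l by (intro \<gamma>(2)) simp
  then have ends: "\<gamma> 0 = x" "\<gamma> (d x y) = y" by (simp_all add: T_def l_def)
  have "geod x y \<gamma>"
  proof (rule geodI[OF x y ends])
    show "\<gamma> ` {0..d x y} \<subseteq> closure D" using \<gamma>(1) by (auto simp: P_def)
    fix s t assume st: "0 \<le> s" "s \<le> t" "t \<le> d x y"
    then have "\<gamma> \<in> T (s, t)" by (intro \<gamma>(2)) (simp add: l_def)
    then show "d (\<gamma> s) (\<gamma> t) \<le> t - s" using st by (simp add: T_def K_def)
  qed
  then show ?thesis by (rule that)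
qed


definition velocity_const :: real where "velocity_const = 4 * sqrt (2 / r)"

text \<open>
  A short piece of a geodesic has a chord of length at least \<open>h - h\<^sup>2 / r\<close>, so it deviates from the
  straight motion along its chord by \<open>O(h * sqrt h)\<close>: this is the identity for \<open>norm (a - c *\<^sub>R b)\<close> below, a
  form of Stewart's theorem. So the difference quotients are Cauchy at zero. The rate depends on \<open>r\<close>
  only, which later makes the direction continuous in the end points.
\<close>

lemma geod_initial_velocity:
  assumes x: "x \<in> closure D" and y: "y \<in> closure D" and "x \<noteq> y" and g: "geod x y \<gamma>"
  obtains \<nu> where "norm \<nu> = 1" "(\<gamma> has_vector_derivative \<nu>) (at 0 within {0..d x y})"
    "\<And>h. 0 \<le> h \<Longrightarrow> h \<le> d x y \<Longrightarrow> h \<le> \<rho> / 2 \<Longrightarrow> norm (\<gamma> h - x - h *\<^sub>R \<nu>) \<le> velocity_const * h * sqrt h"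
proof -
  note g' = geodD[OF g]
  define L where "L = min (d x y) (\<rho> / 2)"
  have dxy: "0 < d x y" using d_nonneg[OF x y] d_eq_0_iff[OF x y] \<open>x \<noteq> y\<close> by linarith
  have L: "0 < L" "L \<le> d x y" "L < \<rho>" using dxy \<rho>_pos by (auto simp: L_def)
  define q where "q h = (1 / h) *\<^sub>R (\<gamma> h - x)" for h
  have up: "norm (\<gamma> s - \<gamma> t) \<le> \<bar>s - t\<bar>" if "0 \<le> s" "s \<le> L" "0 \<le> t" "t \<le> L" for s t
    using geod_dist_le[OF g, of s t] that L by (simp add: dist_norm)
  have low: "h - h\<^sup>2 / r \<le> norm (\<gamma> h - x)" if "0 \<le> h" "h \<le> L" for h
    using dist_ge_of_d[of x "\<gamma> h"] g'(1,3) g'(4)[of 0 h] that L x by (simp add: dist_norm norm_minus_commute)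
  have step: "norm (q h - q k) \<le> sqrt (2 / r) * sqrt h" if hk: "0 < k" "k \<le> h" "h \<le> 2 * k" "h \<le> L" for h k
  proof -
    define a b c where "a = \<gamma> k - x" and "b = \<gamma> h - x" and "c = k / h"
    have c: "0 < c" "c \<le> 1" "1 - c \<le> c" "k = c * h" using hk by (auto simp: c_def field_simps)
    have "norm a \<le> k" using up[of k 0] hk g'(1) by (simp add: a_def)
    then have a: "(norm a)\<^sup>2 \<le> (c * h)\<^sup>2" using c(4) by (intro power_mono) auto
    have "norm (b - a) \<le> h - k" using up[of h k] hk by (simp add: a_def b_def)
    then have ba: "(norm (b - a))\<^sup>2 \<le> ((1 - c) * h)\<^sup>2" using c(4) by (intro power_mono) (auto simp: algebra_simps)
    have "h \<le> r" using hk L \<rho>_le_r by simp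
    then have "h * h \<le> h * r" using hk by (intro mult_left_mono) auto
    then have "0 \<le> h - h\<^sup>2 / r" using r_pos by (simp add: field_simps power2_eq_square)
    then have "(h - h\<^sup>2 / r)\<^sup>2 \<le> (norm b)\<^sup>2" using low[of h] hk by (intro power_mono) (auto simp: b_def)
    moreover have "(h - h\<^sup>2 / r)\<^sup>2 = h\<^sup>2 - 2 * h ^ 3 / r + (h\<^sup>2 / r)\<^sup>2"
      unfolding power2_diff by (simp add: power3_eq_cube power2_eq_square mult.assoc)
    ultimately have b: "h\<^sup>2 - 2 * h ^ 3 / r \<le> (norm b)\<^sup>2"
      using zero_le_power2[of "h\<^sup>2 / r"] by linarith
    have "(norm (a - c *\<^sub>R b))\<^sup>2 = (1 - c) * (norm a)\<^sup>2 + c * (norm (b - a))\<^sup>2 - c * (1 - c) * (norm b)\<^sup>2"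
      by (simp add: power2_norm_eq_inner inner_diff_left inner_diff_right inner_commute algebra_simps)
    also have "\<dots> \<le> (1 - c) * (c * h)\<^sup>2 + c * ((1 - c) * h)\<^sup>2 - c * (1 - c) * (h\<^sup>2 - 2 * h ^ 3 / r)"
      using c a b ba by (intro add_mono diff_mono mult_left_mono) auto
    also have "\<dots> = c * (1 - c) * (2 * h ^ 3 / r)" by (simp add: power2_eq_square algebra_simps)
    also have "\<dots> \<le> c * c * (2 * h ^ 3 / r)"
      using c hk r_pos by (intro mult_right_mono mult_left_mono) auto
    also have "\<dots> = (c * h)\<^sup>2 * (2 / r * h)" by (simp add: power2_eq_square power3_eq_cube)
    finally have "(norm (a - c *\<^sub>R b))\<^sup>2 \<le> (c * h)\<^sup>2 * (2 / r * h)" .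
    then have "norm (a - c *\<^sub>R b) \<le> sqrt ((c * h)\<^sup>2 * (2 / r * h))" by (rule real_le_rsqrt)
    also have "\<dots> = (c * h) * (sqrt (2 / r) * sqrt h)"
      using c hk by (simp only: real_sqrt_mult real_sqrt_abs)
    finally have "norm (a - c *\<^sub>R b) \<le> (c * h) * (sqrt (2 / r) * sqrt h)" .
    moreover have "q h - q k = (- (1 / k)) *\<^sub>R (a - c *\<^sub>R b)"
    proof -
      have "1 / k * c = 1 / h" using hk by (simp add: c_def)
      then have eq: "(1 / k) *\<^sub>R (c *\<^sub>R b) = (1 / h) *\<^sub>R b" by (simp only: scaleR_scaleR)
      show ?thesis
        unfolding q_def a_def[symmetric] b_def[symmetric] scaleR_diff_right scaleR_minus_left eq
        by simp
    qed
    then have "norm (q h - q k) = norm (a - c *\<^sub>R b) / k" using hk by simp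
    ultimately show ?thesis using hk c(4) by (simp add: pos_divide_le_eq mult.commute)
  qed
  have "0 \<le> sqrt (2 / r)" using r_pos by simp
  then have "\<exists>\<nu>. \<forall>h. 0 < h \<and> h \<le> L \<longrightarrow> norm (q h - \<nu>) \<le> 4 * sqrt (2 / r) * sqrt h"
    by (rule dyadic_cauchy_at_zero[OF L(1)]) (rule step)
  then obtain \<nu> where \<nu>: "\<And>h. 0 < h \<Longrightarrow> h \<le> L \<Longrightarrow> norm (q h - \<nu>) \<le> 4 * sqrt (2 / r) * sqrt h"
    by blast
  have bound: "norm (\<gamma> h - x - h *\<^sub>R \<nu>) \<le> velocity_const * h * sqrt h" if h: "0 \<le> h" "h \<le> L" for h
  proof (cases "h = 0")
    case False
    have "\<gamma> h - x - h *\<^sub>R \<nu> = h *\<^sub>R (q h - \<nu>)" using False by (simp add: q_def algebra_simps)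
    then have "norm (\<gamma> h - x - h *\<^sub>R \<nu>) = h * norm (q h - \<nu>)" using h by simp
    also have "\<dots> \<le> h * (velocity_const * sqrt h)"
      using \<nu>[of h] h False by (intro mult_left_mono) (auto simp: velocity_const_def)
    finally show ?thesis by (simp add: mult_ac)
  qed (use g'(1) in simp)
  have "\<bar>norm \<nu> - 1\<bar> \<le> 0"
  proof (rule tendsto_lowerbound[where F = "at_right 0"])
    show "((\<lambda>h. h / r + velocity_const * sqrt h) \<longlongrightarrow> 0) (at_right 0)"
      using r_pos by (auto intro!: tendsto_eq_intros)
    show "\<forall>\<^sub>F h in at_right 0. \<bar>norm \<nu> - 1\<bar> \<le> h / r + velocity_const * sqrt h"
      unfolding eventually_at_right_field
    proof (intro exI[of _ L] conjI allI impI L(1))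
      fix h assume h: "0 < h" "h < L"
      have q: "norm (\<gamma> h - x) = h * norm (q h)" using h by (simp add: q_def)
      have "h * (1 - h / r) \<le> h * norm (q h)" "h * norm (q h) \<le> h * 1"
        using low[of h] up[of h 0] h g'(1) unfolding q[symmetric]
        by (simp_all add: right_diff_distrib power2_eq_square)
      then have "1 - h / r \<le> norm (q h)" "norm (q h) \<le> 1"
        using h by (simp_all only: mult_le_cancel_left_pos)
      moreover have "\<bar>norm (q h) - norm \<nu>\<bar> \<le> velocity_const * sqrt h"
        using norm_triangle_ineq3[of "q h" \<nu>] \<nu>[of h] h by (simp add: velocity_const_def)
      ultimately show "\<bar>norm \<nu> - 1\<bar> \<le> h / r + velocity_const * sqrt h" by linarith
    qed
  qed simp
  moreover have "(\<gamma> has_vector_derivative \<nu>) (at 0 within {0..d x y})"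
    by (rule has_vector_derivativeI_power[OF L(1)]) (use bound g'(1) in auto)
  ultimately show ?thesis using that[of \<nu>] bound by (auto simp: L_def)
qed

end

section \<open>CAT(0) comparison and the direction of pursuit\<close>

lemma comparison_triangle_exists:
  assumes "0 < l" "0 \<le> p" "l \<le> p + q" "p \<le> l + q" "q \<le> l + p"
  obtains a b c :: "real ^ 2" where "dist a b = l" "dist a c = p" "dist b c = q"
proof -
  define u where "u = (l\<^sup>2 + p\<^sup>2 - q\<^sup>2) / (2 * l)"
  define v where "v = sqrt (p\<^sup>2 - u\<^sup>2)"
  have "0 \<le> q" using assms by simp
  have "(l - p)\<^sup>2 \<le> q\<^sup>2" using assms by (intro abs_le_square_iff[THEN iffD1]) auto
  moreover have "q\<^sup>2 \<le> (l + p)\<^sup>2" using assms \<open>0 \<le> q\<close> by (intro power_mono) auto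
  ultimately have "\<bar>u\<bar> \<le> p"
    using assms(1) by (auto simp: u_def abs_le_iff pos_divide_le_eq pos_le_divide_eq power2_eq_square algebra_simps)
  then have "u\<^sup>2 \<le> p\<^sup>2" using assms(2) by (simp add: abs_le_square_iff[symmetric])
  then have v: "v\<^sup>2 = p\<^sup>2 - u\<^sup>2" by (simp add: v_def)
  have ul: "2 * l * u = l\<^sup>2 + p\<^sup>2 - q\<^sup>2" using assms(1) by (simp add: u_def)
  have norm2: "norm w = sqrt ((w $ 1)\<^sup>2 + (w $ 2)\<^sup>2)" for w :: "real ^ 2"
    by (simp add: norm_eq_sqrt_inner inner_vec_def sum_2 power2_eq_square)
  show ?thesis
  proof (rule that[of "vector [0, 0]" "vector [l, 0]" "vector [u, v]"])
    show "dist (vector [0, 0]) (vector [l, 0] :: real ^ 2) = l"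
      using assms(1) by (simp add: dist_norm norm2)
    show "dist (vector [0, 0]) (vector [u, v] :: real ^ 2) = p"
      using assms(2) v by (simp add: dist_norm norm2)
    have "(l - u)\<^sup>2 + v\<^sup>2 = q\<^sup>2" using v ul by (simp add: power2_eq_square algebra_simps)
    then show "dist (vector [l, 0]) (vector [u, v] :: real ^ 2) = q"
      using \<open>0 \<le> q\<close> by (simp add: dist_norm norm2)
  qed
qed

lemma stewart:
  fixes a b c :: "'a::real_inner"
  assumes "a \<noteq> b"
  shows "dist a b * (dist (a + s *\<^sub>R sgn (b - a)) c)\<^sup>2 =
    (dist a b - s) * (dist a c)\<^sup>2 + s * (dist b c)\<^sup>2 - s * (dist a b - s) * dist a b"
proof -
  define l where "l = dist a b"
  define v w where "v = sgn (b - a)" and "w = c - a"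
  have l: "l \<noteq> 0" using assms by (simp add: l_def)
  have b: "b - a = l *\<^sub>R v" using assms by (simp add: v_def l_def dist_norm norm_minus_commute sgn_div_norm)
  have v: "inner v v = 1" using assms by (simp add: v_def norm_sgn flip: power2_norm_eq_inner)
  have expand: "(norm (t *\<^sub>R v - w))\<^sup>2 = t\<^sup>2 - 2 * t * inner v w + inner w w" for t
    unfolding power2_norm_eq_inner using v
    by (simp add: inner_diff_left inner_diff_right inner_commute power2_eq_square)
  have 1: "(dist (a + s *\<^sub>R v) c)\<^sup>2 = s\<^sup>2 - 2 * s * inner v w + inner w w"
  proof -
    have "a + s *\<^sub>R v - c = s *\<^sub>R v - w" by (simp add: w_def)
    then show ?thesis by (simp only: dist_norm expand)
  qed
  have 2: "(dist a c)\<^sup>2 = inner w w"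
    by (simp add: dist_norm w_def norm_minus_commute[of a] flip: power2_norm_eq_inner)
  have 3: "(dist b c)\<^sup>2 = l\<^sup>2 - 2 * l * inner v w + inner w w"
  proof -
    have "b - c = l *\<^sub>R v - w" using b by (simp add: w_def algebra_simps)
    then show ?thesis by (simp only: dist_norm expand)
  qed
  show ?thesis
    unfolding l_def[symmetric] v_def[symmetric] 1 2 3 by (simp add: power2_eq_square algebra_simps)
qed

locale cat0_domain = sphere_cone_domain +
  assumes cat0: "CAT0_domain D"
begin

text \<open>
  The case in which the second point is the vertex \<open>c\<close>: Stewart's theorem evaluates the distance in the
  comparison triangle.
\<close>

lemma cat0_comparison_D:
  assumes D: "a \<in> D" "b \<in> D" "c \<in> D" and g: "geod a b \<gamma>" and s: "0 \<le> s" "s \<le> d a b"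
  shows "d a b * (d c (\<gamma> s))\<^sup>2 \<le> (d a b - s) * (d c a)\<^sup>2 + s * (d c b)\<^sup>2 - s * (d a b - s) * d a b"
proof (cases "d a b = 0")
  case False
  have cl: "a \<in> closure D" "b \<in> closure D" "c \<in> closure D" using D D_in_closure by auto
  have l: "0 < d a b" using False d_nonneg[OF cl(1,2)] by simp
  obtain \<gamma>ac where \<gamma>ac: "geod a c \<gamma>ac" using geod_exists[OF cl(1,3)] .
  obtain \<gamma>bc where \<gamma>bc: "geod b c \<gamma>bc" using geod_exists[OF cl(2,3)] .
  obtain a' b' c' :: "real ^ 2" where tri: "dist a' b' = d a b" "dist a' c' = d a c" "dist b' c' = d b c"
    using comparison_triangle_exists[of "d a b" "d a c" "d b c"] l d_nonneg d_triangle cl d_commute by metis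
  have geos: "unit_speed_geodesic D a b \<gamma>" "unit_speed_geodesic D a c \<gamma>ac" "unit_speed_geodesic D b c \<gamma>bc"
    using g \<gamma>ac \<gamma>bc cl by (simp_all add: unit_speed_geodesic_iff_geod)
  have ac: "d a c \<in> {0..d a c}" "s \<in> {0..d a b}" using d_nonneg cl s by auto
  have "d (\<gamma> s) (\<gamma>ac (d a c)) \<le> dist (a' + s *\<^sub>R sgn (b' - a')) (a' + d a c *\<^sub>R sgn (c' - a'))"
    using cat0[unfolded CAT0_domain_def, rule_format, OF D, of \<gamma> \<gamma>ac \<gamma>bc a' b' c' s "d a c"] geos tri ac by blast
  moreover have "a' + d a c *\<^sub>R sgn (c' - a') = c'"
    by (cases "c' = a'") (simp_all add: sgn_div_norm tri(2)[symmetric] dist_norm norm_minus_commute)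
  moreover have "\<gamma>ac (d a c) = c" using geodD[OF \<gamma>ac] by simp
  moreover have "d (\<gamma> s) c = d c (\<gamma> s)" using d_commute geodD(3)[OF g s] cl by blast
  ultimately have le: "d c (\<gamma> s) \<le> dist (a' + s *\<^sub>R sgn (b' - a')) c'" by simp
  have "d a b * (d c (\<gamma> s))\<^sup>2 \<le> d a b * (dist (a' + s *\<^sub>R sgn (b' - a')) c')\<^sup>2"
    using l le d_nonneg[OF cl(3) geodD(3)[OF g s]] by (intro mult_left_mono power_mono) auto
  also have "\<dots> = (d a b - s) * (d a c)\<^sup>2 + s * (d b c)\<^sup>2 - s * (d a b - s) * d a b"
    using stewart[of a' b' s c'] tri l by (metis dist_self less_irrefl)
  finally show ?thesis using d_commute[OF cl(1,3)] d_commute[OF cl(2,3)] by simp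
qed (use s in auto)

text \<open>
  On the closure the inequality is first obtained for some point \<open>z\<close>, a limit of points on geodesics of
  \<open>D\<close>; it is crucial that one \<open>z\<close> serves all \<open>c\<close>.
\<close>

lemma comparison_point_exists:
  assumes a: "a \<in> closure D" and b: "b \<in> closure D" and s: "0 \<le> s" "s \<le> d a b"
  obtains z where "z \<in> closure D" "\<And>c. c \<in> closure D \<Longrightarrow>
    d a b * (d c z)\<^sup>2 \<le> (d a b - s) * (d c a)\<^sup>2 + s * (d c b)\<^sup>2 - s * (d a b - s) * d a b"
proof -
  obtain X Y where X: "\<And>n. X n \<in> D" "\<And>n. X n \<in> closure D" "X \<longlonglongrightarrow> a"
    and Y: "\<And>n. Y n \<in> D" "\<And>n. Y n \<in> closure D" "Y \<longlonglongrightarrow> b"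
    using sequence_in_domain a b by metis
  define l where "l n = d (X n) (Y n)" for n
  define t where "t n = min s (l n)" for n
  have l: "0 \<le> l n" for n using d_nonneg X Y by (simp add: l_def)
  have t: "0 \<le> t n" "t n \<le> l n" for n using l s by (auto simp: t_def)
  have "\<forall>n. \<exists>\<gamma>. geod (X n) (Y n) \<gamma>" using geod_exists X(2) Y(2) by metis
  then obtain \<gamma> where \<gamma>: "\<And>n. geod (X n) (Y n) (\<gamma> n)" by metis
  define Z where "Z n = \<gamma> n (t n)" for n
  have Z: "Z n \<in> closure D" for n using geodD(3)[OF \<gamma>] t by (simp add: Z_def l_def)
  then obtain z f where z: "z \<in> closure D" "strict_mono f" "(Z \<circ> f) \<longlonglongrightarrow> z"
    using compact_closure unfolding compact_def by metis
  have lim_l: "l \<longlonglongrightarrow> d a b" unfolding l_def by (intro LIMSEQ_d X Y)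
  then have "t \<longlonglongrightarrow> min s (d a b)" unfolding t_def by (intro tendsto_intros)
  then have lim_t: "t \<longlonglongrightarrow> s" using s by simp
  note sub = LIMSEQ_subseq_LIMSEQ[OF _ z(2)]
  show ?thesis
  proof (rule that[OF z(1)])
    fix c assume c: "c \<in> closure D"
    obtain C where C: "\<And>n. C n \<in> D" "\<And>n. C n \<in> closure D" "C \<longlonglongrightarrow> c"
      by (rule sequence_in_domain[OF c], rule that) blast+
    have "l (f n) * (d (C (f n)) (Z (f n)))\<^sup>2 \<le> (l (f n) - t (f n)) * (d (C (f n)) (X (f n)))\<^sup>2
        + t (f n) * (d (C (f n)) (Y (f n)))\<^sup>2 - t (f n) * (l (f n) - t (f n)) * l (f n)" for n
      using cat0_comparison_D[OF X(1) Y(1) C(1) \<gamma>] t by (simp add: l_def Z_def)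
    moreover have "(\<lambda>n. l (f n)) \<longlonglongrightarrow> d a b" "(\<lambda>n. t (f n)) \<longlonglongrightarrow> s"
      using sub[OF lim_l] sub[OF lim_t] by (simp_all add: o_def)
    moreover have "(\<lambda>n. d (C (f n)) (X (f n))) \<longlonglongrightarrow> d c a" "(\<lambda>n. d (C (f n)) (Y (f n))) \<longlonglongrightarrow> d c b"
      using sub[OF LIMSEQ_d[OF C(3) X(3) C(2) X(2)]] sub[OF LIMSEQ_d[OF C(3) Y(3) C(2) Y(2)]]
      by (simp_all add: o_def)
    moreover have "(\<lambda>n. d ((C \<circ> f) n) ((Z \<circ> f) n)) \<longlonglongrightarrow> d c z"
      using C(2) Z by (intro LIMSEQ_d z sub[OF C(3)]) auto
    ultimately show "d a b * (d c z)\<^sup>2 \<le> (d a b - s) * (d c a)\<^sup>2 + s * (d c b)\<^sup>2 - s * (d a b - s) * d a b"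
      by (intro LIMSEQ_le[where X = "\<lambda>n. l (f n) * (d (C (f n)) (Z (f n)))\<^sup>2"
            and Y = "\<lambda>n. (l (f n) - t (f n)) * (d (C (f n)) (X (f n)))\<^sup>2
              + t (f n) * (d (C (f n)) (Y (f n)))\<^sup>2 - t (f n) * (l (f n) - t (f n)) * l (f n)"])
         (auto intro!: tendsto_intros simp: o_def)
  qed
qed

text \<open>
  Testing the limit point with \<open>c = \<gamma> s\<close> itself shows that it lies on the given geodesic.
\<close>

lemma cat0_comparison:
  assumes a: "a \<in> closure D" and b: "b \<in> closure D" and c: "c \<in> closure D"
    and g: "geod a b \<gamma>" and s: "0 \<le> s" "s \<le> d a b"
  shows "d a b * (d c (\<gamma> s))\<^sup>2 \<le> (d a b - s) * (d c a)\<^sup>2 + s * (d c b)\<^sup>2 - s * (d a b - s) * d a b"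
proof (cases "d a b = 0")
  case False
  then have l: "0 < d a b" using d_nonneg[OF a b] by simp
  obtain z where z: "z \<in> closure D" "\<And>c. c \<in> closure D \<Longrightarrow>
      d a b * (d c z)\<^sup>2 \<le> (d a b - s) * (d c a)\<^sup>2 + s * (d c b)\<^sup>2 - s * (d a b - s) * d a b"
    using comparison_point_exists[OF a b s] by blast
  note g' = geodD[OF g]
  have \<gamma>s: "\<gamma> s \<in> closure D" using g'(3) s by simp
  have "d (\<gamma> s) a = s" "d (\<gamma> s) b = d a b - s" using g'(4)[of s 0] g'(4)[of s "d a b"] g'(1,2) s by auto
  then have "d a b * (d (\<gamma> s) z)\<^sup>2 \<le> (d a b - s) * s\<^sup>2 + s * (d a b - s)\<^sup>2 - s * (d a b - s) * d a b"
    using z(2)[OF \<gamma>s] by simp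
  also have "\<dots> = 0" by (simp add: power2_eq_square algebra_simps)
  finally have "(d (\<gamma> s) z)\<^sup>2 \<le> 0" using l by (simp add: mult_le_0_iff)
  then have "\<gamma> s = z" using d_eq_0_iff[OF \<gamma>s z(1)] by simp
  then show ?thesis using z(2)[OF c] by simp
qed (use s in auto)

lemma geod_unique:
  assumes a: "a \<in> closure D" and b: "b \<in> closure D" and g: "geod a b \<gamma>" and g2: "geod a b \<gamma>'"
    and s: "0 \<le> s" "s \<le> d a b"
  shows "\<gamma> s = \<gamma>' s"
proof (cases "d a b = 0")
  case True
  then show ?thesis using geodD(1)[OF g] geodD(1)[OF g2] s by simp
next
  case False
  then have l: "0 < d a b" using d_nonneg[OF a b] by simp
  have cl: "\<gamma> s \<in> closure D" "\<gamma>' s \<in> closure D" using geodD(3)[OF g] geodD(3)[OF g2] s by auto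
  have "d (\<gamma>' s) a = s" "d (\<gamma>' s) b = d a b - s"
    using geodD(4)[OF g2, of s 0] geodD(4)[OF g2, of s "d a b"] geodD(1,2)[OF g2] s by auto
  then have "d a b * (d (\<gamma>' s) (\<gamma> s))\<^sup>2 \<le> (d a b - s) * s\<^sup>2 + s * (d a b - s)\<^sup>2 - s * (d a b - s) * d a b"
    using cat0_comparison[OF a b cl(2) g s] by simp
  also have "\<dots> = 0" by (simp add: power2_eq_square algebra_simps)
  finally have "(d (\<gamma>' s) (\<gamma> s))\<^sup>2 \<le> 0" using l by (simp add: mult_le_0_iff)
  then show ?thesis using d_eq_0_iff[OF cl(2,1)] by simp
qed

text \<open>
  The inequality of Bruhat and Tits.
\<close>

lemma midpoint_exists:
  assumes a: "a \<in> closure D" and b: "b \<in> closure D"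
  obtains m where "m \<in> closure D" "\<And>c. c \<in> closure D \<Longrightarrow>
    (d c m)\<^sup>2 \<le> (d c a)\<^sup>2 / 2 + (d c b)\<^sup>2 / 2 - (d a b)\<^sup>2 / 4"
proof (cases "a = b")
  case True
  then show ?thesis using that[OF a] d_self a by simp
next
  case False
  then have l: "0 < d a b" using d_nonneg[OF a b] d_eq_0_iff[OF a b] by simp
  obtain \<gamma> where g: "geod a b \<gamma>" using geod_exists[OF a b] .
  show ?thesis
  proof (rule that[of "\<gamma> (d a b / 2)"])
    show "\<gamma> (d a b / 2) \<in> closure D" using geodD(3)[OF g] l by simp
    fix c assume c: "c \<in> closure D"
    have "d a b * (d c (\<gamma> (d a b / 2)))\<^sup>2 \<le> d a b * ((d c a)\<^sup>2 / 2 + (d c b)\<^sup>2 / 2 - (d a b)\<^sup>2 / 4)"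
      using cat0_comparison[OF a b c g, of "d a b / 2"] l by (simp add: power2_eq_square algebra_simps)
    then show "(d c (\<gamma> (d a b / 2)))\<^sup>2 \<le> (d c a)\<^sup>2 / 2 + (d c b)\<^sup>2 / 2 - (d a b)\<^sup>2 / 4"
      using l by (simp only: mult_le_cancel_left_pos)
  qed
qed

abbreviation direction :: "'a \<Rightarrow> 'a \<Rightarrow> 'a" where "direction \<equiv> geodesic_direction D"

text \<open>
  Geodesics are unique and have an initial velocity, so the definite description is meaningful.
\<close>

lemma geodesic_direction_expansion:
  assumes x: "x \<in> closure D" and y: "y \<in> closure D" and "x \<noteq> y" and g: "geod x y \<gamma>"
  shows "norm (direction x y) = 1"
    and "0 \<le> h \<Longrightarrow> h \<le> d x y \<Longrightarrow> h \<le> \<rho> / 2 \<Longrightarrow>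
      norm (\<gamma> h - x - h *\<^sub>R direction x y) \<le> velocity_const * h * sqrt h"
proof -
  have l: "0 < d x y" using d_nonneg[OF x y] d_eq_0_iff[OF x y] \<open>x \<noteq> y\<close> by simp
  obtain \<nu> where \<nu>: "norm \<nu> = 1" "(\<gamma> has_vector_derivative \<nu>) (at 0 within {0..d x y})"
    "\<And>h. 0 \<le> h \<Longrightarrow> h \<le> d x y \<Longrightarrow> h \<le> \<rho> / 2 \<Longrightarrow> norm (\<gamma> h - x - h *\<^sub>R \<nu>) \<le> velocity_const * h * sqrt h"
    by (rule geod_initial_velocity[OF x y \<open>x \<noteq> y\<close> g], rule that) blast+
  have "direction x y = \<nu>"
    unfolding geodesic_direction_def
  proof (rule the_equality)
    show "norm \<nu> = 1 \<and> (\<exists>\<gamma>. unit_speed_geodesic D x y \<gamma> \<and> (\<gamma> has_vector_derivative \<nu>) (at 0 within {0..d x y}))"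
      using \<nu>(1,2) g x y by (auto simp: unit_speed_geodesic_iff_geod)
  next
    fix \<mu> assume "norm \<mu> = 1 \<and> (\<exists>\<gamma>. unit_speed_geodesic D x y \<gamma> \<and> (\<gamma> has_vector_derivative \<mu>) (at 0 within {0..d x y}))"
    then obtain \<gamma>' where g2: "geod x y \<gamma>'" and \<mu>: "(\<gamma>' has_vector_derivative \<mu>) (at 0 within {0..d x y})"
      using x y by (auto simp: unit_speed_geodesic_iff_geod)
    have "(\<gamma> has_vector_derivative \<mu>) (at 0 within {0..d x y})"
    proof (rule has_vector_derivative_transform[OF _ _ \<mu>])
      show "0 \<in> {0..d x y}" using l by simp
      show "\<And>s. s \<in> {0..d x y} \<Longrightarrow> \<gamma> s = \<gamma>' s" using geod_unique[OF x y g g2] by simp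
    qed
    then show "\<mu> = \<nu>"
      using \<nu>(2) l by (intro vector_derivative_unique_within[of 0 "{0..d x y}" \<gamma>]) (auto simp: at_within_Icc_at_right)
  qed
  then show "norm (direction x y) = 1"
    and "0 \<le> h \<Longrightarrow> h \<le> d x y \<Longrightarrow> h \<le> \<rho> / 2 \<Longrightarrow>
      norm (\<gamma> h - x - h *\<^sub>R direction x y) \<le> velocity_const * h * sqrt h"
    using \<nu>(1,3) by auto
qed

lemma geodesic_points_close:
  assumes cl: "x \<in> closure D" "y \<in> closure D" "x' \<in> closure D" "y' \<in> closure D"
    and g: "geod x y \<gamma>" and g2: "geod x' y' \<gamma>'" and h: "0 \<le> h" "h \<le> d x y" "h \<le> d x' y'" "x \<noteq> y"
  defines "\<eta> \<equiv> 2 * (d x x' + d y y')"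
  shows "(d (\<gamma>' h) (\<gamma> h))\<^sup>2 \<le> 4 * h * \<eta> + \<eta>\<^sup>2"
proof -
  define l where "l = d x y"
  have l: "0 < l" using d_nonneg[OF cl(1,2)] d_eq_0_iff[OF cl(1,2)] h(4) by (simp add: l_def)
  have dd: "0 \<le> d x x'" "0 \<le> d y y'" using d_nonneg cl by auto
  have \<gamma>h: "\<gamma>' h \<in> closure D" using geodD(3)[OF g2] h by simp
  have "d (\<gamma>' h) x' = h" "d (\<gamma>' h) y' = d x' y' - h"
    using geodD(4)[OF g2, of h 0] geodD(4)[OF g2, of h "d x' y'"] geodD(1,2)[OF g2] h by auto
  moreover have "d (\<gamma>' h) x \<le> d (\<gamma>' h) x' + d x' x" "d (\<gamma>' h) y \<le> d (\<gamma>' h) y' + d y' y"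
    using d_triangle \<gamma>h cl by blast+
  moreover have "d x' y' \<le> d x' x + d x y'" "d x y' \<le> d x y + d y y'" using d_triangle cl by blast+
  moreover have "d x' x = d x x'" "d y' y = d y y'" using d_commute cl by blast+
  ultimately have "d (\<gamma>' h) x \<le> h + \<eta>" "d (\<gamma>' h) y \<le> l - h + \<eta>" using dd by (auto simp: \<eta>_def l_def)
  then have sq: "(d (\<gamma>' h) x)\<^sup>2 \<le> (h + \<eta>)\<^sup>2" "(d (\<gamma>' h) y)\<^sup>2 \<le> (l - h + \<eta>)\<^sup>2"
    using d_nonneg \<gamma>h cl by (auto intro: power_mono)
  have "l * (d (\<gamma>' h) (\<gamma> h))\<^sup>2 \<le> (l - h) * (d (\<gamma>' h) x)\<^sup>2 + h * (d (\<gamma>' h) y)\<^sup>2 - h * (l - h) * l"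
    using cat0_comparison[OF cl(1,2) \<gamma>h g h(1,2)] by (simp add: l_def)
  also have "\<dots> \<le> (l - h) * (h + \<eta>)\<^sup>2 + h * (l - h + \<eta>)\<^sup>2 - h * (l - h) * l"
    using sq h by (intro diff_right_mono add_mono mult_left_mono) (auto simp: l_def)
  also have "\<dots> = l * (4 * h * \<eta> + \<eta>\<^sup>2) - 4 * (h * h * \<eta>)"
    by (simp add: power2_eq_square algebra_simps)
  also have "\<dots> \<le> l * (4 * h * \<eta> + \<eta>\<^sup>2)" using dd h by (simp add: \<eta>_def)
  finally show ?thesis using l by (simp only: mult_le_cancel_left_pos)
qed

text \<open>
  At a fixed small time \<open>h\<close> the geodesics depend continuously on their ends, and their difference
  quotients at \<open>h\<close> approximate the directions uniformly.
\<close>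

lemma tendsto_geodesic_direction:
  assumes f: "(f \<longlongrightarrow> x) F" and g: "(g \<longlongrightarrow> y) F"
    and ev: "\<forall>\<^sub>F t in F. f t \<in> closure D" "\<forall>\<^sub>F t in F. g t \<in> closure D"
    and x: "x \<in> closure D" and y: "y \<in> closure D" and "x \<noteq> y"
  shows "((\<lambda>t. direction (f t) (g t)) \<longlongrightarrow> direction x y) F"
proof (rule tendstoI)
  fix e :: real assume e: "0 < e"
  have l: "0 < d x y" using d_nonneg[OF x y] d_eq_0_iff[OF x y] \<open>x \<noteq> y\<close> by simp
  have "((\<lambda>h. 2 * velocity_const * sqrt h) \<longlongrightarrow> 2 * velocity_const * sqrt 0) (at_right 0)" by (intro tendsto_intros)
  then have "\<forall>\<^sub>F h in at_right 0. 2 * velocity_const * sqrt h < e / 2"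
    using e by (intro order_tendstoD(2)) auto
  moreover have "\<forall>\<^sub>F h in at_right 0. h \<in> {0<..<min (\<rho> / 2) (d x y)}"
    using l \<rho>_pos by (intro eventually_at_right_real) auto
  ultimately have "\<forall>\<^sub>F h in at_right 0. 2 * velocity_const * sqrt h < e / 2 \<and> h \<in> {0<..<min (\<rho> / 2) (d x y)}"
    by (rule eventually_conj)
  then obtain h where h: "2 * velocity_const * sqrt h < e / 2" "0 < h" "h < \<rho> / 2" "h < d x y"
    using eventually_happens[of _ "at_right (0::real)"] by auto
  obtain \<gamma> where \<gamma>: "geod x y \<gamma>" using geod_exists[OF x y] .
  define \<eta> where "\<eta> t = 2 * (d x (f t) + d y (g t))" for t
  have fg: "((\<lambda>t. d (f t) (g t)) \<longlongrightarrow> d x y) F" by (rule tendsto_d[OF f g ev x y])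
  have "((\<lambda>t. d x (f t)) \<longlongrightarrow> d x x) F" "((\<lambda>t. d y (g t)) \<longlongrightarrow> d y y) F"
    using x y by (auto intro!: tendsto_d f g ev)
  then have "(\<eta> \<longlongrightarrow> 2 * (d x x + d y y)) F" unfolding \<eta>_def by (intro tendsto_intros)
  then have \<eta>: "(\<eta> \<longlongrightarrow> 0) F" using d_self x y by simp
  have "((\<lambda>t. (sqrt (4 * h * \<eta> t + (\<eta> t)\<^sup>2) + dist (f t) x) / h) \<longlongrightarrow> (sqrt (4 * h * 0 + 0\<^sup>2) + dist x x) / h) F"
    using h(2) by (intro tendsto_intros \<eta> f) auto
  then have "\<forall>\<^sub>F t in F. (sqrt (4 * h * \<eta> t + (\<eta> t)\<^sup>2) + dist (f t) x) / h < e / 2"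
    using e by (intro order_tendstoD(2)) auto
  moreover have "\<forall>\<^sub>F t in F. h < d (f t) (g t)" using order_tendstoD(1)[OF fg h(4)] .
  ultimately show "\<forall>\<^sub>F t in F. dist (direction (f t) (g t)) (direction x y) < e"
    using ev
  proof eventually_elim
    case (elim t)
    have ne: "f t \<noteq> g t" using elim h(2) d_self by auto
    obtain \<gamma>' where \<gamma>': "geod (f t) (g t) \<gamma>'" using geod_exists elim by blast
    have 1: "norm (\<gamma> h - x - h *\<^sub>R direction x y) \<le> velocity_const * h * sqrt h"
      using h by (intro geodesic_direction_expansion[OF x y \<open>x \<noteq> y\<close> \<gamma>]) auto
    have 2: "norm (\<gamma>' h - f t - h *\<^sub>R direction (f t) (g t)) \<le> velocity_const * h * sqrt h"
      using h elim by (intro geodesic_direction_expansion[OF _ _ ne \<gamma>']) auto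
    have "(d (\<gamma>' h) (\<gamma> h))\<^sup>2 \<le> 4 * h * \<eta> t + (\<eta> t)\<^sup>2"
      unfolding \<eta>_def using h elim \<open>x \<noteq> y\<close> by (intro geodesic_points_close x y \<gamma> \<gamma>') auto
    then have "d (\<gamma>' h) (\<gamma> h) \<le> sqrt (4 * h * \<eta> t + (\<eta> t)\<^sup>2)" by (rule real_le_rsqrt)
    moreover have "dist (\<gamma>' h) (\<gamma> h) \<le> d (\<gamma>' h) (\<gamma> h)"
      using geodD(3)[OF \<gamma>] geodD(3)[OF \<gamma>'] h elim by (intro d_ge_dist) auto
    ultimately have 3: "norm (\<gamma>' h - \<gamma> h) \<le> sqrt (4 * h * \<eta> t + (\<eta> t)\<^sup>2)" by (simp add: dist_norm)
    have "h *\<^sub>R (direction (f t) (g t) - direction x y) = (\<gamma>' h - \<gamma> h) - (f t - x)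
        - (\<gamma>' h - f t - h *\<^sub>R direction (f t) (g t)) + (\<gamma> h - x - h *\<^sub>R direction x y)"
      by (simp add: algebra_simps)
    also have "norm \<dots> \<le> norm (\<gamma>' h - \<gamma> h) + norm (f t - x)
        + norm (\<gamma>' h - f t - h *\<^sub>R direction (f t) (g t)) + norm (\<gamma> h - x - h *\<^sub>R direction x y)"
      using norm_triangle_ineq norm_triangle_ineq4 by (smt (verit))
    finally have le: "h * norm (direction (f t) (g t) - direction x y) \<le> norm (\<gamma>' h - \<gamma> h) + norm (f t - x)
        + norm (\<gamma>' h - f t - h *\<^sub>R direction (f t) (g t)) + norm (\<gamma> h - x - h *\<^sub>R direction x y)"
      using h(2) by (simp only: norm_scaleR abs_of_pos)
    have "h * norm (direction (f t) (g t) - direction x y) \<le>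
        (sqrt (4 * h * \<eta> t + (\<eta> t)\<^sup>2) + dist (f t) x) + h * (2 * velocity_const * sqrt h)"
    proof -
      have "h * (2 * velocity_const * sqrt h) = 2 * (velocity_const * h * sqrt h)" by simp
      then show ?thesis using le 1 2 3 unfolding dist_norm by linarith
    qed
    then have "norm (direction (f t) (g t) - direction x y) \<le>
        (sqrt (4 * h * \<eta> t + (\<eta> t)\<^sup>2) + dist (f t) x) / h + 2 * velocity_const * sqrt h"
      using h(2) by (simp add: field_simps)
    then show ?case using elim h(1) unfolding dist_norm by linarith
  qed
qed

text \<open>
  A geodesic stays in the closure of \<open>D\<close>, hence outside the exterior ball.
\<close>

lemma inner_normal_direction_le:
  assumes x: "x \<in> closure D" and y: "y \<in> closure D" and "x \<noteq> y" and \<nu>: "\<nu> \<in> exterior_normals E D r x"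
  shows "inner \<nu> (direction x y) \<le> 0"
proof (rule tendsto_lowerbound[where F = "at_right 0"])
  have l: "0 < d x y" using d_nonneg[OF x y] d_eq_0_iff[OF x y] \<open>x \<noteq> y\<close> by simp
  obtain \<gamma> where \<gamma>: "geod x y \<gamma>" using geod_exists[OF x y] .
  have n: "norm \<nu> = 1" using \<nu> by (simp add: exterior_normals_def)
  show "((\<lambda>h. h / (2 * r) + velocity_const * sqrt h) \<longlongrightarrow> 0) (at_right 0)"
    using r_pos by (auto intro!: tendsto_eq_intros)
  have "\<forall>\<^sub>F h in at_right 0. h \<in> {0<..<min (\<rho> / 2) (d x y)}"
    using l \<rho>_pos by (intro eventually_at_right_real) auto
  then show "\<forall>\<^sub>F h in at_right 0. inner \<nu> (direction x y) \<le> h / (2 * r) + velocity_const * sqrt h"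
  proof eventually_elim
    case (elim h)
    then have h: "0 < h" "h \<le> \<rho> / 2" "h \<le> d x y" by auto
    have exp: "norm (\<gamma> h - x - h *\<^sub>R direction x y) \<le> velocity_const * h * sqrt h"
      using h by (intro geodesic_direction_expansion[OF x y \<open>x \<noteq> y\<close> \<gamma>]) auto
    have "norm (\<gamma> h - x) \<le> h"
      using geod_dist_le[OF \<gamma>, of h 0] geodD(1)[OF \<gamma>] h by (simp add: dist_norm)
    then have "(norm (\<gamma> h - x))\<^sup>2 \<le> h\<^sup>2" by (intro power_mono) auto
    then have "2 * r * inner \<nu> (\<gamma> h - x) \<le> h\<^sup>2"
      using order_trans[OF exterior_normal_inner_le[OF \<nu> geodD(3)[OF \<gamma>, of h]]] h by simp
    then have 1: "inner \<nu> (\<gamma> h - x) \<le> h\<^sup>2 / (2 * r)" using r_pos by (simp add: pos_le_divide_eq mult.commute)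
    have 2: "- inner \<nu> (\<gamma> h - x - h *\<^sub>R direction x y) \<le> velocity_const * h * sqrt h"
      using Cauchy_Schwarz_ineq2[of \<nu> "\<gamma> h - x - h *\<^sub>R direction x y"] exp n by simp
    have "h * inner \<nu> (direction x y) = inner \<nu> (\<gamma> h - x) - inner \<nu> (\<gamma> h - x - h *\<^sub>R direction x y)"
      by (simp add: inner_diff_right)
    also have "\<dots> \<le> h\<^sup>2 / (2 * r) + velocity_const * h * sqrt h" using 1 2 by simp
    also have "\<dots> = h * (h / (2 * r) + velocity_const * sqrt h)" by (simp add: power2_eq_square algebra_simps)
    finally show ?case using h by simp
  qed
qed simp

end

section \<open>The reflection of the Lion vanishes\<close>

lemma inner_set_integral_le:
  fixes f :: "'a \<Rightarrow> 'b::{real_inner, banach, second_countable_topology}"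
  assumes A: "A \<in> sets M" "emeasure M A < \<infinity>" and f: "f \<in> borel_measurable M"
    and bound: "AE x in M. x \<in> A \<longrightarrow> norm (f x) \<le> B" and le: "AE x in M. x \<in> A \<longrightarrow> inner a (f x) \<le> c"
  shows "set_integrable M A f" "inner a (LINT x:A|M. f x) \<le> c * measure M A"
proof -
  show int: "set_integrable M A f"
    unfolding set_integrable_def by (rule integrableI_bounded_set_indicator[OF A(1) f A(2) bound])
  have "inner a (LINT x:A|M. f x) = (\<integral>x. inner a (indicator A x *\<^sub>R f x) \<partial>M)"
    using int unfolding set_integrable_def set_lebesgue_integral_def
    by (intro integral_inner_right[symmetric])
  also have "\<dots> \<le> (\<integral>x. c * indicator A x \<partial>M)"
  proof (rule integral_mono_AE)
    show "integrable M (\<lambda>x. inner a (indicator A x *\<^sub>R f x))"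
      using int unfolding set_integrable_def by (rule integrable_inner_right)
    show "integrable M (\<lambda>x. c * indicator A x)" using A by simp
    show "AE x in M. inner a (indicator A x *\<^sub>R f x) \<le> c * indicator A x"
      using le by eventually_elim (auto split: split_indicator)
  qed
  also have "\<dots> = c * measure M A" using A by simp
  finally show "inner a (LINT x:A|M. f x) \<le> c * measure M A" .
qed

lemma set_integral_const_Ioc:
  fixes c :: "'b::{banach, second_countable_topology}"
  assumes "s \<le> t"
  shows "set_integrable lebesgue {s<..t} (\<lambda>_. c)" "(LINT \<tau>:{s<..t}|lebesgue. c) = (t - s) *\<^sub>R c"
proof -
  have "measure lebesgue {s<..t} = t - s" using assms by (simp add: measure_completion)
  moreover have "emeasure lebesgue {s<..t} < \<infinity>" using assms by simp
  ultimately show "set_integrable lebesgue {s<..t} (\<lambda>_. c)" "(LINT \<tau>:{s<..t}|lebesgue. c) = (t - s) *\<^sub>R c"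
    by (simp_all add: set_integrable_def set_lebesgue_integral_def)
qed

lemma set_integral_near_constant:
  fixes u :: "real \<Rightarrow> 'b::{banach, second_countable_topology}"
  assumes int: "set_integrable lebesgue {s<..t} u" and "s \<le> t"
    and near: "\<And>\<tau>. \<tau> \<in> {s<..t} \<Longrightarrow> norm (u \<tau> - v) \<le> \<eta>"
  shows "norm ((LINT \<tau>:{s<..t}|lebesgue. u \<tau>) - (t - s) *\<^sub>R v) \<le> \<eta> * (t - s)"
proof -
  note const = set_integral_const_Ioc[OF \<open>s \<le> t\<close>]
  have diff: "set_integrable lebesgue {s<..t} (\<lambda>\<tau>. u \<tau> - v)"
    by (rule set_integral_diff(1)[OF int const(1)])
  have "(LINT \<tau>:{s<..t}|lebesgue. u \<tau>) - (t - s) *\<^sub>R v = (LINT \<tau>:{s<..t}|lebesgue. u \<tau> - v)"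
    by (simp only: set_integral_diff(2)[OF int const(1)] const(2))
  also have "norm \<dots> \<le> (LINT \<tau>:{s<..t}|lebesgue. norm (u \<tau> - v))"
    by (rule set_integral_norm_bound[OF diff])
  also have "\<dots> \<le> (LINT \<tau>:{s<..t}|lebesgue. \<eta>)"
    using near by (intro set_integral_mono set_integrable_norm diff const)
  also have "\<dots> = \<eta> * (t - s)" using const(2)[of \<eta>] by simp
  finally show ?thesis .
qed

lemma additive_bound_from_local:
  fixes N :: "real \<Rightarrow> real \<Rightarrow> 'a::real_normed_vector" and G :: "real \<Rightarrow> real"
  assumes "0 < \<delta>"
    and add: "\<And>s t u. 0 \<le> s \<Longrightarrow> s \<le> t \<Longrightarrow> t \<le> u \<Longrightarrow> u \<le> T \<Longrightarrow> N s u = N s t + N t u"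
    and loc: "\<And>s t. 0 \<le> s \<Longrightarrow> s \<le> t \<Longrightarrow> t \<le> T \<Longrightarrow> t - s \<le> \<delta> \<Longrightarrow> norm (N s t) \<le> K * (G t - G s)"
    and t: "0 \<le> t" "t \<le> T"
  shows "norm (N 0 t) \<le> K * (G t - G 0)"
proof -
  have "norm (N 0 t) \<le> K * (G t - G 0)" if "0 \<le> t" "t \<le> T" "t \<le> real n * \<delta>" for n t
    using that
  proof (induction n arbitrary: t)
    case 0
    then show ?case using loc[of 0 t] \<open>0 < \<delta>\<close> by simp
  next
    case (Suc n)
    show ?case
    proof (cases "t \<le> \<delta>")
      case True
      then show ?thesis using loc[of 0 t] Suc.prems by simp
    next
      case False
      have "norm (N 0 (t - \<delta>)) \<le> K * (G (t - \<delta>) - G 0)"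
        using False Suc.prems \<open>0 < \<delta>\<close> by (intro Suc.IH) (auto simp: algebra_simps)
      moreover have "norm (N (t - \<delta>) t) \<le> K * (G t - G (t - \<delta>))"
        using False Suc.prems \<open>0 < \<delta>\<close> by (intro loc) auto
      moreover have "N 0 t = N 0 (t - \<delta>) + N (t - \<delta>) t"
        using False Suc.prems \<open>0 < \<delta>\<close> by (intro add) auto
      ultimately show ?thesis
        using norm_triangle_ineq[of "N 0 (t - \<delta>)" "N (t - \<delta>) t"] by (simp add: algebra_simps)
    qed
  qed
  moreover obtain n :: nat where "t / \<delta> < real n" using reals_Archimedean2 by blast
  then have "t \<le> real n * \<delta>" using \<open>0 < \<delta>\<close> by (simp add: field_simps)
  ultimately show ?thesis using t by blast
qed

context cat0_domain begin

text \<open>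
  Over a short time \<open>h\<close> write the displacement of the Lion as \<open>U - N\<close>, with the drift \<open>U\<close> and the
  reflection \<open>N\<close>. As the direction \<open>u\<close> is continuous, \<open>U\<close> is almost \<open>h *\<^sub>R u\<close>; as \<open>u\<close> has nonpositive
  inner product with the normals, \<open>\<langle>U, N\<rangle>\<close> is almost nonpositive; and \<open>norm (U - N) \<le> h\<close>. Hence
  \<open>norm N \<le> sqrt (2 \<eta>) (h + \<Delta>L)\<close>, where \<open>\<eta>\<close> is the oscillation of \<open>u\<close>. These bounds are additive over a partition and \<open>L\<close> has
  finite total increase, so letting \<open>\<eta>\<close> tend to zero gives \<open>N = 0\<close>.
\<close>

lemma lion_follows_direction:
  assumes x: "x ` {0..T} \<subseteq> closure D" "1-lipschitz_on {0..T} x"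
    and y: "y ` {0..T} \<subseteq> closure D" "1-lipschitz_on {0..T} y"
    and ne: "\<And>t. t \<in> {0..T} \<Longrightarrow> x t \<noteq> y t"
    and refl: "reflection_term E D r x L \<nu>"
    and int: "\<And>t. t \<in> {0..T} \<Longrightarrow> set_integrable lebesgue {0..t} (\<lambda>s. direction (x s) (y s))"
    and eq: "\<And>t. t \<in> {0..T} \<Longrightarrow> x t = x 0 + (LINT s:{0..t}|lebesgue. direction (x s) (y s))
        - (LINT s:{0<..t}|interval_measure L. \<nu> s)"
    and e: "0 < e"
  obtains \<delta>' where "0 < \<delta>'" "\<And>s t. 0 \<le> s \<Longrightarrow> s \<le> t \<Longrightarrow> t \<le> T \<Longrightarrow> t - s \<le> \<delta>' \<Longrightarrow>
    norm (x t - x s - (t - s) *\<^sub>R direction (x s) (y s)) \<le> e * (t - s)"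
proof -
  define u where "u s = direction (x s) (y s)" for s
  define U where "U s t = (LINT \<tau>:{s<..t}|lebesgue. u \<tau>)" for s t
  define N where "N s t = (LINT \<tau>:{s<..t}|interval_measure L. \<nu> \<tau>)" for s t
  have x_cl: "x t \<in> closure D" and y_cl: "y t \<in> closure D" if "t \<in> {0..T}" for t using that x y by auto
  have norm_u: "norm (u t) = 1" if t: "t \<in> {0..T}" for t
  proof -
    obtain \<gamma> where "geod (x t) (y t) \<gamma>" using geod_exists[OF x_cl[OF t] y_cl[OF t]] .
    then show ?thesis
      unfolding u_def using t by (intro geodesic_direction_expansion(1) x_cl y_cl ne)
  qed
  have "continuous_on {0..T} u"
    unfolding continuous_on_def
  proof
    fix t assume t: "t \<in> {0..T}"
    have "(x \<longlongrightarrow> x t) (at t within {0..T})" "(y \<longlongrightarrow> y t) (at t within {0..T})"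
      using lipschitz_on_continuous_on[OF x(2)] lipschitz_on_continuous_on[OF y(2)] t
      by (auto simp: continuous_on_def)
    then show "(u \<longlongrightarrow> u t) (at t within {0..T})"
      unfolding u_def using t
      by (intro tendsto_geodesic_direction x_cl y_cl ne)
         (auto simp: eventually_at_filter intro!: always_eventually x_cl y_cl)
  qed
  then have uc: "uniformly_continuous_on {0..T} u" by (intro compact_uniformly_continuous) auto
  have modulus: "\<exists>\<delta>'>0. \<forall>s\<in>{0..T}. \<forall>t\<in>{0..T}. \<bar>t - s\<bar> \<le> \<delta>' \<longrightarrow> norm (u t - u s) \<le> \<eta>" if "0 < \<eta>" for \<eta>
  proof -
    obtain \<delta>' where "0 < \<delta>'" "\<And>s t. s \<in> {0..T} \<Longrightarrow> t \<in> {0..T} \<Longrightarrow> dist t s < \<delta>' \<Longrightarrow> dist (u t) (u s) < \<eta>"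
      using uc \<open>0 < \<eta>\<close> unfolding uniformly_continuous_on_def by metis
    then show ?thesis
      by (intro exI[of _ "\<delta>' / 2"]) (auto simp: dist_real_def dist_norm less_imp_le)
  qed
  have L: "mono L" "\<And>t. continuous (at_right t) L" and \<nu>: "\<nu> \<in> borel_measurable borel"
    and AE_refl: "AE t in interval_measure L. 0 < t \<longrightarrow>
        x t \<in> boundary_in E D \<and> \<nu> t \<in> exterior_normals E D r (x t)"
    using refl by (auto simp: reflection_term_def)
  have L_mono: "L s \<le> L t" if "s \<le> t" for s t using L(1) that by (rule monoD)
  have \<nu>_meas: "\<nu> \<in> borel_measurable (interval_measure L)" using \<nu> by simp
  have emeas: "emeasure (interval_measure L) {s<..t} = ennreal (L t - L s)" if "s \<le> t" for s t
    using that L L_mono by (intro emeasure_interval_measure_Ioc) auto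
  have meas: "measure (interval_measure L) {s<..t} = L t - L s" if "s \<le> t" for s t
    using emeas[OF that] L_mono[OF that] by (simp add: measure_def)
  have \<nu>_bound: "AE t in interval_measure L. t \<in> {s<..t'} \<longrightarrow> norm (\<nu> t) \<le> 1" if "0 \<le> s" for s t'
    using AE_refl by eventually_elim (use that in \<open>auto simp: exterior_normals_def\<close>)
  have N_le: "inner a (N s t) \<le> c * (L t - L s)"
    and N_int: "set_integrable (interval_measure L) {s<..t} \<nu>"
    if "0 \<le> s" "s \<le> t" "AE \<tau> in interval_measure L. \<tau> \<in> {s<..t} \<longrightarrow> inner a (\<nu> \<tau>) \<le> c" for a c s t
    using inner_set_integral_le[OF _ _ \<nu>_meas \<nu>_bound[OF that(1)] that(3)] emeas[OF that(2)] meas[OF that(2)]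
    by (auto simp: N_def)
  have N_int': "set_integrable (interval_measure L) {s<..t} \<nu>" if "0 \<le> s" "s \<le> t" for s t
    using N_int[OF that, of 0 0] by simp
  have N_add: "N s w = N s t + N t w" if "0 \<le> s" "s \<le> t" "t \<le> w" for s t w
  proof -
    have "{s<..w} = {s<..t} \<union> {t<..w}" using that by auto
    then show ?thesis unfolding N_def using that by (simp only:) (intro set_integral_Un N_int', auto)
  qed
  have u_int: "set_integrable lebesgue {s<..t} u" if "0 \<le> s" "t \<le> T" for s t
  proof (cases "0 \<le> t")
    case True
    then show ?thesis
      using that by (intro set_integrable_subset[OF int[folded u_def]]) auto
  qed (use that in \<open>auto simp: set_integrable_def\<close>)
  have increment: "x t - x s = U s t - N s t" if st: "0 \<le> s" "s \<le> t" "t \<le> T" for s t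
  proof -
    have "{0..t} = {0..s} \<union> {s<..t}" using st by auto
    then have "(LINT \<tau>:{0..t}|lebesgue. u \<tau>) = (LINT \<tau>:{0..s}|lebesgue. u \<tau>) + U s t"
      unfolding U_def using st int[folded u_def] u_int by (simp only:) (intro set_integral_Un, auto)
    then show ?thesis
      using eq[of t] eq[of s] N_add[of 0 s t] st by (simp add: u_def[symmetric] N_def[symmetric])
  qed
  have small_windows: "\<exists>\<delta>'>0. \<forall>s t. 0 \<le> s \<and> s \<le> t \<and> t \<le> T \<and> t - s \<le> \<delta>' \<longrightarrow>
      norm (N s t) \<le> sqrt (2 * \<eta>) * ((t + L t) - (s + L s))" if \<eta>: "0 < \<eta>" "\<eta> < 1" for \<eta>
  proof -
    obtain \<delta>' where \<delta>': "0 < \<delta>'" "\<And>s t. s \<in> {0..T} \<Longrightarrow> t \<in> {0..T} \<Longrightarrow> \<bar>t - s\<bar> \<le> \<delta>' \<Longrightarrow> norm (u t - u s) \<le> \<eta>"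
      using modulus[OF \<eta>(1)] by blast
    have "norm (N s t) \<le> sqrt (2 * \<eta>) * ((t + L t) - (s + L s))"
      if st: "0 \<le> s" "s \<le> t" "t \<le> T" "t - s \<le> \<delta>'" for s t
    proof -
      define h l where "h = t - s" and "l = L t - L s"
      have h: "0 \<le> h" "0 \<le> l" using st L_mono by (auto simp: h_def l_def)
      have a: "norm (U s t - h *\<^sub>R u \<tau>) \<le> \<eta> * h" if "\<tau> \<in> {s..t}" for \<tau>
        unfolding U_def h_def using st that
        by (intro set_integral_near_constant u_int \<delta>'(2)) auto
      have "inner (U s t) (N s t) \<le> (\<eta> * h) * (L t - L s)"
      proof (rule N_le[OF st(1,2)])
        show "AE \<tau> in interval_measure L. \<tau> \<in> {s<..t} \<longrightarrow> inner (U s t) (\<nu> \<tau>) \<le> \<eta> * h"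
          using AE_refl
        proof eventually_elim
          case (elim \<tau>)
          show ?case
          proof
            assume \<tau>: "\<tau> \<in> {s<..t}"
            then have \<tau>T: "\<tau> \<in> {0..T}" and n: "\<nu> \<tau> \<in> exterior_normals E D r (x \<tau>)" using st elim by auto
            have "inner (\<nu> \<tau>) (u \<tau>) \<le> 0"
              unfolding u_def by (rule inner_normal_direction_le[OF x_cl[OF \<tau>T] y_cl[OF \<tau>T] ne[OF \<tau>T] n])
            then have "h * inner (u \<tau>) (\<nu> \<tau>) \<le> 0" using h(1) by (simp add: inner_commute mult_nonneg_nonpos)
            moreover have "inner (U s t - h *\<^sub>R u \<tau>) (\<nu> \<tau>) \<le> \<eta> * h"
              using norm_cauchy_schwarz[of "U s t - h *\<^sub>R u \<tau>" "\<nu> \<tau>"] a[of \<tau>] \<tau> n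
              by (simp add: exterior_normals_def)
            ultimately show "inner (U s t) (\<nu> \<tau>) \<le> \<eta> * h" by (simp add: inner_diff_left)
          qed
        qed
      qed
      then have inner: "inner (U s t) (N s t) \<le> \<eta> * h * l" by (simp add: l_def)
      have "norm (x t - x s) \<le> h"
        using lipschitz_onD[OF x(2), of t s] st by (simp add: dist_norm h_def)
      then have "norm (U s t - N s t) \<le> h" using increment st by simp
      then have "(norm (U s t - N s t))\<^sup>2 \<le> h\<^sup>2" by (intro power_mono) auto
      then have "(norm (U s t))\<^sup>2 - 2 * inner (U s t) (N s t) + (norm (N s t))\<^sup>2 \<le> h\<^sup>2"
        using dot_norm_neg[of "U s t" "N s t"] by simp
      moreover have "(h - \<eta> * h)\<^sup>2 \<le> (norm (U s t))\<^sup>2"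
      proof (rule power_mono)
        have "norm (h *\<^sub>R u s) = h" using h norm_u[of s] st by simp
        then show "h - \<eta> * h \<le> norm (U s t)"
          using a[of s] norm_triangle_ineq2[of "h *\<^sub>R u s" "U s t"] st by (simp add: norm_minus_commute)
        show "0 \<le> h - \<eta> * h" using h \<eta> by (simp add: mult_left_le_one_le)
      qed
      moreover have "(h - \<eta> * h)\<^sup>2 = h\<^sup>2 - 2 * \<eta> * h\<^sup>2 + (\<eta> * h)\<^sup>2" by (simp add: power2_eq_square algebra_simps)
      moreover have "0 \<le> (\<eta> * h)\<^sup>2" by simp
      ultimately have "(norm (N s t))\<^sup>2 \<le> 2 * \<eta> * h\<^sup>2 + 2 * (\<eta> * h * l)" using inner by linarith
      also have "\<dots> \<le> 2 * \<eta> * (h + l)\<^sup>2"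
      proof -
        have "0 \<le> \<eta> * (h * l)" "0 \<le> \<eta> * (l * l)" using h \<eta> by auto
        then show ?thesis by (simp add: power2_eq_square algebra_simps)
      qed
      finally have "norm (N s t) \<le> sqrt (2 * \<eta> * (h + l)\<^sup>2)" by (rule real_le_rsqrt)
      also have "\<dots> = sqrt (2 * \<eta>) * (h + l)" using h by (simp add: real_sqrt_mult)
      finally show ?thesis by (simp add: h_def l_def algebra_simps)
    qed
    then show ?thesis using \<delta>'(1) by blast
  qed
  have N0: "N 0 t = 0" if t: "0 \<le> t" "t \<le> T" for t
  proof -
    define W where "W = (t + L t) - (0 + L 0)"
    have "norm (N 0 t) \<le> 0"
    proof (rule tendsto_lowerbound[where F = "at_right (0::real)"])
      show "((\<lambda>\<eta>. sqrt (2 * \<eta>) * W) \<longlongrightarrow> 0) (at_right 0)" by (auto intro!: tendsto_eq_intros)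
      have "\<forall>\<^sub>F \<eta> in at_right (0::real). \<eta> \<in> {0<..<1}" by (rule eventually_at_right_real) simp
      then show "\<forall>\<^sub>F \<eta> in at_right 0. norm (N 0 t) \<le> sqrt (2 * \<eta>) * W"
      proof eventually_elim
        case (elim \<eta>)
        then obtain \<delta>' where \<delta>': "0 < \<delta>'" "\<And>s t. 0 \<le> s \<Longrightarrow> s \<le> t \<Longrightarrow> t \<le> T \<Longrightarrow> t - s \<le> \<delta>' \<Longrightarrow>
            norm (N s t) \<le> sqrt (2 * \<eta>) * ((t + L t) - (s + L s))"
          using small_windows[of \<eta>] by auto
        show ?case
          unfolding W_def
          by (rule additive_bound_from_local[where G = "\<lambda>t. t + L t" and T = T, OF \<delta>'(1) N_add \<delta>'(2) t])
      qed
    qed simp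
    then show ?thesis by simp
  qed
  have N_zero: "N s t = 0" if "0 \<le> s" "s \<le> t" "t \<le> T" for s t
    using N0[of s] N0[of t] N_add[of 0 s t] that by simp
  obtain \<delta>' where \<delta>': "0 < \<delta>'" "\<And>s t. s \<in> {0..T} \<Longrightarrow> t \<in> {0..T} \<Longrightarrow> \<bar>t - s\<bar> \<le> \<delta>' \<Longrightarrow> norm (u t - u s) \<le> e"
    using modulus[OF e] by blast
  show ?thesis
  proof (rule that[OF \<delta>'(1)])
    fix s t assume st: "0 \<le> s" "s \<le> t" "t \<le> T" "t - s \<le> \<delta>'"
    have "norm (U s t - (t - s) *\<^sub>R u s) \<le> e * (t - s)"
      unfolding U_def using st by (intro set_integral_near_constant u_int \<delta>'(2)) auto
    then show "norm (x t - x s - (t - s) *\<^sub>R direction (x s) (y s)) \<le> e * (t - s)"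
      using increment[OF st(1-3)] N_zero[OF st(1-3)] by (simp add: u_def)
  qed
qed

end

section \<open>The Lyapunov function\<close>

lemma growth_from_right_increments:
  fixes \<Phi> :: "real \<Rightarrow> real"
  assumes "0 \<le> T" and cont: "continuous_on {0..T} \<Phi>"
    and step: "\<And>t e. 0 \<le> t \<Longrightarrow> t < T \<Longrightarrow> 0 < e \<Longrightarrow>
      \<forall>\<^sub>F h in at_right 0. \<Phi> t + h * (c - e) \<le> \<Phi> (t + h)"
  shows "\<Phi> 0 + c * T \<le> \<Phi> T"
proof -
  have "c * T \<le> \<Phi> T - \<Phi> 0 + e * T" if e: "0 < e" for e
  proof -
    define \<psi> where "\<psi> t = \<Phi> t - (c - e) * t" for t
    have cont_\<psi>: "continuous_on {0..T} \<psi>" unfolding \<psi>_def by (intro continuous_intros cont)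
    define S where "S = {t \<in> {0..T}. \<psi> 0 \<le> \<psi> t}"
    have "closed S" unfolding S_def by (intro continuous_on_closed_Collect_le cont_\<psi>) auto
    moreover have S: "0 \<in> S" "S \<subseteq> {0..T}" using \<open>0 \<le> T\<close> by (auto simp: S_def)
    ultimately have Sup: "Sup S \<in> S" by (intro closed_contains_Sup) (auto intro: bdd_above_mono)
    have "Sup S = T"
    proof (rule ccontr)
      assume "Sup S \<noteq> T"
      then have t: "0 \<le> Sup S" "Sup S < T" using Sup S by (auto simp: less_le)
      have "\<forall>\<^sub>F h in at_right 0. h \<in> {0<..<T - Sup S}"
        using t by (intro eventually_at_right_real) auto
      with step[OF t e] have "\<forall>\<^sub>F h in at_right 0. \<Phi> (Sup S) + h * (c - e) \<le> \<Phi> (Sup S + h) \<and> h \<in> {0<..<T - Sup S}"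
        by (rule eventually_conj)
      then obtain h where h: "\<Phi> (Sup S) + h * (c - e) \<le> \<Phi> (Sup S + h)" "0 < h" "h < T - Sup S"
        using eventually_happens[of _ "at_right (0::real)"] by auto
      then have "\<psi> (Sup S) \<le> \<psi> (Sup S + h)" by (simp add: \<psi>_def algebra_simps)
      then have "Sup S + h \<in> S" using Sup h t by (auto simp: S_def)
      then have "Sup S + h \<le> Sup S" using S(2) by (intro cSup_upper) (auto intro: bdd_above_mono)
      then show False using h by simp
    qed
    then show ?thesis using Sup by (simp add: S_def \<psi>_def algebra_simps)
  qed
  note slack = this
  have "c * T \<le> \<Phi> T - \<Phi> 0 + e" if "0 < e" for e
  proof -
    have "c * T \<le> \<Phi> T - \<Phi> 0 + e / (T + 1) * T"
      using slack[of "e / (T + 1)"] that \<open>0 \<le> T\<close> by simp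
    also have "e / (T + 1) * T \<le> e" using that \<open>0 \<le> T\<close> by (simp add: field_simps)
    finally show ?thesis by simp
  qed
  then have "c * T \<le> \<Phi> T - \<Phi> 0" by (rule field_le_epsilon)
  then show ?thesis by simp
qed

context cat0_domain begin

lemma d_le_two_dist:
  assumes "x \<in> closure D" "y \<in> closure D" "dist x y < \<rho>" shows "d x y \<le> 2 * dist x y"
proof -
  have "dist x y * dist x y \<le> r * dist x y"
    using assms(3) \<rho>_le_r by (intro mult_right_mono) auto
  then have "dist x y * dist x y / r \<le> dist x y" using r_pos by (simp add: pos_divide_le_eq mult.commute)
  then show ?thesis using d_le_quadratic[OF assms] by (simp add: power2_eq_square)
qed

text \<open>
  One step of the Lyapunov function. The number \<open>lam\<close> is the defect of the Man from running straight away: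
  his new distance from the old position of the Lion is \<open>d X Y + h - lam * h\<close>. The terms in the inner
  parentheses become small with \<open>h\<close> and \<open>\<theta>\<close>.
\<close>

lemma pursuit_step:
  assumes cl: "X \<in> closure D" "Y \<in> closure D" "x1 \<in> closure D" "y1 \<in> closure D" "p \<in> closure D"
    and \<gamma>: "geod X Y \<gamma>" and h: "0 < h" "2 * h \<le> d X Y" and \<theta>: "0 \<le> \<theta>"
    and lion: "d x1 (\<gamma> h) \<le> \<theta> * h" and man: "d Y y1 \<le> h"
    and M: "\<And>a b. a \<in> closure D \<Longrightarrow> b \<in> closure D \<Longrightarrow> d a b \<le> M"
    and \<epsilon>: "0 < \<epsilon>" "\<epsilon> \<le> 2 * d X Y"
  defines "K \<equiv> 8 * M\<^sup>2 / \<epsilon>"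
  shows "(d p Y)\<^sup>2 - (d p X)\<^sup>2 - K * d X Y
      + h * (\<epsilon> / 2 - (8 * h + 2 * M * \<theta> + \<theta>\<^sup>2 * h + K * (sqrt (h / d X Y) + \<theta>)))
    \<le> (d p y1)\<^sup>2 - (d p x1)\<^sup>2 - K * d x1 y1"
proof -
  define f where "f = d X Y"
  define A B where "A = (d p X)\<^sup>2" and "B = (d p Y)\<^sup>2"
  define lam where "lam = (f + h - d X y1) / h"
  have f: "0 < f" "2 * h \<le> f" using h by (auto simp: f_def)
  have M0: "0 \<le> M" using M[OF cl(1,1)] d_self[OF cl(1)] by simp
  have K0: "0 \<le> K" using \<epsilon> by (simp add: K_def)
  note \<gamma>' = geodD[OF \<gamma>, folded f_def]
  have Xy1: "d X y1 = f + h - lam * h" using h by (simp add: lam_def)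
  have "d X y1 \<le> f + d Y y1" unfolding f_def by (intro d_triangle cl)
  then have "0 \<le> lam" using man h by (simp add: lam_def)
  have "f \<le> d X y1 + d y1 Y" unfolding f_def by (intro d_triangle cl)
  moreover have "d y1 Y = d Y y1" by (intro d_commute cl)
  ultimately have e_low: "f - h \<le> d X y1" using man by simp
  then have "lam \<le> 2" using h by (simp add: lam_def pos_divide_le_eq)

  define g where "g = \<gamma> h"
  have g: "g \<in> closure D" using \<gamma>'(3) h f by (simp add: g_def)
  have gx1: "d g x1 \<le> \<theta> * h" using lion d_commute[OF cl(3) g] by (simp add: g_def)

  (* The comparison inequality at g bounds the growth of the Lion's squared distance from p. *)
  have A1: "(d p x1)\<^sup>2 \<le> A + h * (B - A) / f - h * f + h\<^sup>2 + 2 * M * \<theta> * h + \<theta>\<^sup>2 * h\<^sup>2"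
  proof -
    have "f * (d p g)\<^sup>2 \<le> (f - h) * A + h * B - h * (f - h) * f"
      using cat0_comparison[OF cl(1,2,5) \<gamma>, of h] h by (simp add: f_def A_def B_def g_def)
    also have "\<dots> = f * (A + h * (B - A) / f - h * f + h\<^sup>2)"
      using f by (simp add: power2_eq_square field_simps)
    finally have g_le: "(d p g)\<^sup>2 \<le> A + h * (B - A) / f - h * f + h\<^sup>2"
      using f(1) by (simp only: mult_le_cancel_left_pos)
    have "d p x1 \<le> d p g + \<theta> * h" using d_triangle[OF cl(5) g cl(3)] gx1 by simp
    then have "(d p x1)\<^sup>2 \<le> (d p g + \<theta> * h)\<^sup>2" using d_nonneg cl by (intro power_mono) auto
    also have "\<dots> = (d p g)\<^sup>2 + d p g * (2 * \<theta> * h) + \<theta>\<^sup>2 * h\<^sup>2" by (simp add: power2_eq_square algebra_simps)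
    also have "d p g * (2 * \<theta> * h) \<le> M * (2 * \<theta> * h)"
      using M[OF cl(5) g] \<theta> h by (intro mult_right_mono) auto
    finally show ?thesis using g_le by simp
  qed

  (* Go back from Y by h along the geodesic, to z. If the defect lam is small, Y is almost the
     midpoint of z and y1, so the midpoint inequality bounds the distance of y1 from below in terms
     of those of Y and z. *)
  have B1: "B + h * (B - A) / f + h * f - 4 * M * h * sqrt lam - 7 * h\<^sup>2 \<le> (d p y1)\<^sup>2"
  proof -
    define z where "z = \<gamma> (f - h)"
    have z: "z \<in> closure D" using \<gamma>'(3) h f by (simp add: z_def)
    have zY: "d Y z = h" and Xz: "d X z = f - h"
      using \<gamma>'(4)[of f "f - h"] \<gamma>'(4)[of 0 "f - h"] \<gamma>'(1,2) h f by (auto simp: z_def f_def)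
    have "f * (d p z)\<^sup>2 \<le> (f - (f - h)) * A + (f - h) * B - (f - h) * (f - (f - h)) * f"
      using cat0_comparison[OF cl(1,2,5) \<gamma>, of "f - h"] h f(2) by (simp add: f_def A_def B_def z_def)
    also have "\<dots> = f * (B - h * (B - A) / f - h * f + h\<^sup>2)"
      using f by (simp add: power2_eq_square field_simps)
    finally have z_le: "(d p z)\<^sup>2 \<le> B - h * (B - A) / f - h * f + h\<^sup>2"
      using f(1) by (simp only: mult_le_cancel_left_pos)
    define w where "w = d z y1"
    have "2 * h - lam * h \<le> w" using d_triangle[OF cl(1) z cl(4)] Xy1 Xz by (simp add: w_def)
    moreover have "0 \<le> 2 * h - lam * h" using \<open>lam \<le> 2\<close> h by (simp add: mult_right_mono)
    ultimately have "(2 * h - lam * h)\<^sup>2 \<le> w\<^sup>2" by (intro power_mono)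
    moreover have "(2 * h - lam * h)\<^sup>2 = 4 * h\<^sup>2 - 4 * (lam * h\<^sup>2) + (lam * h)\<^sup>2"
      by (simp add: power2_eq_square algebra_simps)
    ultimately have w: "4 * h\<^sup>2 - 4 * (lam * h\<^sup>2) \<le> w\<^sup>2" using zero_le_power2[of "lam * h"] by linarith
    obtain m where m: "m \<in> closure D"
      "\<And>c. c \<in> closure D \<Longrightarrow> (d c m)\<^sup>2 \<le> (d c z)\<^sup>2 / 2 + (d c y1)\<^sup>2 / 2 - w\<^sup>2 / 4"
      using midpoint_exists[OF z cl(4)] unfolding w_def by blast
    have "(d Y y1)\<^sup>2 \<le> h\<^sup>2" using man d_nonneg[OF cl(2,4)] by (intro power_mono)
    then have "(d Y m)\<^sup>2 \<le> lam * h\<^sup>2" using m(2)[OF cl(2)] w zY by simp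
    then have "d Y m \<le> sqrt (lam * h\<^sup>2)" by (rule real_le_rsqrt)
    then have Ym: "d Y m \<le> h * sqrt lam" using h by (simp add: real_sqrt_mult mult.commute)
    have "d p Y \<le> d p m + d m Y" by (intro d_triangle cl m)
    then have "d p Y \<le> d p m + h * sqrt lam" using Ym d_commute[OF cl(2) m(1)] by simp
    then have "B \<le> (d p m + h * sqrt lam)\<^sup>2" unfolding B_def using d_nonneg[OF cl(5,2)] by (intro power_mono)
    also have "\<dots> = (d p m)\<^sup>2 + d p m * (2 * (h * sqrt lam)) + lam * h\<^sup>2"
      using \<open>0 \<le> lam\<close> by (simp add: power2_sum power_mult_distrib)
    also have "d p m * (2 * (h * sqrt lam)) \<le> M * (2 * (h * sqrt lam))"
      using M[OF cl(5) m(1)] h \<open>0 \<le> lam\<close> by (intro mult_right_mono) auto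
    finally have "B \<le> (d p m)\<^sup>2 + 2 * (M * h * sqrt lam) + lam * h\<^sup>2" by simp
    moreover have "lam * h\<^sup>2 \<le> 2 * h\<^sup>2" using \<open>lam \<le> 2\<close> by (intro mult_right_mono) auto
    ultimately show ?thesis using m(2)[OF cl(5)] w z_le zero_le_power2[of h] by linarith
  qed

  (* Comparison for c = y1, whose distance from Y is at most h: the Lion gains h on the point y1 up
     to a higher order term, although he aims at Y. *)
  have sep: "d x1 y1 \<le> f - lam * h + h * (sqrt (h / f) + \<theta>)"
  proof -
    define e where "e = d X y1"
    have e: "h \<le> e" "f - h \<le> e" using e_low f by (auto simp: e_def)
    have "(d y1 Y)\<^sup>2 \<le> h\<^sup>2" using man d_nonneg[OF cl(4,2)] d_commute[OF cl(2,4)] by (intro power_mono) auto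
    then have "h * (d y1 Y)\<^sup>2 \<le> h * h\<^sup>2" using h by (intro mult_left_mono) auto
    moreover have "f * (d y1 g)\<^sup>2 \<le> (f - h) * e\<^sup>2 + h * (d y1 Y)\<^sup>2 - h * (f - h) * f"
      using cat0_comparison[OF cl(1,2,4) \<gamma>, of h] h d_commute[OF cl(1,4)] by (simp add: f_def e_def g_def)
    moreover have "(f - h) * e\<^sup>2 + h * h\<^sup>2 - h * (f - h) * f = f * ((e - h)\<^sup>2 + h * h\<^sup>2 / f) - h * (e - f)\<^sup>2"
      using f by (simp add: power2_eq_square field_simps)
    moreover have "0 \<le> h * (e - f)\<^sup>2" using h by simp
    ultimately have "f * (d y1 g)\<^sup>2 \<le> f * ((e - h)\<^sup>2 + h * h\<^sup>2 / f)" by linarith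
    then have "(d y1 g)\<^sup>2 \<le> (e - h)\<^sup>2 + h * h\<^sup>2 / f" using f(1) by (simp only: mult_le_cancel_left_pos)
    also have "h * h\<^sup>2 / f = (h * sqrt (h / f))\<^sup>2" using h f by (simp add: power_mult_distrib)
    also have "(e - h)\<^sup>2 + (h * sqrt (h / f))\<^sup>2 \<le> (e - h + h * sqrt (h / f))\<^sup>2"
      using e h f by (simp add: power2_sum)
    finally have "d y1 g \<le> e - h + h * sqrt (h / f)"
      by (rule power2_le_imp_le) (use e h f in simp)
    moreover have "d x1 y1 \<le> d x1 g + d g y1" by (intro d_triangle cl g)
    ultimately show ?thesis
      using lion d_commute[OF cl(4) g] Xy1 by (simp add: g_def[symmetric] e_def algebra_simps)
  qed
  have "K * d x1 y1 \<le> K * (f - lam * h + h * (sqrt (h / f) + \<theta>))" using sep K0 by (rule mult_left_mono)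
  (* The choice of K: the gain lam in the separation pays for the loss sqrt lam. *)
  moreover have "h * (4 * M * sqrt lam) \<le> h * (\<epsilon> / 2 + K * lam)"
  proof (rule mult_left_mono)
    have "0 \<le> (\<epsilon> - 4 * M * sqrt lam)\<^sup>2" by simp
    also have "\<dots> = \<epsilon>\<^sup>2 - 8 * \<epsilon> * M * sqrt lam + 16 * M\<^sup>2 * lam"
      using \<open>0 \<le> lam\<close> by (simp add: power2_diff power_mult_distrib)
    finally have "8 * \<epsilon> * M * sqrt lam \<le> \<epsilon>\<^sup>2 + 16 * M\<^sup>2 * lam" by simp
    then show "4 * M * sqrt lam \<le> \<epsilon> / 2 + K * lam"
      using \<epsilon>(1) by (simp add: K_def field_simps power2_eq_square)
  qed (use h in simp)
  moreover have "h * \<epsilon> \<le> h * (2 * f)" using \<epsilon>(2) h by (intro mult_left_mono) (auto simp: f_def)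
  ultimately show ?thesis
    using A1 B1 unfolding f_def[symmetric] A_def[symmetric] B_def[symmetric]
    by (simp add: power2_eq_square algebra_simps)
qed

text \<open>
  The bound is the largest possible increase of \<open>\<Phi>\<close> from \<open>- (M\<^sup>2 + K * M)\<close> to \<open>M\<^sup>2\<close>.
\<close>

lemma pursuit_time_bound:
  assumes "0 \<le> T"
    and x: "x ` {0..T} \<subseteq> closure D" "1-lipschitz_on {0..T} x"
    and y: "y ` {0..T} \<subseteq> closure D" "1-lipschitz_on {0..T} y"
    and \<epsilon>: "0 < \<epsilon>" and apart: "\<And>t. t \<in> {0..T} \<Longrightarrow> \<epsilon> / 2 < d (x t) (y t)"
    and lion: "\<And>e. 0 < e \<Longrightarrow> \<exists>\<delta>'>0. \<forall>s t. 0 \<le> s \<and> s \<le> t \<and> t \<le> T \<and> t - s \<le> \<delta>' \<longrightarrow>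
      norm (x t - x s - (t - s) *\<^sub>R direction (x s) (y s)) \<le> e * (t - s)"
    and M: "\<And>a b. a \<in> closure D \<Longrightarrow> b \<in> closure D \<Longrightarrow> d a b \<le> M"
  shows "\<epsilon> / 2 * T \<le> 2 * M\<^sup>2 + 8 * M\<^sup>2 / \<epsilon> * M"
proof -
  define K where "K = 8 * M\<^sup>2 / \<epsilon>"
  define p where "p = x 0"
  define \<Phi> where "\<Phi> t = (d p (y t))\<^sup>2 - (d p (x t))\<^sup>2 - K * d (x t) (y t)" for t
  have x_cl: "x t \<in> closure D" and y_cl: "y t \<in> closure D" if "t \<in> {0..T}" for t using that x y by auto
  have p: "p \<in> closure D" using x_cl[of 0] \<open>0 \<le> T\<close> by (simp add: p_def)
  have M0: "0 \<le> M" using M[OF p p] d_self[OF p] by simp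
  have K0: "0 \<le> K" using \<epsilon> by (simp add: K_def)
  have "continuous_on {0..T} \<Phi>"
    unfolding continuous_on_def
  proof
    fix t assume t: "t \<in> {0..T}"
    have lim: "(x \<longlongrightarrow> x t) (at t within {0..T})" "(y \<longlongrightarrow> y t) (at t within {0..T})"
      using lipschitz_on_continuous_on[OF x(2)] lipschitz_on_continuous_on[OF y(2)] t
      by (auto simp: continuous_on_def)
    have ev: "\<forall>\<^sub>F s in at t within {0..T}. x s \<in> closure D" "\<forall>\<^sub>F s in at t within {0..T}. y s \<in> closure D"
      by (auto simp: eventually_at_filter intro!: always_eventually x_cl y_cl)
    show "(\<Phi> \<longlongrightarrow> \<Phi> t) (at t within {0..T})"
      unfolding \<Phi>_def
      by (intro tendsto_intros tendsto_d lim ev x_cl[OF t] y_cl[OF t] p tendsto_const always_eventually allI)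
  qed
  moreover have "\<forall>\<^sub>F h in at_right 0. \<Phi> t + h * (\<epsilon> / 2 - e) \<le> \<Phi> (t + h)"
    if t: "0 \<le> t" "t < T" and e: "0 < e" for t e
  proof -
    have tT: "t \<in> {0..T}" using t by simp
    define f where "f = d (x t) (y t)"
    have f: "\<epsilon> / 2 < f" using apart[OF tT] by (simp add: f_def)
    have ne: "x t \<noteq> y t" using f \<epsilon> d_self[OF x_cl[OF tT]] by (auto simp: f_def)
    obtain \<gamma> where \<gamma>: "geod (x t) (y t) \<gamma>" using geod_exists[OF x_cl[OF tT] y_cl[OF tT]] .
    (* The Lion is within \<theta> h of the geodesic for small h; this \<theta> uses up half of the slack e. *)
    define \<theta> where "\<theta> = e / (2 * (2 * M + K + 1))"
    have \<theta>: "0 < \<theta>" using e M0 K0 by (simp add: \<theta>_def)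
    have "(2 * M + K) * \<theta> \<le> (2 * M + K + 1) * \<theta>" using \<theta> by simp
    also have "\<dots> = e / 2"
    proof -
      have "c * (e / (2 * c)) = e / 2" if "0 < c" for c using that by simp
      moreover have "0 < 2 * M + K + 1" using M0 K0 by simp
      ultimately show ?thesis unfolding \<theta>_def by blast
    qed
    finally have \<theta>_small: "2 * M * \<theta> + K * \<theta> \<le> e / 2" by (simp add: algebra_simps)
    obtain \<delta>' where \<delta>': "0 < \<delta>'" "\<And>s t. 0 \<le> s \<Longrightarrow> s \<le> t \<Longrightarrow> t \<le> T \<Longrightarrow> t - s \<le> \<delta>' \<Longrightarrow>
        norm (x t - x s - (t - s) *\<^sub>R direction (x s) (y s)) \<le> \<theta> / 4 * (t - s)"
      using lion[of "\<theta> / 4"] \<theta> by auto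
    have lim1: "((\<lambda>h. 8 * h + \<theta>\<^sup>2 * h + K * sqrt (h / f)) \<longlongrightarrow> 0) (at_right 0)"
      using f \<epsilon> by (auto intro!: tendsto_eq_intros)
    have lim2: "((\<lambda>h. velocity_const * sqrt h) \<longlongrightarrow> 0) (at_right 0)" by (auto intro!: tendsto_eq_intros)
    have lim3: "((\<lambda>h. \<theta> / 2 * h) \<longlongrightarrow> 0) (at_right 0)" by (auto intro!: tendsto_eq_intros)
    have "\<forall>\<^sub>F h in at_right 0. 8 * h + \<theta>\<^sup>2 * h + K * sqrt (h / f) < e / 2"
      using e by (intro order_tendstoD(2)[OF lim1]) simp
    moreover have "\<forall>\<^sub>F h in at_right 0. velocity_const * sqrt h < \<theta> / 4"
      using \<theta> by (intro order_tendstoD(2)[OF lim2]) simp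
    moreover have "\<forall>\<^sub>F h in at_right 0. \<theta> / 2 * h < \<rho>"
      using \<rho>_pos by (intro order_tendstoD(2)[OF lim3])
    moreover have "\<forall>\<^sub>F h in at_right 0. h \<in> {0<..<min (min (\<rho> / 2) \<delta>') (min (T - t) (f / 2))}"
      using \<rho>_pos \<delta>' t f \<epsilon> by (intro eventually_at_right_real) auto
    ultimately show ?thesis
    proof eventually_elim
      case (elim h)
      then have h: "0 < h" "h \<le> \<rho> / 2" "h \<le> \<delta>'" "t + h \<le> T" "2 * h \<le> f" by auto
      have th: "t + h \<in> {0..T}" using h t by simp
      have 1: "norm (x (t + h) - x t - h *\<^sub>R direction (x t) (y t)) \<le> \<theta> / 4 * h"
        using \<delta>'(2)[of t "t + h"] h t by simp
      have "norm (\<gamma> h - x t - h *\<^sub>R direction (x t) (y t)) \<le> velocity_const * h * sqrt h"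
        using h by (intro geodesic_direction_expansion(2)[OF x_cl[OF tT] y_cl[OF tT] ne \<gamma>]) (auto simp: f_def)
      also have "\<dots> \<le> \<theta> / 4 * h"
        using elim(2) h(1) mult_right_mono[of "velocity_const * sqrt h" "\<theta> / 4" h] by (simp add: mult_ac)
      finally have 2: "norm (\<gamma> h - x t - h *\<^sub>R direction (x t) (y t)) \<le> \<theta> / 4 * h" .
      have near: "dist (x (t + h)) (\<gamma> h) \<le> \<theta> / 2 * h"
        using norm_triangle_ineq4[of "x (t + h) - x t - h *\<^sub>R direction (x t) (y t)" "\<gamma> h - x t - h *\<^sub>R direction (x t) (y t)"] 1 2
        by (simp add: dist_norm)
      have "\<gamma> h \<in> closure D" using geodD(3)[OF \<gamma>, of h] h by (simp add: f_def)
      then have "d (x (t + h)) (\<gamma> h) \<le> 2 * dist (x (t + h)) (\<gamma> h)"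
        using near elim(3) x_cl[OF th] by (intro d_le_two_dist) auto
      then have lion_near: "d (x (t + h)) (\<gamma> h) \<le> \<theta> * h" using near by simp
      have "d (y t) (y (t + h)) \<le> (t + h) - t"
      proof (rule d_le_of_lipschitz)
        show "y ` {t..t + h} \<subseteq> closure D" using y(1) t h by auto
        show "dist (y s) (y s') \<le> \<bar>s - s'\<bar>" if "s \<in> {t..t + h}" "s' \<in> {t..t + h}" for s s'
          using lipschitz_onD[OF y(2), of s s'] that t h by (simp add: dist_real_def)
      qed (use h in simp)
      then have man: "d (y t) (y (t + h)) \<le> h" by simp
      have "\<Phi> t + h * (\<epsilon> / 2 - (8 * h + 2 * M * \<theta> + \<theta>\<^sup>2 * h + K * (sqrt (h / f) + \<theta>))) \<le> \<Phi> (t + h)"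
        unfolding \<Phi>_def K_def f_def
        using h f \<theta>
        by (intro pursuit_step[OF x_cl[OF tT] y_cl[OF tT] x_cl[OF th] y_cl[OF th] p \<gamma> h(1) _ _ lion_near man M \<epsilon>])
           (auto simp: f_def)
      moreover have "h * (\<epsilon> / 2 - e) \<le> h * (\<epsilon> / 2 - (8 * h + 2 * M * \<theta> + \<theta>\<^sup>2 * h + K * (sqrt (h / f) + \<theta>)))"
        using elim(1) \<theta>_small h(1) by (intro mult_left_mono) (auto simp: algebra_simps)
      ultimately show ?case by simp
    qed
  qed
  ultimately have growth: "\<Phi> 0 + \<epsilon> / 2 * T \<le> \<Phi> T"
    by (rule growth_from_right_increments[OF \<open>0 \<le> T\<close>])
  have sq: "(d a b)\<^sup>2 \<le> M\<^sup>2" if "a \<in> closure D" "b \<in> closure D" for a b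
    using M[OF that] d_nonneg[OF that] by (intro power_mono)
  have ends: "0 \<in> {0..T}" "T \<in> {0..T}" using \<open>0 \<le> T\<close> by auto
  have "\<Phi> T \<le> M\<^sup>2"
    unfolding \<Phi>_def using sq[OF p y_cl[OF ends(2)]] K0 d_nonneg[OF x_cl[OF ends(2)] y_cl[OF ends(2)]]
    by (smt (verit) mult_nonneg_nonneg zero_le_power2)
  moreover have "- (M\<^sup>2 + K * M) \<le> \<Phi> 0"
  proof -
    have "K * d (x 0) (y 0) \<le> K * M" using M[OF x_cl[OF ends(1)] y_cl[OF ends(1)]] K0 by (rule mult_left_mono)
    then show ?thesis
      unfolding \<Phi>_def using sq[OF p x_cl[OF ends(1)]] zero_le_power2[of "d p (y 0)"] by linarith
  qed
  ultimately show ?thesis using growth by (simp add: K_def)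
qed

end

theorem proposition17:
  shows "\<exists>t\<^sub>c :: real \<Rightarrow> real \<Rightarrow> real.
    \<forall>(d :: nat) (D :: ell2 set) (r :: real) (\<delta> :: real) (\<alpha> :: real) (\<epsilon> :: real).
      2 \<le> d \<and> domain_in (Rd d) D \<and> bounded D \<and> CAT0_domain D \<and>
      uniform_exterior_sphere (Rd d) D r \<and> uniform_interior_cone (Rd d) D \<delta> \<alpha> \<and> 0 < \<epsilon> \<longrightarrow>
      0 < t\<^sub>c (intrinsic_diameter D) \<epsilon> \<and>
      (\<forall>(H :: real \<Rightarrow> ell2) (x :: real \<Rightarrow> ell2) (y :: real \<Rightarrow> ell2).
        H \<in> borel_measurable (lebesgue_on {0..}) \<and> (\<forall>t\<ge>0. H t \<in> Rd d \<and> norm (H t) = 1) \<and>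
        x 0 \<in> D \<and> y 0 \<in> D \<and> greedy_pursuit (Rd d) D r H x y \<longrightarrow>
        (\<exists>t. 0 \<le> t \<and> t < t\<^sub>c (intrinsic_diameter D) \<epsilon> \<and>
             intrinsic_dist D (x t) (y t) \<le> \<epsilon> / 2))"
proof -
  define tc :: "real \<Rightarrow> real \<Rightarrow> real"
    where "tc M \<epsilon> = 1 + 2 / \<epsilon> * (2 * M\<^sup>2 + 8 * M\<^sup>2 / \<epsilon> * \<bar>M\<bar>)" for M \<epsilon>
  show ?thesis
  proof (rule exI[of _ tc], intro allI impI, elim conjE, intro conjI allI impI, goal_cases)
    case (1 d D r \<delta> \<alpha> \<epsilon>)
    then show ?case by (auto simp: tc_def intro!: add_pos_nonneg)
  next
    case (2 d D r \<delta> \<alpha> \<epsilon> H x y)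
    then have dom: "domain_in (Rd d) D" "bounded D" "CAT0_domain D" "uniform_exterior_sphere (Rd d) D r"
      "uniform_interior_cone (Rd d) D \<delta> \<alpha>" "0 < \<epsilon>" "x 0 \<in> D" "greedy_pursuit (Rd d) D r H x y" by auto
    have "D \<subseteq> Rd d" using dom(1) openin_imp_subset by (auto simp: domain_in_def)
    then have "compact (closure D)" using dom(2) by (intro compact_closure_in_Rd)
    then interpret cat0_domain "Rd d" D r \<delta> \<alpha>
      using dom subspace_Rd closed_Rd by unfold_locales
    define M where "M = intrinsic_diameter D"
    have M: "intrinsic_dist D a b \<le> M" if "a \<in> closure D" "b \<in> closure D" for a b
      using d_le_diameter that by (simp add: M_def)
    have x0: "x 0 \<in> closure D" using dom(7) by (rule D_in_closure)
    have M0: "0 \<le> M" using M[OF x0 x0] d_self[OF x0] by simp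
    obtain Lx \<nu>x where xy: "x ` {0..} \<subseteq> closure D" "y ` {0..} \<subseteq> closure D"
        "1-lipschitz_on {0..} x" "1-lipschitz_on {0..} y"
      and refl: "reflection_term (Rd d) D r x Lx \<nu>x"
      and eq: "\<And>t. 0 \<le> t \<Longrightarrow> (\<forall>s\<in>{0..t}. x s \<noteq> y s) \<Longrightarrow>
        set_integrable lebesgue {0..t} (\<lambda>s. geodesic_direction D (x s) (y s)) \<and>
        x t = x 0 + (LINT s:{0..t}|lebesgue. geodesic_direction D (x s) (y s))
                  - (LINT s:{0<..t}|interval_measure Lx. \<nu>x s)"
      using dom(8) unfolding greedy_pursuit_def by blast
    show ?case
    proof (rule ccontr)
      assume "\<not> ?case"
      then have apart: "\<epsilon> / 2 < intrinsic_dist D (x t) (y t)" if "0 \<le> t" "t < tc M \<epsilon>" for t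
        using that by (auto simp: M_def not_le)
      (* The lower bound on the separation is only known strictly before the capture time. *)
      define T where "T = tc M \<epsilon> - 1 / 2"
      have T: "0 \<le> T" using M0 dom(6) by (auto simp: T_def tc_def intro!: add_nonneg_nonneg)
      have apart_T: "\<epsilon> / 2 < intrinsic_dist D (x t) (y t)" if "t \<in> {0..T}" for t
        using apart that by (simp add: T_def)
      have x: "x ` {0..T} \<subseteq> closure D" "1-lipschitz_on {0..T} x"
        and y: "y ` {0..T} \<subseteq> closure D" "1-lipschitz_on {0..T} y"
        using xy by (auto intro: lipschitz_on_subset)
      have ne: "x t \<noteq> y t" if "t \<in> {0..T}" for t
      proof
        assume "x t = y t"
        moreover have "y t \<in> closure D" using y(1) that by auto
        ultimately show False using apart_T[OF that] d_self[of "y t"] dom(6) by simp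
      qed
      have eq_T: "set_integrable lebesgue {0..t} (\<lambda>s. geodesic_direction D (x s) (y s))"
        "x t = x 0 + (LINT s:{0..t}|lebesgue. geodesic_direction D (x s) (y s))
                  - (LINT s:{0<..t}|interval_measure Lx. \<nu>x s)" if "t \<in> {0..T}" for t
        using eq[of t] ne that by auto
      have "\<epsilon> / 2 * T \<le> 2 * M\<^sup>2 + 8 * M\<^sup>2 / \<epsilon> * M"
      proof (rule pursuit_time_bound[OF T x y dom(6) apart_T _ M])
        fix e :: real assume "0 < e"
        obtain \<delta>' where "0 < \<delta>'" "\<And>s t. 0 \<le> s \<Longrightarrow> s \<le> t \<Longrightarrow> t \<le> T \<Longrightarrow> t - s \<le> \<delta>' \<Longrightarrow>
            norm (x t - x s - (t - s) *\<^sub>R geodesic_direction D (x s) (y s)) \<le> e * (t - s)"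
          by (rule lion_follows_direction[OF x y ne refl eq_T \<open>0 < e\<close>], assumption, assumption, assumption, rule that) blast+
        then show "\<exists>\<delta>'>0. \<forall>s t. 0 \<le> s \<and> s \<le> t \<and> t \<le> T \<and> t - s \<le> \<delta>' \<longrightarrow>
            norm (x t - x s - (t - s) *\<^sub>R geodesic_direction D (x s) (y s)) \<le> e * (t - s)"
          by blast
      qed
      moreover have "\<epsilon> / 2 * T = \<epsilon> / 4 + (2 * M\<^sup>2 + 8 * M\<^sup>2 / \<epsilon> * M)"
        using dom(6) M0 by (simp add: T_def tc_def field_simps)
      ultimately show False using dom(6) by simp
    qed
  qed
qed

end
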